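(* If $M$ is a cocomplete category, then $M$ is a (dependent right) $Cat$-module in the following way. For every $x:U\to Cat$ in $hCAT$ define a function $$\sum^{x}:\mathrm{Hom}_{hCAT}(\llbracket x\rrbracket,M)\to\mathrm{Hom}_{hCAT}(U,M)$$ as follows: for $f:\llbracket x\rrbracket\to M$ let $(\sum^x f)^\heartsuit:U\to M$ be the functor sending $u\in U$ to $\mathrm{colim}_{i\in x(u)}f(u,i)$ and sending a morphism $\alpha:u\to v$ in $U$ to the canonical map $\mathrm{colim}_{i\in x(u)}f(u,i)\to\mathrm{colim}_{i\in x(v)}f(v,i)$ in $M$, and put $\sum^x f:=\mathrm{Ho}((\sum^x f)^\heartsuit)$. With these dependent sum functions, $M$ is a dependent right module, in $hCAT$, over the dependent adder $Cat$ (small categories with oplax colimits as dependent sums).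
   Context: Fix strongly inaccessible cardinals $\kappa_0<\kappa_1$. A category is small if it is smaller than $\kappa_0$, moderately small if it is smaller than $\kappa_1$. $Cat$ and $CAT$ are the $1$-categories of small, respectively moderately small, categories. $M$ is an object of $hCAT$, i.e. moderately small. The category $hCAT$: for moderately small $I,J$ let $\mathrm{Hom}_{hCAT}(I,J)$ be a skeleton of the category of functors $I\to J$, so that for every functor $G:I\to J$ there is exactly one $\mathrm{Ho}(G)\in\mathrm{Hom}_{hCAT}(I,J)$ with $G\cong\mathrm{Ho}(G)$. Objects of $hCAT$ are the moderately small categories, morphisms are the elements of $\mathrm{Hom}_{hCAT}(I,J)$, and composites are $\mathrm{Ho}$ of the composites in $CAT$. $hCAT$ has finite limits, and pullbacks in $CAT$ of Grothendieck opfibrations are also pullbacks in $hCAT$. Oplax colimits: for a functor $f:I\to CAT$, $\mathrm{colim}^{oplax}_{i\in I}f(i)$ is the category with objects the pairs $(i,j)$, $j\in f(i)$, and morphisms $(i,j)\to(i',j')$ the pairs $(\alpha,\beta)$ with $\alpha:i\to i'$ in $I$ and $\beta:f(\alpha)(j)\to j'$ in $f(i')$. The dependent adder $A=Cat$ in $hCAT$: the inclusion $Cat\to CAT$ corresponds to a Grothendieck opfibration $p^\heartsuit:F\to Cat$ with fiber over $I$ isomorphic to $I$; $p=\mathrm{Ho}(p^\heartsuit)$. The unit $1_F:1\to F$ is $\mathrm{Ho}$ of the functor picking out the terminal category $1\in Cat$ with its unique object; $1_A=p\circ 1_F$. For $x:U\to Cat$ in $hCAT$, $\llbracket x\rrbracket$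 is the pullback of $x$ and $p$ in $hCAT$, and $\llbracket x\rrbracket\cong\mathrm{colim}^{oplax}_{u\in U}x(u)$. For $f:\llbracket x\rrbracket\to Cat$, $\sum^x f:U\to Cat$ is $\mathrm{Ho}$ of the functor $u\mapsto\mathrm{colim}^{oplax}_{i\in x(u)}f(u,i)$, whose action on $\alpha:u\to v$ is induced by the composites $f(u,i)\to f(v,x(\alpha)(i))\to\mathrm{colim}^{oplax}_{k\in x(v)}f(v,k)$, the first functor being $f(\alpha,\mathrm{id}_{x(\alpha)(i)})$. The flattening map $f^\flat:\llbracket f\rrbracket\to\llbracket\sum^x f\rrbracket$ is $\mathrm{Ho}$ of the canonical isomorphism $\mathrm{colim}^{oplax}_{(u,i)\in\mathrm{colim}^{oplax}_{u\in U}x(u)}f(u,i)\to\mathrm{colim}^{oplax}_{u\in U}\mathrm{colim}^{oplax}_{i\in x(u)}f(u,i)$. Right modules: let $\mathscr{C}$ be a category with pullbacks and $A$ a dependent adder in $\mathscr{C}$, with $p:F\to A$, $\llbracket x\rrbracket=U\times_A F$ for $x:U\to A$, sums $\sum^x$, flattening maps $f^\flat$ and unit $1_A$. A dependent right $A$-module consists of an object $M$ of $\mathscr{C}$ and, for every $x:U\to A$, a function $\sum^x:\mathrm{Hom}_{\mathscr{C}}(\llbracket x\rrbracket,M)\to\mathrm{Hom}_{\mathscr{C}}(U,M)$, natural in $x\in\mathscr{C}/A$ (for all $h:U\to U'$ and $y:U'\to A$ with $y\circ h=x$ in $\mathscr{C}$, $\sum^x(k\circ(h\times_A\mathrm{id}_F))=(\sum^y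 k)\circ h$ for all $k:\llbracket y\rrbracket\to M$), satisfying as equalities in $\mathscr{C}$: (Unit) for $x:U\to A$ and $f:\llbracket x\rrbracket\to M$, $\sum^{const_1}(f\circ const_1^\flat)=f$, where $const_1:\llbracket x\rrbracket\to A$ is the constant $1_A$ map; (Sum Associativity) for $x:U\to A$, $f:\llbracket x\rrbracket\to A$ and $g:\llbracket\sum^x f\rrbracket\to M$, $\sum^{\sum^x f}g=\sum^x\sum^f(g\circ f^\flat)$.
   Formalization: ⟦x⟧ need not be a pullback in hCAT (x picking discrete {0,1}). So h×id_F is read as every Ho of (u,i)↦(hu,t_u i), t a natural iso x≅y∘h; f^♭ uses any iso from u↦colim^oplax f(u,i) to Σ^x f, but for const_1 it must be the canonical projection (else Unit fails). *)

theory Defs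
  imports "HOL-Library.FuncSet"
begin

unbundle cardinal_syntax

section \<open>Two strongly inaccessible cardinals\<close>

definition strongly_inaccessible :: "'a rel \<Rightarrow> bool" where
  "strongly_inaccessible r \<longleftrightarrow>
     Card_order r \<and> natLeq <o r \<and> regularCard r \<and>
     (\<forall>A :: 'a set. |A| <o r \<longrightarrow> |Pow A| <o r)"

text \<open>
  A type of this class is the cumulative hierarchy \<open>V\<^bsub>kappa1\<^esub>\<close>: \<open>elts\<close> sends a set to the set of
  its elements, and precisely the collections of fewer than \<open>kappa1\<close> sets are sets. Everything that
  is smaller than \<open>kappa1\<close> lives in such a type; no instance is declared, as the existence of
  inaccessible cardinals is not provable.
\<close>

class two_inaccessibles =
  fixes elts :: "'a \<Rightarrow> 'a set"
    and kappa0 :: "'a rel"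
    and kappa1 :: "'a rel"
  assumes kappa0_inaccessible: "strongly_inaccessible kappa0"
    and kappa1_inaccessible: "strongly_inaccessible kappa1"
    and kappa0_less_kappa1: "kappa0 <o kappa1"
    and inj_elts: "inj elts"
    and range_elts: "range elts = {A. |A| <o kappa1}"
    and wf_elts: "wf {(x, y). x \<in> elts y}"

text \<open>The members of \<open>V\<^bsub>kappa0\<^esub>\<close>: the sets that are hereditarily smaller than \<open>kappa0\<close>.\<close>

inductive small_set :: "'u::two_inaccessibles \<Rightarrow> bool" where
  "(\<And>y. y \<in> elts x \<Longrightarrow> small_set y) \<Longrightarrow> |elts x| <o (kappa0 :: 'u rel) \<Longrightarrow> small_set x"

definition vset :: "'u::two_inaccessibles set \<Rightarrow> 'u" where
  "vset A = inv elts A"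

definition vpair :: "'u::two_inaccessibles \<Rightarrow> 'u \<Rightarrow> 'u" where
  "vpair a b = vset {vset {a}, vset {a, b}}"

definition vfst :: "'u::two_inaccessibles \<Rightarrow> 'u" where
  "vfst z = (THE a. \<exists>b. z = vpair a b)"

definition vsnd :: "'u::two_inaccessibles \<Rightarrow> 'u" where
  "vsnd z = (THE b. \<exists>a. z = vpair a b)"

definition vgraph :: "'u::two_inaccessibles set \<Rightarrow> ('u \<Rightarrow> 'u) \<Rightarrow> 'u" where
  "vgraph A f = vset ((\<lambda>a. vpair a (f a)) ` A)"


section \<open>Categories, functors, natural isomorphisms, colimits\<close>

text \<open>\<open>Cmp C g f\<close> is the composite of \<open>f\<close> followed by \<open>g\<close>.\<close>

record ('o, 'a) cat =
  Obj :: "'o set"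
  Arr :: "'a set"
  Dom :: "'a \<Rightarrow> 'o"
  Cod :: "'a \<Rightarrow> 'o"
  Ident :: "'o \<Rightarrow> 'a"
  Cmp :: "'a \<Rightarrow> 'a \<Rightarrow> 'a"

definition hom :: "('o, 'a) cat \<Rightarrow> 'o \<Rightarrow> 'o \<Rightarrow> 'a set" where
  "hom C a b = {f \<in> Arr C. Dom C f = a \<and> Cod C f = b}"

text \<open>
  The structure maps are required to be \<open>undefined\<close> outside their domains, so that two categories
  are equal iff they have the same objects, arrows and structure.
\<close>

definition category :: "('o, 'a) cat \<Rightarrow> bool" where
  "category C \<longleftrightarrow>
     Dom C \<in> Arr C \<rightarrow>\<^sub>E Obj C \<and> Cod C \<in> Arr C \<rightarrow>\<^sub>E Obj C \<and> Ident C \<in> Obj C \<rightarrow>\<^sub>E Arr C \<and>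
     (\<forall>a\<in>Obj C. Ident C a \<in> hom C a a) \<and>
     (\<forall>f\<in>Arr C. \<forall>g\<in>Arr C. Cod C f = Dom C g \<longrightarrow> Cmp C g f \<in> hom C (Dom C f) (Cod C g)) \<and>
     (\<forall>f g. \<not> (f \<in> Arr C \<and> g \<in> Arr C \<and> Cod C f = Dom C g) \<longrightarrow> Cmp C g f = undefined) \<and>
     (\<forall>f\<in>Arr C. Cmp C f (Ident C (Dom C f)) = f \<and> Cmp C (Ident C (Cod C f)) f = f) \<and>
     (\<forall>f\<in>Arr C. \<forall>g\<in>Arr C. \<forall>h\<in>Arr C. Cod C f = Dom C g \<longrightarrow> Cod C g = Dom C h \<longrightarrow>
        Cmp C h (Cmp C g f) = Cmp C (Cmp C h g) f)"

definition make_cat ::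
  "'o set \<Rightarrow> 'a set \<Rightarrow> ('a \<Rightarrow> 'o) \<Rightarrow> ('a \<Rightarrow> 'o) \<Rightarrow> ('o \<Rightarrow> 'a) \<Rightarrow> ('a \<Rightarrow> 'a \<Rightarrow> 'a) \<Rightarrow> ('o, 'a) cat" where
  "make_cat Ob Ar d c i m =
     \<lparr>Obj = Ob, Arr = Ar, Dom = restrict d Ar, Cod = restrict c Ar, Ident = restrict i Ob,
      Cmp = (\<lambda>g f. if f \<in> Ar \<and> g \<in> Ar \<and> c f = d g then m g f else undefined)\<rparr>"

definition is_iso :: "('o, 'a) cat \<Rightarrow> 'a \<Rightarrow> bool" where
  "is_iso C f \<longleftrightarrow> f \<in> Arr C \<and>
     (\<exists>g \<in> hom C (Cod C f) (Dom C f).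
        Cmp C g f = Ident C (Dom C f) \<and> Cmp C f g = Ident C (Cod C f))"

definition is_terminal :: "('o, 'a) cat \<Rightarrow> 'o \<Rightarrow> bool" where
  "is_terminal C t \<longleftrightarrow> t \<in> Obj C \<and> (\<forall>a\<in>Obj C. \<exists>!f. f \<in> hom C a t)"

type_synonym 'u ucat = "('u, 'u) cat"

record 'u func =
  Src :: "'u ucat"
  Tgt :: "'u ucat"
  FO :: "'u \<Rightarrow> 'u"
  FA :: "'u \<Rightarrow> 'u"

definition is_functor :: "'u func \<Rightarrow> bool" where
  "is_functor G \<longleftrightarrow>
     category (Src G) \<and> category (Tgt G) \<and>
     FO G \<in> Obj (Src G) \<rightarrow>\<^sub>E Obj (Tgt G) \<and> FA G \<in> Arr (Src G) \<rightarrow>\<^sub>E Arr (Tgt G) \<and>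
     (\<forall>f\<in>Arr (Src G). FA G f \<in> hom (Tgt G) (FO G (Dom (Src G) f)) (FO G (Cod (Src G) f))) \<and>
     (\<forall>a\<in>Obj (Src G). FA G (Ident (Src G) a) = Ident (Tgt G) (FO G a)) \<and>
     (\<forall>f\<in>Arr (Src G). \<forall>g\<in>Arr (Src G). Cod (Src G) f = Dom (Src G) g \<longrightarrow>
        FA G (Cmp (Src G) g f) = Cmp (Tgt G) (FA G g) (FA G f))"

definition make_fun :: "'u ucat \<Rightarrow> 'u ucat \<Rightarrow> ('u \<Rightarrow> 'u) \<Rightarrow> ('u \<Rightarrow> 'u) \<Rightarrow> 'u func" where
  "make_fun C D fo fa =
     \<lparr>Src = C, Tgt = D, FO = restrict fo (Obj C), FA = restrict fa (Arr C)\<rparr>"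

definition id_fun :: "'u ucat \<Rightarrow> 'u func" where
  "id_fun C = make_fun C C (\<lambda>a. a) (\<lambda>f. f)"

definition comp_fun :: "'u func \<Rightarrow> 'u func \<Rightarrow> 'u func"  (infixr \<open>\<odot>\<close> 70) where
  "G \<odot> F = make_fun (Src F) (Tgt G) (\<lambda>a. FO G (FO F a)) (\<lambda>f. FA G (FA F f))"

definition is_nat_iso :: "'u func \<Rightarrow> 'u func \<Rightarrow> ('u \<Rightarrow> 'u) \<Rightarrow> bool" where
  "is_nat_iso G H t \<longleftrightarrow>
     is_functor G \<and> is_functor H \<and> Src H = Src G \<and> Tgt H = Tgt G \<and>
     (\<forall>a\<in>Obj (Src G). t a \<in> hom (Tgt G) (FO G a) (FO H a) \<and> is_iso (Tgt G) (t a)) \<and>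
     (\<forall>f\<in>Arr (Src G). Cmp (Tgt G) (t (Cod (Src G) f)) (FA G f)
                     = Cmp (Tgt G) (FA H f) (t (Dom (Src G) f)))"

definition fun_iso :: "'u func \<Rightarrow> 'u func \<Rightarrow> bool"  (infix \<open>\<cong>\<^sub>F\<close> 50) where
  "G \<cong>\<^sub>F H \<longleftrightarrow> (\<exists>t. is_nat_iso G H t)"

definition is_cocone :: "'u func \<Rightarrow> 'u \<Rightarrow> ('u \<Rightarrow> 'u) \<Rightarrow> bool" where
  "is_cocone D l c \<longleftrightarrow>
     l \<in> Obj (Tgt D) \<and> (\<forall>i\<in>Obj (Src D). c i \<in> hom (Tgt D) (FO D i) l) \<and>
     (\<forall>f\<in>Arr (Src D). Cmp (Tgt D) (c (Cod (Src D) f)) (FA D f) = c (Dom (Src D) f))"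

definition is_colimit :: "'u func \<Rightarrow> 'u \<Rightarrow> ('u \<Rightarrow> 'u) \<Rightarrow> bool" where
  "is_colimit D l c \<longleftrightarrow>
     is_cocone D l c \<and>
     (\<forall>l' c'. is_cocone D l' c' \<longrightarrow>
        (\<exists>!m. m \<in> hom (Tgt D) l l' \<and> (\<forall>i\<in>Obj (Src D). Cmp (Tgt D) m (c i) = c' i)))"

definition colim :: "'u func \<Rightarrow> 'u" where
  "colim D = fst (SOME lc. is_colimit D (fst lc) (snd lc))"

definition colim_in :: "'u func \<Rightarrow> 'u \<Rightarrow> 'u" where
  "colim_in D = snd (SOME lc. is_colimit D (fst lc) (snd lc))"

definition small_cat :: "'u::two_inaccessibles ucat \<Rightarrow> bool" where
  "small_cat C \<longleftrightarrow> category C \<and> Obj C \<subseteq> Collect small_set \<and> Arr C \<subseteq> Collect small_set \<and>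
     |Obj C| <o (kappa0 :: 'u rel) \<and> |Arr C| <o (kappa0 :: 'u rel)"

definition moderately_small_cat :: "'u::two_inaccessibles ucat \<Rightarrow> bool" where
  "moderately_small_cat C \<longleftrightarrow> category C \<and>
     |Obj C| <o (kappa1 :: 'u rel) \<and> |Arr C| <o (kappa1 :: 'u rel)"

definition cocomplete :: "'u::two_inaccessibles ucat \<Rightarrow> bool" where
  "cocomplete M \<longleftrightarrow>
     (\<forall>D. is_functor D \<and> small_cat (Src D) \<and> Tgt D = M \<longrightarrow> (\<exists>l c. is_colimit D l c))"


section \<open>The category of small categories, as a moderately small category\<close>

text \<open>Small categories and the functors between them, coded as sets.\<close>

definition vcat :: "'u::two_inaccessibles ucat \<Rightarrow> 'u" where
  "vcat C =
     vpair (vset (Obj C)) (vpair (vset (Arr C))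
       (vpair (vgraph (Arr C) (Dom C)) (vpair (vgraph (Arr C) (Cod C))
         (vpair (vgraph (Obj C) (Ident C))
            (vset {vpair (vpair g f) (Cmp C g f) |g f.
                     f \<in> Arr C \<and> g \<in> Arr C \<and> Cod C f = Dom C g})))))"

definition cat_of :: "'u::two_inaccessibles \<Rightarrow> 'u ucat" where
  "cat_of c = (THE C. small_cat C \<and> vcat C = c)"

definition small_fun :: "'u::two_inaccessibles func \<Rightarrow> bool" where
  "small_fun G \<longleftrightarrow> is_functor G \<and> small_cat (Src G) \<and> small_cat (Tgt G)"

definition vfun :: "'u::two_inaccessibles func \<Rightarrow> 'u" where
  "vfun G = vpair (vcat (Src G)) (vpair (vcat (Tgt G))
              (vpair (vgraph (Obj (Src G)) (FO G)) (vgraph (Arr (Src G)) (FA G))))"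

definition fun_of :: "'u::two_inaccessibles \<Rightarrow> 'u func" where
  "fun_of a = (THE G. small_fun G \<and> vfun G = a)"

definition Cat :: "'u::two_inaccessibles ucat" where
  "Cat = make_cat (vcat ` Collect small_cat) (vfun ` Collect small_fun)
     (\<lambda>a. vcat (Src (fun_of a))) (\<lambda>a. vcat (Tgt (fun_of a)))
     (\<lambda>c. vfun (id_fun (cat_of c))) (\<lambda>b a. vfun (fun_of b \<odot> fun_of a))"

definition one_cat :: "'u::two_inaccessibles ucat" where
  "one_cat = make_cat {vset {}} {vset {}}
     (\<lambda>_. vset {}) (\<lambda>_. vset {}) (\<lambda>_. vset {}) (\<lambda>_ _. vset {})"


section \<open>Oplax colimits\<close>

text \<open>
  \<open>oplax I D E\<close> is the oplax colimit of the functor from \<open>I\<close> to moderately small categories with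
  object part \<open>D\<close> and arrow part \<open>E\<close>. A pair \<open>(\<alpha>, \<beta>)\<close> does not determine the source \<open>(i, j)\<close>
  of the arrow it denotes, so arrows are coded as \<open>((i, j), (\<alpha>, \<beta>))\<close>.
\<close>

definition oplax ::
  "'u::two_inaccessibles ucat \<Rightarrow> ('u \<Rightarrow> 'u ucat) \<Rightarrow> ('u \<Rightarrow> 'u func) \<Rightarrow> 'u ucat" where
  "oplax I D E = make_cat
     {vpair i j |i j. i \<in> Obj I \<and> j \<in> Obj (D i)}
     {vpair (vpair i j) (vpair \<alpha> \<beta>) |i j \<alpha> \<beta>.
        \<alpha> \<in> Arr I \<and> Dom I \<alpha> = i \<and> j \<in> Obj (D i) \<and>
        \<beta> \<in> Arr (D (Cod I \<alpha>)) \<and> Dom (D (Cod I \<alpha>)) \<beta> = FO (E \<alpha>) j}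
     vfst
     (\<lambda>a. let \<alpha> = vfst (vsnd a); \<beta> = vsnd (vsnd a)
          in vpair (Cod I \<alpha>) (Cod (D (Cod I \<alpha>)) \<beta>))
     (\<lambda>s. vpair s (vpair (Ident I (vfst s)) (Ident (D (vfst s)) (vsnd s))))
     (\<lambda>b a. let \<alpha> = vfst (vsnd a); \<beta> = vsnd (vsnd a); \<alpha>' = vfst (vsnd b); \<beta>' = vsnd (vsnd b)
            in vpair (vfst a)
                 (vpair (Cmp I \<alpha>' \<alpha>) (Cmp (D (Cod I \<alpha>')) \<beta>' (FA (E \<alpha>') \<beta>))))"

text \<open>For \<open>x : U \<rightarrow> Cat\<close>, \<open>gr x\<close> is the oplax colimit of \<open>x\<close>; it is \<open>\<lbrakk>x\<rbrakk>\<close> below.\<close>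

definition gr :: "'u::two_inaccessibles func \<Rightarrow> 'u ucat" where
  "gr x = oplax (Src x) (\<lambda>u. cat_of (FO x u)) (\<lambda>\<alpha>. fun_of (FA x \<alpha>))"

definition gr_proj :: "'u::two_inaccessibles func \<Rightarrow> 'u func" where
  "gr_proj x = make_fun (gr x) (Src x) vfst (\<lambda>a. vfst (vsnd a))"

text \<open>The functor \<open>(u, i) \<mapsto> (u, t\<^sub>u i)\<close> induced by a natural transformation \<open>t : x \<rightarrow> y\<close>.\<close>

definition gr_map :: "'u::two_inaccessibles func \<Rightarrow> 'u func \<Rightarrow> ('u \<Rightarrow> 'u) \<Rightarrow> 'u func" where
  "gr_map x y t =
     (let ob = (\<lambda>s. vpair (vfst s) (FO (fun_of (t (vfst s))) (vsnd s)))
      in make_fun (gr x) (gr y) ob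
           (\<lambda>a. let \<alpha> = vfst (vsnd a); \<beta> = vsnd (vsnd a)
                in vpair (ob (vfst a))
                     (vpair \<alpha> (FA (fun_of (t (Cod (Src x) \<alpha>))) \<beta>))))"

text \<open>For \<open>h : U \<rightarrow> U'\<close> and \<open>y : U' \<rightarrow> Cat\<close>, the functor \<open>(u, i) \<mapsto> (h u, i)\<close>.\<close>

definition gr_reindex :: "'u::two_inaccessibles func \<Rightarrow> 'u func \<Rightarrow> 'u func" where
  "gr_reindex y h =
     (let ob = (\<lambda>s. vpair (FO h (vfst s)) (vsnd s))
      in make_fun (gr (y \<odot> h)) (gr y) ob
           (\<lambda>a. vpair (ob (vfst a)) (vpair (FA h (vfst (vsnd a))) (vsnd (vsnd a)))))"

text \<open>
  The inclusion of the fibre \<open>x(u)\<close> into \<open>\<lbrakk>x\<rbrakk>\<close>; thus \<open>f \<odot> fibre x u\<close> is \<open>i \<mapsto> f(u, i)\<close>.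
\<close>

definition fibre :: "'u::two_inaccessibles func \<Rightarrow> 'u \<Rightarrow> 'u func" where
  "fibre x u = make_fun (cat_of (FO x u)) (gr x) (vpair u)
     (\<lambda>\<beta>. vpair (vpair u (Dom (cat_of (FO x u)) \<beta>)) (vpair (Ident (Src x) u) \<beta>))"

text \<open>The arrow \<open>(\<alpha>, id) : (u, i) \<rightarrow> (v, x(\<alpha>)(i))\<close> of \<open>\<lbrakk>x\<rbrakk>\<close>, for \<open>\<alpha> : u \<rightarrow> v\<close>.\<close>

definition gr_lift :: "'u::two_inaccessibles func \<Rightarrow> 'u \<Rightarrow> 'u \<Rightarrow> 'u" where
  "gr_lift x \<alpha> i =
     vpair (vpair (Dom (Src x) \<alpha>) i)
       (vpair \<alpha> (Ident (cat_of (FO x (Cod (Src x) \<alpha>))) (FO (fun_of (FA x \<alpha>)) i)))"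

text \<open>
  The functor \<open>u \<mapsto> colim\<^sup>o\<^sup>p\<^sup>l\<^sup>a\<^sup>x\<^bsub>i \<in> x(u)\<^esub> f(u, i)\<close>. Its value at \<open>\<alpha> : u \<rightarrow> v\<close> sends \<open>(i, j)\<close> to
  \<open>(x(\<alpha>)(i), f(\<alpha>, id)(j))\<close> and an arrow \<open>(\<beta>, \<gamma>)\<close> with \<open>\<beta> : i \<rightarrow> i'\<close> to
  \<open>(x(\<alpha>)(\<beta>), f(\<alpha>, id\<^bsub>x(\<alpha>)(i')\<^esub>)(\<gamma>))\<close>.
\<close>

definition oplax_sum :: "'u::two_inaccessibles func \<Rightarrow> 'u func \<Rightarrow> 'u func" where
  "oplax_sum x f = make_fun (Src x) Cat
     (\<lambda>u. vcat (gr (f \<odot> fibre x u)))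
     (\<lambda>\<alpha>. let u = Dom (Src x) \<alpha>; v = Cod (Src x) \<alpha>; x\<alpha> = fun_of (FA x \<alpha>);
              ob = (\<lambda>s. vpair (FO x\<alpha> (vfst s))
                              (FO (fun_of (FA f (gr_lift x \<alpha> (vfst s)))) (vsnd s)))
          in vfun (make_fun (gr (f \<odot> fibre x u)) (gr (f \<odot> fibre x v)) ob
               (\<lambda>a. let \<beta> = vfst (vsnd a); \<gamma> = vsnd (vsnd a)
                    in vpair (ob (vfst a))
                         (vpair (FA x\<alpha> \<beta>)
                            (FA (fun_of (FA f (gr_lift x \<alpha> (Cod (cat_of (FO x u)) \<beta>)))) \<gamma>)))))"

text \<open>
  The canonical isomorphism \<open>((u, i), j) \<mapsto> (u, (i, j))\<close> from \<open>\<lbrakk>f\<rbrakk>\<close> to the oplax colimit of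
  \<open>oplax_sum x f\<close>; an arrow \<open>((\<alpha>, \<beta>), \<gamma>)\<close> goes to \<open>(\<alpha>, (\<beta>, \<gamma>))\<close>.
\<close>

definition flatten_fun :: "'u::two_inaccessibles func \<Rightarrow> 'u func \<Rightarrow> 'u func" where
  "flatten_fun x f =
     (let ob = (\<lambda>s. vpair (vfst (vfst s)) (vpair (vsnd (vfst s)) (vsnd s)))
      in make_fun (gr f) (gr (oplax_sum x f)) ob
           (\<lambda>a. let \<alpha> = vfst (vsnd (vfst (vsnd a))); \<beta> = vsnd (vsnd (vfst (vsnd a)));
                    \<gamma> = vsnd (vsnd a)
                in vpair (ob (vfst a))
                     (vpair \<alpha>
                        (vpair (FO (fun_of (FA (oplax_sum x f) \<alpha>)) (vsnd (ob (vfst a))))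
                               (vpair \<beta> \<gamma>)))))"


section \<open>The category hCAT\<close>

definition skeleton_choice :: "('u::two_inaccessibles func \<Rightarrow> 'u func) \<Rightarrow> bool" where
  "skeleton_choice Ho \<longleftrightarrow>
     (\<forall>G. is_functor G \<and> moderately_small_cat (Src G) \<and> moderately_small_cat (Tgt G) \<longrightarrow>
        G \<cong>\<^sub>F Ho G \<and> (\<forall>H. G \<cong>\<^sub>F H \<longrightarrow> Ho H = Ho G))"

definition hCAT :: "('u::two_inaccessibles func \<Rightarrow> 'u func) \<Rightarrow> ('u ucat, 'u func) cat" where
  "hCAT Ho = make_cat (Collect moderately_small_cat)
     {G. is_functor G \<and> moderately_small_cat (Src G) \<and> moderately_small_cat (Tgt G) \<and> Ho G = G}
     Src Tgt (\<lambda>I. Ho (id_fun I)) (\<lambda>G F. Ho (G \<odot> F))"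


section \<open>Dependent adders and dependent right modules\<close>

text \<open>
  The data carried by a dependent adder \<open>A\<close> in a category: \<open>p : F \<rightarrow> A\<close>, the objects
  \<open>\<lbrakk>x\<rbrakk> = U \<times>\<^sub>A F\<close> with their projections to \<open>U\<close> and \<open>F\<close>, sums, flattening maps and the unit
  \<open>1\<^sub>F : 1 \<rightarrow> F\<close>. The maps \<open>h \<times>\<^sub>A id\<^sub>F : \<lbrakk>y \<circ> h\<rbrakk> \<rightarrow> \<lbrakk>y\<rbrakk>\<close> are data as well: if the \<open>\<lbrakk>x\<rbrakk>\<close> are
  pullbacks, then \<open>adder_data\<close> below forces \<open>ad_pair A y h\<close> to consist of the unique such map;
  but in \<open>hCAT\<close> a map into \<open>\<lbrakk>y\<rbrakk>\<close> is not determined by its two projections.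
\<close>

record ('o, 'a) adder =
  ad_obj :: 'o
  ad_F :: 'o
  ad_p :: 'a
  ad_unit :: 'a
  ad_ext :: "'a \<Rightarrow> 'o"
  ad_prU :: "'a \<Rightarrow> 'a"
  ad_prF :: "'a \<Rightarrow> 'a"
  ad_pair :: "'a \<Rightarrow> 'a \<Rightarrow> 'a set"
  ad_sum :: "'a \<Rightarrow> 'a \<Rightarrow> 'a"
  ad_flat :: "'a \<Rightarrow> 'a \<Rightarrow> 'a"

text \<open>The constant map \<open>X \<rightarrow> 1 \<rightarrow> B\<close> at a global element \<open>e : 1 \<rightarrow> B\<close>.\<close>

definition const_map :: "('o, 'a) cat \<Rightarrow> 'a \<Rightarrow> 'o \<Rightarrow> 'a" where
  "const_map C e X = Cmp C e (THE t. t \<in> hom C X (Dom C e))"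

definition ad_const :: "('o, 'a) cat \<Rightarrow> ('o, 'a) adder \<Rightarrow> 'a \<Rightarrow> 'a" where
  "ad_const C A x = const_map C (Cmp C (ad_p A) (ad_unit A)) (ad_ext A x)"

definition adder_data :: "('o, 'a) cat \<Rightarrow> ('o, 'a) adder \<Rightarrow> bool" where
  "adder_data C A \<longleftrightarrow>
     category C \<and>
     ad_p A \<in> hom C (ad_F A) (ad_obj A) \<and>
     (\<exists>t. is_terminal C t \<and> ad_unit A \<in> hom C t (ad_F A)) \<and>
     (\<forall>U x. x \<in> hom C U (ad_obj A) \<longrightarrow>
        ad_prU A x \<in> hom C (ad_ext A x) U \<and> ad_prF A x \<in> hom C (ad_ext A x) (ad_F A) \<and>
        Cmp C x (ad_prU A x) = Cmp C (ad_p A) (ad_prF A x)) \<and>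
     (\<forall>U V h y. h \<in> hom C U V \<and> y \<in> hom C V (ad_obj A) \<longrightarrow>
        ad_pair A y h \<noteq> {} \<and>
        (\<forall>w\<in>ad_pair A y h.
           w \<in> hom C (ad_ext A (Cmp C y h)) (ad_ext A y) \<and>
           Cmp C (ad_prU A y) w = Cmp C h (ad_prU A (Cmp C y h)) \<and>
           Cmp C (ad_prF A y) w = ad_prF A (Cmp C y h))) \<and>
     (\<forall>U x f. x \<in> hom C U (ad_obj A) \<and> f \<in> hom C (ad_ext A x) (ad_obj A) \<longrightarrow>
        ad_sum A x f \<in> hom C U (ad_obj A) \<and>
        ad_flat A x f \<in> hom C (ad_ext A f) (ad_ext A (ad_sum A x f)) \<and>
        Cmp C (ad_prU A (ad_sum A x f)) (ad_flat A x f) = Cmp C (ad_prU A x) (ad_prU A f)) \<and>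
     (\<forall>U x. x \<in> hom C U (ad_obj A) \<longrightarrow> ad_sum A x (ad_const C A x) = x)"

text \<open>\<open>S x k\<close> is \<open>\<Sum>\<^sup>x k\<close>.\<close>

definition dependent_right_module ::
  "('o, 'a) cat \<Rightarrow> ('o, 'a) adder \<Rightarrow> 'o \<Rightarrow> ('a \<Rightarrow> 'a \<Rightarrow> 'a) \<Rightarrow> bool" where
  "dependent_right_module C A M S \<longleftrightarrow>
     adder_data C A \<and> M \<in> Obj C \<and>
     (\<forall>U x k. x \<in> hom C U (ad_obj A) \<and> k \<in> hom C (ad_ext A x) M \<longrightarrow> S x k \<in> hom C U M) \<and>
     (\<forall>U V h x y k w. h \<in> hom C U V \<and> y \<in> hom C V (ad_obj A) \<and> Cmp C y h = x \<and>
        k \<in> hom C (ad_ext A y) M \<and> w \<in> ad_pair A y h \<longrightarrow>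
        S x (Cmp C k w) = Cmp C (S y k) h) \<and>
     (\<forall>U x f. x \<in> hom C U (ad_obj A) \<and> f \<in> hom C (ad_ext A x) M \<longrightarrow>
        S (ad_const C A x) (Cmp C f (ad_flat A x (ad_const C A x))) = f) \<and>
     (\<forall>U x f g. x \<in> hom C U (ad_obj A) \<and> f \<in> hom C (ad_ext A x) (ad_obj A) \<and>
        g \<in> hom C (ad_ext A (ad_sum A x f)) M \<longrightarrow>
        S (ad_sum A x f) g = S x (S f (Cmp C g (ad_flat A x f))))"


section \<open>The dependent adder of small categories\<close>

definition univ_opfib :: "'u::two_inaccessibles func" where
  "univ_opfib = gr_proj (id_fun Cat)"

definition unit_fun :: "'u::two_inaccessibles func" where
  "unit_fun =
     (let s = vpair (vcat one_cat) (vset {})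
      in make_fun one_cat (gr (id_fun Cat)) (\<lambda>_. s) (\<lambda>_. Ident (gr (id_fun Cat)) s))"

text \<open>
  \<open>\<lbrakk>\<Sum>\<^sup>x f\<rbrakk>\<close> is formed from \<open>\<Sum>\<^sup>x f = Ho (oplax_sum x f)\<close> and not from \<open>oplax_sum x f\<close> itself, so
  the flattening maps involve isomorphisms \<open>eta x f\<close> between these two functors. They are
  arbitrary, except when \<open>f\<close> is constant at the unit: then \<open>\<Sum>\<^sup>x f = x\<close>, and \<open>eta x f\<close> is the
  projection \<open>colim\<^sup>o\<^sup>p\<^sup>l\<^sup>a\<^sup>x\<^bsub>i \<in> x(u)\<^esub> 1 \<rightarrow> x(u)\<close>. (Any other automorphism of \<open>x\<close> in its
  place would spoil the unit law.)
\<close>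

definition Cat_adder ::
  "('u::two_inaccessibles func \<Rightarrow> 'u func) \<Rightarrow> ('u func \<Rightarrow> 'u func \<Rightarrow> 'u \<Rightarrow> 'u)
     \<Rightarrow> ('u ucat, 'u func) adder" where
  "Cat_adder Ho eta =
     \<lparr>ad_obj = Cat,
      ad_F = gr (id_fun Cat),
      ad_p = Ho univ_opfib,
      ad_unit = Ho unit_fun,
      ad_ext = gr,
      ad_prU = (\<lambda>x. Ho (gr_proj x)),
      ad_prF = (\<lambda>x. Ho (gr_reindex (id_fun Cat) x)),
      ad_pair = (\<lambda>y h. {Ho (gr_reindex y h \<odot> gr_map (Ho (y \<odot> h)) (y \<odot> h) t) |t.
                          is_nat_iso (Ho (y \<odot> h)) (y \<odot> h) t}),
      ad_sum = (\<lambda>x f. Ho (oplax_sum x f)),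
      ad_flat = (\<lambda>x f. Ho (gr_map (oplax_sum x f) (Ho (oplax_sum x f)) (eta x f)
                              \<odot> flatten_fun x f))\<rparr>"

definition flattening_choice ::
  "('u::two_inaccessibles func \<Rightarrow> 'u func) \<Rightarrow> ('u func \<Rightarrow> 'u func \<Rightarrow> 'u \<Rightarrow> 'u) \<Rightarrow> bool" where
  "flattening_choice Ho eta \<longleftrightarrow>
     (\<forall>U x f. x \<in> hom (hCAT Ho) U Cat \<and> f \<in> hom (hCAT Ho) (gr x) Cat \<longrightarrow>
        is_nat_iso (oplax_sum x f) (Ho (oplax_sum x f)) (eta x f)) \<and>
     (\<forall>U x c. x \<in> hom (hCAT Ho) U Cat \<and> c = ad_const (hCAT Ho) (Cat_adder Ho eta) x \<longrightarrow>
        (\<forall>u\<in>Obj U. eta x c u = vfun (gr_proj (c \<odot> fibre x u))))"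


section \<open>Dependent sums in a cocomplete category\<close>

text \<open>
  The functor \<open>u \<mapsto> colim\<^bsub>i \<in> x(u)\<^esub> f(u, i)\<close>, for \<open>f : \<lbrakk>x\<rbrakk> \<rightarrow> M\<close>.
\<close>

definition colim_sum :: "'u::two_inaccessibles func \<Rightarrow> 'u func \<Rightarrow> 'u func" where
  "colim_sum x f = make_fun (Src x) (Tgt f)
     (\<lambda>u. colim (f \<odot> fibre x u))
     (\<lambda>\<alpha>. let Du = f \<odot> fibre x (Dom (Src x) \<alpha>); Dv = f \<odot> fibre x (Cod (Src x) \<alpha>)
          in THE m. m \<in> hom (Tgt f) (colim Du) (colim Dv) \<and>
               (\<forall>i\<in>Obj (Src Du).
                  Cmp (Tgt f) m (colim_in Du i) =
                  Cmp (Tgt f) (colim_in Dv (FO (fun_of (FA x \<alpha>)) i)) (FA f (gr_lift x \<alpha> i))))"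

end

theory Submission
  imports Defs
begin

text \<open>
  For \<open>x : U \<rightarrow> Cat\<close> and \<open>f : \<lbrakk>x\<rbrakk> \<rightarrow> M\<close>, the functor \<open>u \<mapsto> colim\<^bsub>i \<in> x(u)\<^esub> f(u, i)\<close> is a pointwise left Kan
  extension of \<open>f\<close> along the projection \<open>\<lbrakk>x\<rbrakk> \<rightarrow> U\<close>. Such an extension is unique up to isomorphism
  (\<open>left_kan_unique\<close>), and isomorphic functors become equal in \<open>hCAT\<close>. Each axiom of a right module
  therefore reduces to exhibiting one functor, with a suitable cocone, as the same left Kan
  extension as another.

  Four stability properties of left Kan extensions suffice. They may be transported along an
  isomorphism of the extended functor (\<open>left_kan_iso\<close>), which absorbs every choice of
  representatives made by \<open>Ho\<close> in \<open>M\<close>. They are stable under base change along a functor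
  \<open>h : U \<rightarrow> V\<close> and under replacing \<open>x\<close> by an isomorphic family (both are instances of
  \<open>left_kan_pullback\<close>); together these give naturality in \<open>x\<close>. For a family \<open>c\<close> of one-arrow
  categories, \<open>f\<close> is the left Kan extension of its composite with the projection
  \<open>\<lbrakk>c\<rbrakk> \<rightarrow> \<lbrakk>x\<rbrakk>\<close> (\<open>left_kan_unit\<close>); this gives the unit law, as the flattening map of the family that
  is constant at the unit is that projection (\<open>flat_const\<close>). Finally, for \<open>f : \<lbrakk>x\<rbrakk> \<rightarrow> Cat\<close>, a left
  Kan extension along \<open>\<lbrakk>f\<rbrakk> \<rightarrow> \<lbrakk>x\<rbrakk>\<close> followed by one along \<open>\<lbrakk>x\<rbrakk> \<rightarrow> U\<close> is one along the projection
  to \<open>U\<close> from the oplax colimit of \<open>oplax_sum x f\<close>, a Fubini theorem (\<open>left_kan_flatten\<close>); this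
  gives associativity.

  The rest consists of checking that the categories involved exist at the right size and that the
  adder satisfies its equations. The one point of set theory is that there are fewer than
  \<open>kappa1\<close> small sets (\<open>card_of_small_sets\<close>), so that \<open>Cat\<close> is moderately small. The equation
  \<open>\<Sum>\<^sup>x 1 = x\<close> is forced by the choice of the flattening isomorphisms (\<open>sum_const\<close>): they are the
  projections onto \<open>x(u)\<close>, and a natural isomorphism determines its target.
\<close>

section \<open>Sets of the universe\<close>

lemma inaccessible_infinite:
  fixes r :: "'a rel"
  assumes "strongly_inaccessible r"
  shows "\<not> finite (Field r)"
  using assms Card_order_iff_ordLeq_card_of finite_iff_ordLess_natLeq
    not_ordLess_ordLeq ordLess_imp_ordLeq ordLess_ordLeq_trans
  unfolding strongly_inaccessible_def by metis

lemma inaccessible_stable: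
  fixes r :: "'a rel"
  assumes "strongly_inaccessible r"
  shows "stable r"
  using assms inaccessible_infinite[OF assms] regularCard_stable
  unfolding strongly_inaccessible_def by blast

lemma inaccessible_finite:
  assumes "strongly_inaccessible r" and "finite A"
  shows "|A| <o r"
  using assms finite_iff_ordLess_natLeq ordLess_transitive
  unfolding strongly_inaccessible_def by blast

lemma kappa0_Card_order: "Card_order (kappa0 :: 'u::two_inaccessibles rel)"
  using kappa0_inaccessible unfolding strongly_inaccessible_def by blast

lemmas kappa0_stable = inaccessible_stable[OF kappa0_inaccessible]
lemmas kappa1_stable = inaccessible_stable[OF kappa1_inaccessible]

lemma kappa0_kappa1: "|A| <o (kappa0 :: 'u::two_inaccessibles rel) \<Longrightarrow> |A| <o (kappa1 :: 'u rel)"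
  using kappa0_less_kappa1 ordLess_transitive by blast

lemma card_of_image_less: "|A| <o r \<Longrightarrow> |f ` A| <o r"
  using card_of_image ordLeq_ordLess_trans by blast

lemma card_of_subset_less: "|B| <o r \<Longrightarrow> A \<subseteq> B \<Longrightarrow> |A| <o r"
  using card_of_mono1 ordLeq_ordLess_trans by blast

lemma elts_vset: "|A| <o (kappa1 :: 'u::two_inaccessibles rel) \<Longrightarrow> elts (vset A) = (A :: 'u set)"
  unfolding vset_def using range_elts by (metis (mono_tags) f_inv_into_f mem_Collect_eq)

lemma vset_inject:
  assumes "|A| <o (kappa1 :: 'u::two_inaccessibles rel)" and "|B| <o (kappa1 :: 'u rel)"
  shows "vset A = vset (B :: 'u set) \<longleftrightarrow> A = B"
  using assms elts_vset by metis

lemma vset_finite_inject: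
  "finite A \<Longrightarrow> finite B \<Longrightarrow> vset A = vset B \<longleftrightarrow> A = (B :: 'u::two_inaccessibles set)"
  by (simp add: vset_inject inaccessible_finite[OF kappa1_inaccessible])

lemma vpair_inject [simp]: "vpair a b = vpair c d \<longleftrightarrow> a = c \<and> b = d"
  unfolding vpair_def by (auto simp: vset_finite_inject doubleton_eq_iff)

lemma vfst_vpair [simp]: "vfst (vpair a b) = a"
  unfolding vfst_def by simp

lemma vsnd_vpair [simp]: "vsnd (vpair a b) = b"
  unfolding vsnd_def by simp

lemma vgraph_inject:
  assumes "|A| <o (kappa1 :: 'u::two_inaccessibles rel)" and "|B| <o (kappa1 :: 'u rel)"
    and "vgraph A f = vgraph B (g :: 'u \<Rightarrow> 'u)" and "a \<in> A"
  shows "f a = g a"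
proof -
  have "(\<lambda>a. vpair a (f a)) ` A = (\<lambda>a. vpair a (g a)) ` B"
    using assms unfolding vgraph_def by (simp add: vset_inject card_of_image_less)
  then have "vpair a (f a) \<in> (\<lambda>a. vpair a (g a)) ` B" using \<open>a \<in> A\<close> by blast
  then show ?thesis by auto
qed

lemma small_vset:
  assumes "A \<subseteq> Collect small_set" and "|A| <o (kappa0 :: 'u::two_inaccessibles rel)"
  shows "small_set (vset (A :: 'u set))"
  by (rule small_set.intros) (use assms in \<open>auto simp: elts_vset[OF kappa0_kappa1]\<close>)

lemma small_vset_finite: "A \<subseteq> Collect small_set \<Longrightarrow> finite A \<Longrightarrow> small_set (vset A)"
  using small_vset inaccessible_finite kappa0_inaccessible by blast

lemma small_vpair: "small_set a \<Longrightarrow> small_set b \<Longrightarrow> small_set (vpair a b)"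
  unfolding vpair_def by (simp add: small_vset_finite)

lemma small_vgraph:
  assumes "A \<subseteq> Collect small_set" and "|A| <o (kappa0 :: 'u::two_inaccessibles rel)"
    and "f ` A \<subseteq> Collect small_set"
  shows "small_set (vgraph A (f :: 'u \<Rightarrow> 'u))"
  unfolding vgraph_def using assms
  by (intro small_vset card_of_image_less) (auto intro!: small_vpair)

text \<open>
  The stages of the cumulative hierarchy, indexed by the ordinals below \<open>kappa0\<close>. They bound the
  number of small sets: each stage is smaller than \<open>kappa1\<close> as \<open>kappa1\<close> is a strong limit, and no
  small set lies outside of all stages as \<open>kappa0\<close> is regular.
\<close>

inductive stage :: "'u::two_inaccessibles \<Rightarrow> 'u \<Rightarrow> bool" where
  "(\<And>y. y \<in> elts x \<Longrightarrow> \<exists>b. b \<in> underS kappa0 a \<and> stage b y) \<Longrightarrow> stage a x"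

lemma stage_iff: "stage a x \<longleftrightarrow> elts x \<subseteq> (\<Union>b\<in>underS kappa0 a. Collect (stage b))"
  by (subst stage.simps) auto

lemma card_of_stage:
  fixes a :: "'u::two_inaccessibles"
  shows "|Collect (stage a)| <o (kappa1 :: 'u rel)"
proof -
  have "wf (kappa0 - Id :: 'u rel)"
    using kappa0_Card_order unfolding card_order_on_def well_order_on_def by blast
  then show ?thesis
  proof (induction a rule: wf_induct_rule)
    case (less a)
    have "|underS kappa0 a| <o (kappa0 :: 'u rel)"
    proof (cases "a \<in> Field kappa0")
      case True
      then show ?thesis by (rule card_of_underS[OF kappa0_Card_order])
    next
      case False
      then have "underS kappa0 a = {}" unfolding underS_def Field_def by blast
      then show ?thesis by (simp add: inaccessible_finite[OF kappa0_inaccessible])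
    qed
    then have "|\<Union>b\<in>underS kappa0 a. Collect (stage b)| <o (kappa1 :: 'u rel)" (is "|?B| <o _")
      by (rule stable_UNION[OF kappa1_stable kappa0_kappa1]) (simp add: less underS_def)
    then have "|Pow ?B| <o (kappa1 :: 'u rel)"
      using kappa1_inaccessible unfolding strongly_inaccessible_def by blast
    moreover have "|Collect (stage a)| \<le>o |Pow ?B|"
    proof (rule card_of_ordLeqI)
      show "inj_on elts (Collect (stage a))" using inj_elts inj_on_subset by blast
      show "elts x \<in> Pow ?B" if "x \<in> Collect (stage a)" for x
        using that unfolding mem_Collect_eq stage_iff[of a x] by blast
    qed
    ultimately show ?case using ordLeq_ordLess_trans by blast
  qed
qed

lemma small_set_stage:
  "small_set (x :: 'u::two_inaccessibles) \<Longrightarrow> \<exists>a\<in>Field kappa0. stage a x"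
proof (induction rule: small_set.induct)
  case (1 x)
  have co: "Card_order (kappa0 :: 'u rel)" and reg: "regularCard (kappa0 :: 'u rel)"
    using kappa0_inaccessible unfolding strongly_inaccessible_def by auto
  have wo: "wo_rel (kappa0 :: 'u rel)" using co by (simp add: card_order_on_def wo_rel_def)
  have "relChain kappa0 (\<lambda>a. Collect (stage (a :: 'u)))"
    unfolding relChain_def
  proof (intro allI impI subsetI)
    fix a b x :: 'u assume "(a, b) \<in> kappa0" and "x \<in> Collect (stage a)"
    moreover have "underS kappa0 a \<subseteq> underS kappa0 b"
      using \<open>(a, b) \<in> kappa0\<close> wo_rel.TRANS[OF wo] wo_rel.ANTISYM[OF wo]
      unfolding underS_def trans_def antisym_def by blast
    ultimately show "x \<in> Collect (stage b)"
      unfolding mem_Collect_eq stage_iff[of a] stage_iff[of b] by blast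
  qed
  moreover have "elts x \<subseteq> (\<Union>a\<in>Field kappa0. Collect (stage a))" using 1 by auto
  ultimately obtain a :: 'u where a: "a \<in> Field kappa0" "elts x \<subseteq> Collect (stage a)"
    using regularCard_UNION[OF co reg] 1 by blast
  obtain b where b: "(a, b) \<in> kappa0" "a \<noteq> b"
    using infinite_Card_order_limit[OF co inaccessible_infinite[OF kappa0_inaccessible] a(1)] by blast
  then have "a \<in> underS kappa0 b" by (simp add: underS_def)
  then have "stage b x" using a(2) unfolding stage_iff[of b] by blast
  then show ?case using b(1) by (auto simp: Field_def)
qed

lemma card_of_small_sets: "|Collect small_set :: 'u set| <o (kappa1 :: 'u::two_inaccessibles rel)"
proof -
  have "|Field (kappa0 :: 'u rel)| =o (kappa0 :: 'u rel)"
    by (rule card_of_Field_ordIso[OF kappa0_Card_order])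
  then have "|Field (kappa0 :: 'u rel)| <o (kappa1 :: 'u rel)"
    using kappa0_less_kappa1 ordIso_ordLess_trans by blast
  then have "|\<Union>a\<in>Field kappa0. Collect (stage (a :: 'u))| <o (kappa1 :: 'u rel)"
    by (rule stable_UNION[OF kappa1_stable]) (rule card_of_stage)
  then show ?thesis by (rule card_of_subset_less) (use small_set_stage in blast)
qed

section \<open>Categories and functors\<close>

lemma cat_Dom: "category C \<Longrightarrow> f \<in> Arr C \<Longrightarrow> Dom C f \<in> Obj C"
  unfolding category_def by auto

lemma cat_Cod: "category C \<Longrightarrow> f \<in> Arr C \<Longrightarrow> Cod C f \<in> Obj C"
  unfolding category_def by auto

lemma cat_Ident:
  assumes "category C" and "a \<in> Obj C"
  shows "Ident C a \<in> Arr C" and "Dom C (Ident C a) = a" and "Cod C (Ident C a) = a"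
  using assms unfolding category_def hom_def by auto

lemma cat_Cmp:
  assumes "category C" and "f \<in> Arr C" and "g \<in> Arr C" and "Cod C f = Dom C g"
  shows "Cmp C g f \<in> Arr C" and "Dom C (Cmp C g f) = Dom C f" and "Cod C (Cmp C g f) = Cod C g"
  using assms unfolding category_def hom_def by auto

lemma cat_idR: "category C \<Longrightarrow> f \<in> Arr C \<Longrightarrow> a = Dom C f \<Longrightarrow> Cmp C f (Ident C a) = f"
  unfolding category_def by auto

lemma cat_idL: "category C \<Longrightarrow> f \<in> Arr C \<Longrightarrow> a = Cod C f \<Longrightarrow> Cmp C (Ident C a) f = f"
  unfolding category_def by auto

lemma cat_assoc:
  "category C \<Longrightarrow> f \<in> Arr C \<Longrightarrow> g \<in> Arr C \<Longrightarrow> h \<in> Arr C \<Longrightarrow> Cod C f = Dom C g \<Longrightarrow>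
    Cod C g = Dom C h \<Longrightarrow> Cmp C h (Cmp C g f) = Cmp C (Cmp C h g) f"
  unfolding category_def by blast

lemmas cat_rules [simp] = cat_Dom cat_Cod cat_Ident cat_Cmp cat_idR cat_idL

lemma make_cat_simps [simp]:
  "Obj (make_cat Ob Ar d c i m) = Ob"
  "Arr (make_cat Ob Ar d c i m) = Ar"
  "f \<in> Ar \<Longrightarrow> Dom (make_cat Ob Ar d c i m) f = d f"
  "f \<in> Ar \<Longrightarrow> Cod (make_cat Ob Ar d c i m) f = c f"
  "a \<in> Ob \<Longrightarrow> Ident (make_cat Ob Ar d c i m) a = i a"
  "f \<in> Ar \<Longrightarrow> g \<in> Ar \<Longrightarrow> c f = d g \<Longrightarrow> Cmp (make_cat Ob Ar d c i m) g f = m g f"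
  by (simp_all add: make_cat_def)

lemma category_make_cat:
  assumes "\<And>f. f \<in> Ar \<Longrightarrow> d f \<in> Ob" and "\<And>f. f \<in> Ar \<Longrightarrow> c f \<in> Ob"
    and "\<And>a. a \<in> Ob \<Longrightarrow> i a \<in> Ar \<and> d (i a) = a \<and> c (i a) = a"
    and "\<And>f g. f \<in> Ar \<Longrightarrow> g \<in> Ar \<Longrightarrow> c f = d g \<Longrightarrow>
           m g f \<in> Ar \<and> d (m g f) = d f \<and> c (m g f) = c g"
    and "\<And>f. f \<in> Ar \<Longrightarrow> m f (i (d f)) = f" and "\<And>f. f \<in> Ar \<Longrightarrow> m (i (c f)) f = f"
    and "\<And>f g h. f \<in> Ar \<Longrightarrow> g \<in> Ar \<Longrightarrow> h \<in> Ar \<Longrightarrow> c f = d g \<Longrightarrow> c g = d h \<Longrightarrow>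
           m h (m g f) = m (m h g) f"
  shows "category (make_cat Ob Ar d c i m)"
  using assms unfolding category_def by (auto simp: make_cat_def hom_def)

definition Fun :: "'u ucat \<Rightarrow> 'u ucat \<Rightarrow> 'u func set" where
  "Fun C D = {G. is_functor G \<and> Src G = C \<and> Tgt G = D}"

lemma Fun_Src: "G \<in> Fun C D \<Longrightarrow> Src G = C"
  and Fun_Tgt: "G \<in> Fun C D \<Longrightarrow> Tgt G = D"
  and Fun_catS: "G \<in> Fun C D \<Longrightarrow> category C"
  and Fun_catT: "G \<in> Fun C D \<Longrightarrow> category D"
  by (auto simp: Fun_def is_functor_def)

lemma Fun_obj: "G \<in> Fun C D \<Longrightarrow> a \<in> Obj C \<Longrightarrow> FO G a \<in> Obj D"
  by (auto simp: Fun_def is_functor_def)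

lemma Fun_arr:
  assumes "G \<in> Fun C D" and "f \<in> Arr C"
  shows "FA G f \<in> Arr D" and "Dom D (FA G f) = FO G (Dom C f)"
    and "Cod D (FA G f) = FO G (Cod C f)"
  using assms by (auto simp: Fun_def is_functor_def hom_def)

lemma Fun_Ident: "G \<in> Fun C D \<Longrightarrow> a \<in> Obj C \<Longrightarrow> FA G (Ident C a) = Ident D (FO G a)"
  by (auto simp: Fun_def is_functor_def)

lemma Fun_Cmp:
  "G \<in> Fun C D \<Longrightarrow> f \<in> Arr C \<Longrightarrow> g \<in> Arr C \<Longrightarrow> Cod C f = Dom C g \<Longrightarrow>
    FA G (Cmp C g f) = Cmp D (FA G g) (FA G f)"
  by (auto simp: Fun_def is_functor_def)

lemmas Fun_rules = Fun_obj Fun_arr Fun_Ident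

lemma make_fun_simps [simp]:
  "Src (make_fun C D fo fa) = C"
  "Tgt (make_fun C D fo fa) = D"
  "a \<in> Obj C \<Longrightarrow> FO (make_fun C D fo fa) a = fo a"
  "f \<in> Arr C \<Longrightarrow> FA (make_fun C D fo fa) f = fa f"
  by (simp_all add: make_fun_def)

lemma make_fun_in_Fun:
  assumes "category C" and "category D" and "\<And>a. a \<in> Obj C \<Longrightarrow> fo a \<in> Obj D"
    and "\<And>f. f \<in> Arr C \<Longrightarrow> fa f \<in> Arr D \<and> Dom D (fa f) = fo (Dom C f) \<and> Cod D (fa f) = fo (Cod C f)"
    and "\<And>a. a \<in> Obj C \<Longrightarrow> fa (Ident C a) = Ident D (fo a)"
    and "\<And>f g. f \<in> Arr C \<Longrightarrow> g \<in> Arr C \<Longrightarrow> Cod C f = Dom C g \<Longrightarrow>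
           fa (Cmp C g f) = Cmp D (fa g) (fa f)"
  shows "make_fun C D fo fa \<in> Fun C D"
  using assms unfolding Fun_def is_functor_def by (auto simp: hom_def make_fun_def)

lemma functor_eqI:
  assumes "G \<in> Fun C D" and "H \<in> Fun C D" and "\<And>a. a \<in> Obj C \<Longrightarrow> FO G a = FO H a"
    and "\<And>f. f \<in> Arr C \<Longrightarrow> FA G f = FA H f"
  shows "G = H"
proof -
  have "FO G \<in> Obj C \<rightarrow>\<^sub>E Obj D" "FO H \<in> Obj C \<rightarrow>\<^sub>E Obj D"
    "FA G \<in> Arr C \<rightarrow>\<^sub>E Arr D" "FA H \<in> Arr C \<rightarrow>\<^sub>E Arr D" "Src G = Src H" "Tgt G = Tgt H"
    using assms(1,2) unfolding Fun_def is_functor_def by auto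
  then show ?thesis
    using PiE_ext[of "FO G" _ _ "FO H"] PiE_ext[of "FA G" _ _ "FA H"] assms(3,4)
    by (intro func.equality) auto
qed

lemma id_fun_Fun [simp]: "category C \<Longrightarrow> id_fun C \<in> Fun C C"
  unfolding id_fun_def by (rule make_fun_in_Fun) auto

lemma id_fun_simps [simp]:
  "Src (id_fun C) = C" "Tgt (id_fun C) = C"
  "a \<in> Obj C \<Longrightarrow> FO (id_fun C) a = a" "f \<in> Arr C \<Longrightarrow> FA (id_fun C) f = f"
  by (simp_all add: id_fun_def)

lemma comp_fun_simps [simp]:
  "Src (G \<odot> F) = Src F" "Tgt (G \<odot> F) = Tgt G"
  "a \<in> Obj (Src F) \<Longrightarrow> FO (G \<odot> F) a = FO G (FO F a)"
  "f \<in> Arr (Src F) \<Longrightarrow> FA (G \<odot> F) f = FA G (FA F f)"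
  by (simp_all add: comp_fun_def)

lemma comp_Fun:
  assumes "F \<in> Fun C D" and "G \<in> Fun D E" shows "G \<odot> F \<in> Fun C E"
  unfolding comp_fun_def Fun_Src[OF assms(1)] Fun_Tgt[OF assms(2)]
  using Fun_catS[OF assms(1)] Fun_catT[OF assms(2)] Fun_catS[OF assms(2)]
  by (intro make_fun_in_Fun)
    (auto simp: Fun_rules[OF assms(1)] Fun_rules[OF assms(2)] Fun_Cmp[OF assms(1)] Fun_Cmp[OF assms(2)])

lemma comp_FO: "F \<in> Fun C D \<Longrightarrow> a \<in> Obj C \<Longrightarrow> FO (G \<odot> F) a = FO G (FO F a)"
  and comp_FA: "F \<in> Fun C D \<Longrightarrow> f \<in> Arr C \<Longrightarrow> FA (G \<odot> F) f = FA G (FA F f)"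
  by (simp_all add: Fun_Src)

lemma comp_assoc:
  assumes "F \<in> Fun B C" and "G \<in> Fun C D" and "H \<in> Fun D E"
  shows "(H \<odot> G) \<odot> F = H \<odot> (G \<odot> F)"
proof (rule functor_eqI)
  show "(H \<odot> G) \<odot> F \<in> Fun B E" "H \<odot> (G \<odot> F) \<in> Fun B E" using assms by (meson comp_Fun)+
qed (use assms in \<open>auto simp: Fun_Src Fun_rules\<close>)

lemma comp_id_right [simp]: "F \<in> Fun C D \<Longrightarrow> F \<odot> id_fun C = F"
  by (rule functor_eqI) (auto intro!: comp_Fun[where D = C] dest: Fun_catS)

lemma comp_id_left [simp]: "F \<in> Fun C D \<Longrightarrow> id_fun D \<odot> F = F"
  by (rule functor_eqI) (auto intro!: comp_Fun[where D = D] dest: Fun_catT simp: Fun_Src Fun_rules)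

subsection \<open>Natural isomorphisms\<close>

lemma is_isoI:
  assumes "f \<in> Arr C" and "g \<in> Arr C" and "Dom C g = Cod C f" and "Cod C g = Dom C f"
    and "Cmp C g f = Ident C (Dom C f)" and "Cmp C f g = Ident C (Cod C f)"
  shows "is_iso C f"
  using assms unfolding is_iso_def hom_def by blast

lemma is_isoE:
  assumes "is_iso C f"
  obtains g where "f \<in> Arr C" "g \<in> Arr C" "Dom C g = Cod C f" "Cod C g = Dom C f"
    "Cmp C g f = Ident C (Dom C f)" "Cmp C f g = Ident C (Cod C f)"
  using assms unfolding is_iso_def hom_def by blast

lemma iso_Arr: "is_iso C f \<Longrightarrow> f \<in> Arr C"
  unfolding is_iso_def by blast

lemma Fun_iso:
  assumes G: "G \<in> Fun C D" and "is_iso C f"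
  shows "is_iso D (FA G f)"
proof -
  obtain g where f: "f \<in> Arr C" "g \<in> Arr C" "Dom C g = Cod C f" "Cod C g = Dom C f"
    "Cmp C g f = Ident C (Dom C f)" "Cmp C f g = Ident C (Cod C f)"
    using \<open>is_iso C f\<close> by (rule is_isoE)
  have C: "category C" using Fun_catS[OF G] .
  have "Cmp D (FA G g) (FA G f) = FA G (Cmp C g f)" "Cmp D (FA G f) (FA G g) = FA G (Cmp C f g)"
    using f(1-4) by (simp_all only: Fun_Cmp[OF G])
  then show ?thesis using f C
    by (intro is_isoI[where g = "FA G g"]) (auto simp: Fun_rules[OF G])
qed

lemma nat_isoI:
  assumes "G \<in> Fun C D" and "H \<in> Fun C D"
    and "\<And>a. a \<in> Obj C \<Longrightarrow> Dom D (t a) = FO G a \<and> Cod D (t a) = FO H a \<and> is_iso D (t a)"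
    and "\<And>f. f \<in> Arr C \<Longrightarrow> Cmp D (t (Cod C f)) (FA G f) = Cmp D (FA H f) (t (Dom C f))"
  shows "is_nat_iso G H t"
  using assms unfolding is_nat_iso_def Fun_def hom_def by (auto dest: iso_Arr)

lemma nat_isoD:
  assumes "is_nat_iso G H t" and "G \<in> Fun C D"
  shows "H \<in> Fun C D"
    and "a \<in> Obj C \<Longrightarrow> t a \<in> Arr D" and "a \<in> Obj C \<Longrightarrow> Dom D (t a) = FO G a"
    and "a \<in> Obj C \<Longrightarrow> Cod D (t a) = FO H a" and "a \<in> Obj C \<Longrightarrow> is_iso D (t a)"
    and "f \<in> Arr C \<Longrightarrow> Cmp D (t (Cod C f)) (FA G f) = Cmp D (FA H f) (t (Dom C f))"
  using assms unfolding is_nat_iso_def Fun_def hom_def by auto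

lemma nat_iso_Fun: "is_nat_iso G H t \<Longrightarrow> G \<in> Fun (Src G) (Tgt G)"
  unfolding is_nat_iso_def Fun_def by auto

text \<open>
  A function, rather than an existential statement, so that inverses taken objectwise form the
  inverse of a natural isomorphism.
\<close>

definition cat_inv :: "('o, 'a) cat \<Rightarrow> 'a \<Rightarrow> 'a" where
  "cat_inv C f = (SOME g. g \<in> Arr C \<and> Dom C g = Cod C f \<and> Cod C g = Dom C f \<and>
     Cmp C g f = Ident C (Dom C f) \<and> Cmp C f g = Ident C (Cod C f))"

lemma cat_inv:
  assumes "is_iso C f"
  shows "cat_inv C f \<in> Arr C" "Dom C (cat_inv C f) = Cod C f" "Cod C (cat_inv C f) = Dom C f"
    "Cmp C (cat_inv C f) f = Ident C (Dom C f)" "Cmp C f (cat_inv C f) = Ident C (Cod C f)"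
proof -
  have "\<exists>g. g \<in> Arr C \<and> Dom C g = Cod C f \<and> Cod C g = Dom C f \<and>
     Cmp C g f = Ident C (Dom C f) \<and> Cmp C f g = Ident C (Cod C f)"
    using assms by (blast elim: is_isoE)
  from someI_ex[OF this]
  show "cat_inv C f \<in> Arr C" "Dom C (cat_inv C f) = Cod C f" "Cod C (cat_inv C f) = Dom C f"
    "Cmp C (cat_inv C f) f = Ident C (Dom C f)" "Cmp C f (cat_inv C f) = Ident C (Cod C f)"
    unfolding cat_inv_def by blast+
qed

lemma nat_iso_inverse:
  assumes t: "is_nat_iso G H t" and G: "G \<in> Fun C D"
  shows "is_nat_iso H G (\<lambda>a. cat_inv D (t a))"
proof (rule nat_isoI)
  have C: "category C" and D: "category D" using Fun_catS[OF G] Fun_catT[OF G] by auto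
  show H: "H \<in> Fun C D" using nat_isoD[OF t G] by blast
  note tD = nat_isoD(2-5)[OF t G]
  note inv = cat_inv[OF tD(4)]
  show "Dom D (cat_inv D (t a)) = FO H a \<and> Cod D (cat_inv D (t a)) = FO G a \<and>
          is_iso D (cat_inv D (t a))" if "a \<in> Obj C" for a
    using that tD[OF that] inv[OF that] by (auto intro!: is_isoI[where g = "t a"])
  fix f assume f: "f \<in> Arr C"
  let ?a = "Dom C f" and ?b = "Cod C f"
  let ?i = "cat_inv D (t ?a)" and ?j = "cat_inv D (t ?b)"
  have a: "?a \<in> Obj C" and b: "?b \<in> Obj C" using f C by auto
  note types = D f tD[OF a] tD[OF b] inv(1-3)[OF a] inv(1-3)[OF b]
    Fun_rules[OF G] Fun_rules[OF H] a b
  note facts = types inv(4-5)[OF a] inv(4-5)[OF b]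
  have "Cmp D ?j (FA H f) = Cmp D ?j (Cmp D (FA H f) (Cmp D (t ?a) ?i))"
    using facts by simp
  also have "\<dots> = Cmp D ?j (Cmp D (Cmp D (t ?b) (FA G f)) ?i)"
    unfolding nat_isoD(6)[OF t G f]
    using types by (simp add: cat_assoc)
  also have "\<dots> = Cmp D (Cmp D (Cmp D ?j (t ?b)) (FA G f)) ?i"
    using types by (simp add: cat_assoc)
  also have "\<dots> = Cmp D (FA G f) ?i" using facts by simp
  finally show "Cmp D ?j (FA H f) = Cmp D (FA G f) ?i" .
qed (rule G)

lemma fun_iso_sym: "G \<cong>\<^sub>F H \<Longrightarrow> H \<cong>\<^sub>F G"
  unfolding fun_iso_def using nat_iso_inverse nat_iso_Fun by blast

lemma fun_iso_Fun: "G \<cong>\<^sub>F H \<Longrightarrow> G \<in> Fun C D \<Longrightarrow> H \<in> Fun C D"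
  unfolding fun_iso_def using nat_isoD(1) by blast

lemma nat_iso_whisker_right:
  assumes t: "is_nat_iso G H t" and G: "G \<in> Fun C D" and F: "F \<in> Fun B C"
  shows "is_nat_iso (G \<odot> F) (H \<odot> F) (\<lambda>a. t (FO F a))"
proof (rule nat_isoI)
  have B: "category B" using Fun_catS[OF F] .
  have H: "H \<in> Fun C D" using nat_isoD[OF t G] by blast
  show "G \<odot> F \<in> Fun B D" "H \<odot> F \<in> Fun B D" using G H F by (auto intro: comp_Fun)
  show "Dom D (t (FO F a)) = FO (G \<odot> F) a \<and> Cod D (t (FO F a)) = FO (H \<odot> F) a \<and>
      is_iso D (t (FO F a))" if "a \<in> Obj B" for a
    using that F by (auto simp: Fun_obj[OF F] nat_isoD[OF t G] comp_FO)
  show "Cmp D (t (FO F (Cod B f))) (FA (G \<odot> F) f) = Cmp D (FA (H \<odot> F) f) (t (FO F (Dom B f)))"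
    if "f \<in> Arr B" for f
    using that F nat_isoD(6)[OF t G, of "FA F f"] by (simp add: Fun_rules[OF F] comp_FA)
qed

lemma nat_iso_whisker_left:
  assumes t: "is_nat_iso G H t" and G: "G \<in> Fun B C" and F: "F \<in> Fun C D"
  shows "is_nat_iso (F \<odot> G) (F \<odot> H) (\<lambda>a. FA F (t a))"
proof (rule nat_isoI)
  have B: "category B" using Fun_catS[OF G] .
  have H: "H \<in> Fun B C" using nat_isoD[OF t G] by blast
  show "F \<odot> G \<in> Fun B D" "F \<odot> H \<in> Fun B D" using G H F by (auto intro: comp_Fun)
  show "Dom D (FA F (t a)) = FO (F \<odot> G) a \<and> Cod D (FA F (t a)) = FO (F \<odot> H) a \<and>
      is_iso D (FA F (t a))" if "a \<in> Obj B" for a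
    using that G H F nat_isoD(2-5)[OF t G that]
    by (auto simp: Fun_rules[OF F] comp_FO[OF G] comp_FO[OF H] Fun_iso)
  show "Cmp D (FA F (t (Cod B f))) (FA (F \<odot> G) f) = Cmp D (FA (F \<odot> H) f) (FA F (t (Dom B f)))"
    if f: "f \<in> Arr B" for f
  proof -
    have "Dom B f \<in> Obj B" "Cod B f \<in> Obj B" using f B by auto
    then show ?thesis
      using f nat_isoD(2-5)[OF t G] nat_isoD(6)[OF t G f]
      by (simp add: comp_FA[OF G] comp_FA[OF H] Fun_rules[OF G] Fun_rules[OF H]
          flip: Fun_Cmp[OF F])
  qed
qed

lemma comp_cong_right: "H \<cong>\<^sub>F H' \<Longrightarrow> H \<in> Fun B C \<Longrightarrow> F \<in> Fun C D \<Longrightarrow> F \<odot> H \<cong>\<^sub>F F \<odot> H'"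
  unfolding fun_iso_def using nat_iso_whisker_left by blast

lemma comp_cong_left: "G \<cong>\<^sub>F G' \<Longrightarrow> G \<in> Fun C D \<Longrightarrow> F \<in> Fun B C \<Longrightarrow> G \<odot> F \<cong>\<^sub>F G' \<odot> F"
  unfolding fun_iso_def using nat_iso_whisker_right by blast

subsection \<open>Colimits\<close>

lemma cocone_iff:
  assumes "D \<in> Fun J M"
  shows "is_cocone D l c \<longleftrightarrow>
     l \<in> Obj M \<and> (\<forall>i\<in>Obj J. c i \<in> Arr M \<and> Dom M (c i) = FO D i \<and> Cod M (c i) = l) \<and>
     (\<forall>f\<in>Arr J. Cmp M (c (Cod J f)) (FA D f) = c (Dom J f))"
  using assms unfolding is_cocone_def Fun_def hom_def by auto

lemma colimit_cocone: "is_colimit D l c \<Longrightarrow> is_cocone D l c"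
  unfolding is_colimit_def by blast

lemma colimitD:
  assumes "is_colimit D l c" and "D \<in> Fun J M"
  shows "l \<in> Obj M" and "i \<in> Obj J \<Longrightarrow> c i \<in> Arr M" and "i \<in> Obj J \<Longrightarrow> Dom M (c i) = FO D i"
    and "i \<in> Obj J \<Longrightarrow> Cod M (c i) = l"
    and "f \<in> Arr J \<Longrightarrow> Cmp M (c (Cod J f)) (FA D f) = c (Dom J f)"
  using colimit_cocone[OF assms(1)] unfolding cocone_iff[OF assms(2)] by auto

lemma colimit_ex1:
  assumes "is_colimit D l c" and "D \<in> Fun J M" and "is_cocone D l' c'"
  shows "\<exists>!m. m \<in> hom M l l' \<and> (\<forall>i\<in>Obj J. Cmp M m (c i) = c' i)"
  using assms unfolding is_colimit_def Fun_def by blast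

lemma colimit_ex:
  assumes "is_colimit D l c" and "D \<in> Fun J M" and "is_cocone D l' c'"
  obtains m where "m \<in> Arr M" "Dom M m = l" "Cod M m = l'"
    "\<And>i. i \<in> Obj J \<Longrightarrow> Cmp M m (c i) = c' i"
  using colimit_ex1[OF assms] that unfolding hom_def by blast

text \<open>
  The composites with one of the two arrows form a cocone, through which both arrows are
  factorisations.
\<close>

lemma colimit_unique:
  assumes l: "is_colimit D l c" and D: "D \<in> Fun J M"
    and m: "m \<in> Arr M" "Dom M m = l" and n: "n \<in> Arr M" "Dom M n = l" "Cod M n = Cod M m"
    and eq: "\<And>i. i \<in> Obj J \<Longrightarrow> Cmp M m (c i) = Cmp M n (c i)"
  shows "m = n"
proof -
  have J: "category J" and M: "category M" using Fun_catS[OF D] Fun_catT[OF D] by auto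
  note cD = colimitD[OF l D]
  have "Cmp M (Cmp M n (c (Cod J f))) (FA D f) = Cmp M n (c (Dom J f))" if f: "f \<in> Arr J" for f
    using f J M n(1,2) by (simp add: Fun_rules[OF D] cD flip: cat_assoc)
  then have "is_cocone D (Cod M n) (\<lambda>i. Cmp M n (c i))"
    unfolding cocone_iff[OF D] using M n(1,2) by (simp add: cD)
  from colimit_ex1[OF l D this] have "\<exists>!k. k \<in> hom M l (Cod M n) \<and>
      (\<forall>i\<in>Obj J. Cmp M k (c i) = Cmp M n (c i))" .
  moreover have "m \<in> hom M l (Cod M n)" "n \<in> hom M l (Cod M n)"
    using m n unfolding hom_def by simp_all
  ultimately show ?thesis using eq by blast
qed

lemma is_colimitI:
  assumes D: "D \<in> Fun J M" and "is_cocone D l c"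
    and "\<And>l' c'. is_cocone D l' c' \<Longrightarrow>
      \<exists>m. m \<in> Arr M \<and> Dom M m = l \<and> Cod M m = l' \<and> (\<forall>i\<in>Obj J. Cmp M m (c i) = c' i)"
    and "\<And>m n. m \<in> Arr M \<Longrightarrow> n \<in> Arr M \<Longrightarrow> Dom M m = l \<Longrightarrow> Dom M n = l \<Longrightarrow>
      Cod M n = Cod M m \<Longrightarrow> \<forall>i\<in>Obj J. Cmp M m (c i) = Cmp M n (c i) \<Longrightarrow> m = n"
  shows "is_colimit D l c"
proof -
  have "\<exists>!m. m \<in> hom M l l' \<and> (\<forall>i\<in>Obj J. Cmp M m (c i) = c' i)" if "is_cocone D l' c'" for l' c'
  proof -
    obtain m where "m \<in> Arr M \<and> Dom M m = l \<and> Cod M m = l' \<and> (\<forall>i\<in>Obj J. Cmp M m (c i) = c' i)"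
      using assms(3)[OF \<open>is_cocone D l' c'\<close>] by blast
    then show ?thesis unfolding hom_def by (intro ex1I[of _ m]) (auto intro: assms(4))
  qed
  then show ?thesis using assms unfolding is_colimit_def Fun_def by blast
qed

lemma colimit_cong:
  assumes l: "is_colimit D l c" and D: "D \<in> Fun J M" and eq: "\<And>i. i \<in> Obj J \<Longrightarrow> c i = d i"
  shows "is_colimit D l d"
  using l eq Fun_catS[OF D] unfolding is_colimit_def cocone_iff[OF D] Fun_Src[OF D]
  by simp

lemma colim_is_colimit: "\<exists>l c. is_colimit D l c \<Longrightarrow> is_colimit D (colim D) (colim_in D)"
  unfolding colim_def colim_in_def by (metis (mono_tags, lifting) fst_conv snd_conv someI_ex)

lemma cocone_iso_diagram:
  assumes c: "is_cocone D l c" and D': "D' \<in> Fun J M" and t: "is_nat_iso D' D t"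
  shows "is_cocone D' l (\<lambda>i. Cmp M (c i) (t i))"
proof -
  note tD = nat_isoD[OF t D'] and J = Fun_catS[OF D'] and M = Fun_catT[OF D']
  note D = tD(1)
  note cD = c[unfolded cocone_iff[OF D]]
  have "Cmp M (Cmp M (c (Cod J f)) (t (Cod J f))) (FA D' f) = Cmp M (c (Dom J f)) (t (Dom J f))"
    if f: "f \<in> Arr J" for f
  proof -
    have "Cmp M (Cmp M (c (Cod J f)) (t (Cod J f))) (FA D' f) =
        Cmp M (c (Cod J f)) (Cmp M (t (Cod J f)) (FA D' f))"
      using J f cD by (intro cat_assoc[OF M, symmetric]) (simp_all add: tD Fun_rules[OF D'])
    also have "\<dots> = Cmp M (Cmp M (c (Cod J f)) (FA D f)) (t (Dom J f))"
      unfolding tD(6)[OF f]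
      using J f cD by (intro cat_assoc[OF M]) (simp_all add: tD Fun_rules[OF D])
    finally show ?thesis using cD f by simp
  qed
  then show ?thesis unfolding cocone_iff[OF D'] using M cD by (auto simp: tD)
qed

text \<open>
  Composing with \<open>t\<close> and with its inverse is a bijection between the cocones over \<open>D\<close> and those over
  \<open>D'\<close>, compatible with the factorisations.
\<close>

lemma colimit_iso_diagram:
  assumes l: "is_colimit D l c" and D: "D \<in> Fun J M" and D': "D' \<in> Fun J M"
    and t: "is_nat_iso D' D t"
  shows "is_colimit D' l (\<lambda>i. Cmp M (c i) (t i))"
proof (rule is_colimitI[OF D'])
  note M = Fun_catT[OF D] and cD = colimitD[OF l D] and tD = nat_isoD[OF t D']
  note inv = cat_inv[OF tD(5)]
  let ?s = "\<lambda>i. cat_inv M (t i)"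
  show "is_cocone D' l (\<lambda>i. Cmp M (c i) (t i))"
    by (rule cocone_iso_diagram[OF colimit_cocone[OF l] D' t])
  have cancel: "Cmp M (Cmp M k (Cmp M (c i) (t i))) (?s i) = Cmp M k (c i)"
    if "k \<in> Arr M" "Dom M k = l" "i \<in> Obj J" for k i
  proof -
    have "Cmp M (Cmp M k (Cmp M (c i) (t i))) (?s i) = Cmp M (Cmp M k (c i)) (Cmp M (t i) (?s i))"
      using M cD(1-4) tD(2-4) inv(1-3) that by (simp add: cat_assoc)
    then show ?thesis using inv(5) M cD(2-4) tD(4) that by simp
  qed
  show "\<exists>m. m \<in> Arr M \<and> Dom M m = l \<and> Cod M m = l' \<and>
      (\<forall>i\<in>Obj J. Cmp M m (Cmp M (c i) (t i)) = c' i)" if c': "is_cocone D' l' c'" for l' c'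
  proof -
    note c'D = c'[unfolded cocone_iff[OF D']]
    have "is_cocone D l' (\<lambda>i. Cmp M (c' i) (?s i))"
      by (rule cocone_iso_diagram[OF c' D nat_iso_inverse[OF t D']])
    from colimit_ex[OF l D this] obtain m where
      m: "m \<in> Arr M" "Dom M m = l" "Cod M m = l'"
        "\<And>i. i \<in> Obj J \<Longrightarrow> Cmp M m (c i) = Cmp M (c' i) (?s i)"
      by blast
    have "Cmp M m (Cmp M (c i) (t i)) = c' i" if i: "i \<in> Obj J" for i
    proof -
      have "Cmp M m (Cmp M (c i) (t i)) = Cmp M (Cmp M (c' i) (?s i)) (t i)"
        using M cD(1-4) tD(2-4) m i by (simp add: cat_assoc flip: m(4))
      also have "\<dots> = Cmp M (c' i) (Cmp M (?s i) (t i))"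
        using M tD(2-4) inv(1-3) c'D i by (intro cat_assoc[symmetric]) auto
      finally show ?thesis using inv(4)[OF i] tD(3) M c'D i by simp
    qed
    then show ?thesis using m by blast
  qed
  show "m = n" if mn: "m \<in> Arr M" "n \<in> Arr M" "Dom M m = l" "Dom M n = l" "Cod M n = Cod M m"
    "\<forall>i\<in>Obj J. Cmp M m (Cmp M (c i) (t i)) = Cmp M n (Cmp M (c i) (t i))" for m n
    by (rule colimit_unique[OF l D]) (use mn in \<open>auto simp flip: cancel\<close>)
qed

text \<open>
  Isomorphisms \<open>t\<close> of families in \<open>Cat\<close> are, objectwise, isomorphisms of categories on the nose and
  not merely equivalences. Hence a cocone over the reindexed diagram becomes one over \<open>D\<close> by
  reindexing along \<open>S\<close>.
\<close>

lemma colimit_iso_shape: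
  assumes l: "is_colimit D l c" and D: "D \<in> Fun J M"
    and T: "T \<in> Fun I J" and S: "S \<in> Fun J I"
    and ST: "S \<odot> T = id_fun I" and TS: "T \<odot> S = id_fun J"
  shows "is_colimit (D \<odot> T) l (\<lambda>i. c (FO T i))"
proof -
  have I: "category I" and J: "category J" and M: "category M"
    using Fun_catS[OF T] Fun_catS[OF D] Fun_catT[OF D] by auto
  have DT: "D \<odot> T \<in> Fun I M" using T D by (rule comp_Fun)
  have inv: "FO T (FO S j) = j" "FA T (FA S b) = b" if "j \<in> Obj J" "b \<in> Arr J" for j b
    using that comp_FO[OF S, of j T] comp_FA[OF S, of b T] unfolding TS by auto
  have invo: "FO T (FO S j) = j" if "j \<in> Obj J" for j
    using that comp_FO[OF S, of j T] unfolding TS by auto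
  have cocone: "is_cocone D l' c' \<longleftrightarrow> is_cocone (D \<odot> T) l' (\<lambda>i. c' (FO T i))" for l' c'
  proof
    assume "is_cocone D l' c'"
    then show "is_cocone (D \<odot> T) l' (\<lambda>i. c' (FO T i))"
      unfolding cocone_iff[OF D] cocone_iff[OF DT]
      using I by (auto simp: Fun_rules[OF T] comp_FO[OF T] comp_FA[OF T]) (metis Fun_arr[OF T])
  next
    assume *: "is_cocone (D \<odot> T) l' (\<lambda>i. c' (FO T i))"
    show "is_cocone D l' c'"
      unfolding cocone_iff[OF D]
    proof (intro conjI ballI)
      fix i assume i: "i \<in> Obj J"
      have "FO S i \<in> Obj I" using i by (simp add: Fun_rules[OF S])
      then show "c' i \<in> Arr M" "Dom M (c' i) = FO D i" "Cod M (c' i) = l'"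
        using * invo[OF i] unfolding cocone_iff[OF DT] by (auto simp: comp_FO[OF T])
    next
      fix f assume f: "f \<in> Arr J"
      have "FA S f \<in> Arr I" using f by (simp add: Fun_rules[OF S])
      then have "Cmp M (c' (FO T (Cod I (FA S f)))) (FA (D \<odot> T) (FA S f)) = c' (FO T (Dom I (FA S f)))"
        using * unfolding cocone_iff[OF DT] by blast
      then show "Cmp M (c' (Cod J f)) (FA D f) = c' (Dom J f)"
        using f J \<open>FA S f \<in> Arr I\<close> inv[of "Dom J f" f]
        by (simp add: Fun_rules[OF S] comp_FA[OF T] invo)
    qed (use * in \<open>auto simp: cocone_iff[OF DT]\<close>)
  qed
  show ?thesis
  proof (rule is_colimitI[OF DT])
    show "is_cocone (D \<odot> T) l (\<lambda>i. c (FO T i))" using colimit_cocone[OF l] cocone by blast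
    fix l' c' assume c': "is_cocone (D \<odot> T) l' c'"
    have ST': "FO S (FO T i) = i" if "i \<in> Obj I" for i
      using that comp_FO[OF T, of i S] unfolding ST by auto
    have "is_cocone (D \<odot> T) l' (\<lambda>i. c' (FO S (FO T i)))"
      using c' I unfolding cocone_iff[OF DT] by (simp add: ST')
    then have "is_cocone D l' (\<lambda>j. c' (FO S j))" using cocone by blast
    from colimit_ex[OF l D this] obtain m where
      m: "m \<in> Arr M" "Dom M m = l" "Cod M m = l'" "\<And>j. j \<in> Obj J \<Longrightarrow> Cmp M m (c j) = c' (FO S j)"
      by blast
    then show "\<exists>m. m \<in> Arr M \<and> Dom M m = l \<and> Cod M m = l' \<and>
        (\<forall>i\<in>Obj I. Cmp M m (c (FO T i)) = c' i)"
      by (auto simp: ST' Fun_rules[OF T])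
  next
    fix m n assume mn: "m \<in> Arr M" "n \<in> Arr M" "Dom M m = l" "Dom M n = l" "Cod M n = Cod M m"
      "\<forall>i\<in>Obj I. Cmp M m (c (FO T i)) = Cmp M n (c (FO T i))"
    show "m = n"
    proof (rule colimit_unique[OF l D])
      fix j assume j: "j \<in> Obj J"
      have "FO S j \<in> Obj I" using j by (simp add: Fun_rules[OF S])
      then show "Cmp M m (c j) = Cmp M n (c j)" using mn(6) invo[OF j] by fastforce
    qed (use mn in auto)
  qed
qed

section \<open>The category of small categories\<close>

text \<open>
  Structure maps are \<open>undefined\<close> off their domains, so agreement on the domains suffices. This is
  what makes a small category recoverable from its code.
\<close>

lemma category_eqI:
  fixes C D :: "('o, 'a) cat"
  assumes C: "category C" and D: "category D" and "Obj C = Obj D" and "Arr C = Arr D"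
    and "\<And>f. f \<in> Arr C \<Longrightarrow> Dom C f = Dom D f" and "\<And>f. f \<in> Arr C \<Longrightarrow> Cod C f = Cod D f"
    and "\<And>a. a \<in> Obj C \<Longrightarrow> Ident C a = Ident D a"
    and "\<And>f g. f \<in> Arr C \<Longrightarrow> g \<in> Arr C \<Longrightarrow> Cod C f = Dom C g \<Longrightarrow> Cmp C g f = Cmp D g f"
  shows "C = D"
proof -
  have "Dom C = Dom D"
    using assms PiE_ext[of "Dom C" "Arr C" _ "Dom D"] unfolding category_def by metis
  moreover have "Cod C = Cod D"
    using assms PiE_ext[of "Cod C" "Arr C" _ "Cod D"] unfolding category_def by metis
  moreover have "Ident C = Ident D"
    using assms PiE_ext[of "Ident C" "Obj C" _ "Ident D"] unfolding category_def by metis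
  moreover have "Cmp C g f = Cmp D g f" for f g
  proof (cases "f \<in> Arr C \<and> g \<in> Arr C \<and> Cod C f = Dom C g")
    case False
    then have "\<not> (f \<in> Arr D \<and> g \<in> Arr D \<and> Cod D f = Dom D g)" using assms by auto
    then show ?thesis using C D False unfolding category_def by metis
  qed (use assms in blast)
  ultimately show ?thesis using assms(3,4) by (intro cat.equality ext) auto
qed

lemma small_catD:
  fixes C :: "'u::two_inaccessibles ucat"
  assumes "small_cat C"
  shows "category C" and "a \<in> Obj C \<Longrightarrow> small_set a" and "f \<in> Arr C \<Longrightarrow> small_set f"
    and "|Obj C| <o (kappa0 :: 'u rel)" and "|Arr C| <o (kappa0 :: 'u rel)"
    and "|Obj C| <o (kappa1 :: 'u rel)" and "|Arr C| <o (kappa1 :: 'u rel)"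
  using assms kappa0_kappa1 unfolding small_cat_def by auto

lemma card_of_compositions:
  fixes C :: "'u::two_inaccessibles ucat"
  assumes "small_cat C"
  shows "|{vpair (vpair g f) (Cmp C g f) |g f. f \<in> Arr C \<and> g \<in> Arr C \<and> Cod C f = Dom C g}|
    <o (kappa0 :: 'u rel)" (is "|?A| <o _")
proof -
  have "|Arr C \<times> Arr C| <o (kappa0 :: 'u rel)"
    by (rule stable_elim[OF kappa0_stable]) (use small_catD[OF assms] in auto)
  then have "|(\<lambda>(g, f). vpair (vpair g f) (Cmp C g f)) ` (Arr C \<times> Arr C)| <o (kappa0 :: 'u rel)"
    by (rule card_of_image_less)
  then show ?thesis by (rule card_of_subset_less) force
qed

lemma small_vcat:
  assumes "small_cat C" shows "small_set (vcat C)"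
proof -
  note C = small_catD[OF assms]
  show ?thesis unfolding vcat_def
    by (intro small_vpair small_vset small_vgraph card_of_compositions assms)
      (use C in \<open>auto intro!: small_vpair\<close>)
qed

lemma vcat_inject:
  assumes C: "small_cat C" and D: "small_cat D" and eq: "vcat C = vcat D"
  shows "C = D"
proof -
  note CD = small_catD[OF C] small_catD[OF D]
  have parts: "vset (Obj C) = vset (Obj D)" "vset (Arr C) = vset (Arr D)"
    "vgraph (Arr C) (Dom C) = vgraph (Arr D) (Dom D)"
    "vgraph (Arr C) (Cod C) = vgraph (Arr D) (Cod D)"
    "vgraph (Obj C) (Ident C) = vgraph (Obj D) (Ident D)"
    "vset {vpair (vpair g f) (Cmp C g f) |g f. f \<in> Arr C \<and> g \<in> Arr C \<and> Cod C f = Dom C g} =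
     vset {vpair (vpair g f) (Cmp D g f) |g f. f \<in> Arr D \<and> g \<in> Arr D \<and> Cod D f = Dom D g}"
    using eq unfolding vcat_def by auto
  from parts(6) have comps:
    "{vpair (vpair g f) (Cmp C g f) |g f. f \<in> Arr C \<and> g \<in> Arr C \<and> Cod C f = Dom C g} =
     {vpair (vpair g f) (Cmp D g f) |g f. f \<in> Arr D \<and> g \<in> Arr D \<and> Cod D f = Dom D g}"
    using vset_inject[OF kappa0_kappa1[OF card_of_compositions[OF C]]
        kappa0_kappa1[OF card_of_compositions[OF D]]] by blast
  show ?thesis
  proof (rule category_eqI)
    show "Obj C = Obj D" "Arr C = Arr D" using parts CD by (simp_all add: vset_inject)
    show "Dom C f = Dom D f" "Cod C f = Cod D f" if "f \<in> Arr C" for f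
      using parts(3,4) CD that vgraph_inject by metis+
    show "Ident C a = Ident D a" if "a \<in> Obj C" for a
      using parts(5) CD that vgraph_inject by metis
    fix f g assume "f \<in> Arr C" "g \<in> Arr C" "Cod C f = Dom C g"
    then have "vpair (vpair g f) (Cmp C g f) \<in>
       {vpair (vpair g f) (Cmp D g f) |g f. f \<in> Arr D \<and> g \<in> Arr D \<and> Cod D f = Dom D g}"
      unfolding comps[symmetric] by blast
    then show "Cmp C g f = Cmp D g f" by auto
  qed (use CD in auto)
qed

lemma cat_of_vcat [simp]: "small_cat C \<Longrightarrow> cat_of (vcat C) = C"
  unfolding cat_of_def using vcat_inject by blast

lemma small_funD:
  assumes "small_fun G"
  shows "G \<in> Fun (Src G) (Tgt G)" and "small_cat (Src G)" and "small_cat (Tgt G)"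
  using assms unfolding small_fun_def Fun_def by auto

lemma small_fun_Fun: "G \<in> Fun C D \<Longrightarrow> small_cat C \<Longrightarrow> small_cat D \<Longrightarrow> small_fun G"
  unfolding small_fun_def Fun_def by auto

lemma small_vfun:
  assumes "small_fun G" shows "small_set (vfun G)"
proof -
  note G = small_funD[OF assms]
  show ?thesis unfolding vfun_def
    by (intro small_vpair small_vset small_vgraph small_vcat G)
      (use small_catD[OF G(2)] small_catD[OF G(3)] Fun_rules[OF G(1)] in auto)
qed

lemma vfun_inject:
  assumes G: "small_fun G" and H: "small_fun H" and eq: "vfun G = vfun H"
  shows "G = H"
proof -
  note GH = small_funD[OF G] small_funD[OF H]
  have parts: "vcat (Src G) = vcat (Src H)" "vcat (Tgt G) = vcat (Tgt H)"
    "vgraph (Obj (Src G)) (FO G) = vgraph (Obj (Src H)) (FO H)"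
    "vgraph (Arr (Src G)) (FA G) = vgraph (Arr (Src H)) (FA H)"
    using eq unfolding vfun_def by auto
  then have st: "Src H = Src G" "Tgt H = Tgt G" using vcat_inject GH by metis+
  note small = small_catD[OF GH(2)]
  show ?thesis
  proof (rule functor_eqI[OF GH(1)])
    show "H \<in> Fun (Src G) (Tgt G)" using GH(4) st by simp
    show "FO G a = FO H a" if "a \<in> Obj (Src G)" for a
      using parts(3) small that st vgraph_inject by metis
    show "FA G a = FA H a" if "a \<in> Arr (Src G)" for a
      using parts(4) small that st vgraph_inject by metis
  qed
qed

lemma fun_of_vfun [simp]: "small_fun G \<Longrightarrow> fun_of (vfun G) = G"
  unfolding fun_of_def using vfun_inject by blast

lemma small_fun_id: "small_cat C \<Longrightarrow> small_fun (id_fun C)"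
  using small_catD(1) small_fun_Fun id_fun_Fun by blast

lemma small_fun_comp: "small_fun F \<Longrightarrow> small_fun G \<Longrightarrow> Tgt F = Src G \<Longrightarrow> small_fun (G \<odot> F)"
  using small_funD comp_Fun small_fun_Fun by metis

lemma Obj_Cat: "c \<in> Obj Cat \<longleftrightarrow> (\<exists>C. small_cat C \<and> c = vcat C)"
  unfolding Cat_def by auto

lemma Arr_Cat: "a \<in> Arr Cat \<longleftrightarrow> (\<exists>G. small_fun G \<and> a = vfun G)"
  unfolding Cat_def by auto

lemma vcat_Cat [simp]: "small_cat C \<Longrightarrow> vcat C \<in> Obj Cat"
  unfolding Obj_Cat by blast

lemma vfun_Cat [simp]: "small_fun G \<Longrightarrow> vfun G \<in> Arr Cat"
  unfolding Arr_Cat by blast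

lemma Cat_vfun [simp]:
  assumes "small_fun G"
  shows "Dom Cat (vfun G) = vcat (Src G)" and "Cod Cat (vfun G) = vcat (Tgt G)"
proof -
  have "vfun G \<in> vfun ` Collect small_fun" using assms by blast
  then show "Dom Cat (vfun G) = vcat (Src G)" "Cod Cat (vfun G) = vcat (Tgt G)"
    using assms by (simp_all add: Cat_def)
qed

lemma Ident_Cat [simp]:
  assumes "small_cat C" shows "Ident Cat (vcat C) = vfun (id_fun C)"
proof -
  have "vcat C \<in> vcat ` Collect small_cat" using assms by blast
  then show ?thesis using assms by (simp add: Cat_def)
qed

lemma Cmp_Cat [simp]:
  assumes "small_fun F" and "small_fun G" and "Tgt F = Src G"
  shows "Cmp Cat (vfun G) (vfun F) = vfun (G \<odot> F)"
proof -
  have "vfun F \<in> vfun ` Collect small_fun" "vfun G \<in> vfun ` Collect small_fun"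
    using assms by blast+
  then show ?thesis using assms by (simp add: Cat_def)
qed

lemma cat_of_Cat:
  "c \<in> Obj Cat \<Longrightarrow> small_cat (cat_of c)" "c \<in> Obj Cat \<Longrightarrow> vcat (cat_of c) = c"
  unfolding Obj_Cat by auto

lemma fun_of_Cat:
  assumes "a \<in> Arr Cat"
  shows "small_fun (fun_of a)" and "vfun (fun_of a) = a"
    and "fun_of a \<in> Fun (cat_of (Dom Cat a)) (cat_of (Cod Cat a))"
proof -
  obtain G where G: "small_fun G" "a = vfun G" using assms Arr_Cat by blast
  then show "small_fun (fun_of a)" "vfun (fun_of a) = a" by auto
  show "fun_of a \<in> Fun (cat_of (Dom Cat a)) (cat_of (Cod Cat a))" using G small_funD[OF G(1)] by simp
qed

lemma fun_of_Cmp: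
  assumes "a \<in> Arr Cat" and "b \<in> Arr Cat" and "Cod Cat a = Dom Cat b"
  shows "fun_of (Cmp Cat b a) = fun_of b \<odot> fun_of a"
proof -
  obtain F where F: "small_fun F" "a = vfun F" using assms Arr_Cat by blast
  obtain G where G: "small_fun G" "b = vfun G" using assms Arr_Cat by blast
  have "Tgt F = Src G"
    using F G assms(3) vcat_inject small_funD[OF F(1)] small_funD[OF G(1)] by simp
  then show ?thesis using F G by (simp add: small_fun_comp)
qed

lemma fun_of_Ident: "c \<in> Obj Cat \<Longrightarrow> fun_of (Ident Cat c) = id_fun (cat_of c)"
  unfolding Obj_Cat by (auto simp: small_fun_id)

lemma category_Cat: "category Cat"
proof -
  have eq: "Tgt (fun_of a) = Src (fun_of b)"
    if "a \<in> vfun ` Collect small_fun" "b \<in> vfun ` Collect small_fun"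
      "vcat (Tgt (fun_of a)) = vcat (Src (fun_of b))" for a b
    using that vcat_inject[of "Tgt (fun_of a)" "Src (fun_of b)"] by (auto simp: small_funD(2,3))
  show ?thesis unfolding Cat_def
  proof (rule category_make_cat, goal_cases)
    case (4 f g)
    then show ?case using eq[OF 4] by (auto simp: small_fun_comp)
  next
    case (5 f)
    then show ?case by (auto simp: small_funD small_fun_id comp_id_right[OF small_funD(1)])
  next
    case (6 f)
    then show ?case by (auto simp: small_funD small_fun_id comp_id_left[OF small_funD(1)])
  next
    case (7 f g h)
    obtain F where F: "f = vfun F" "small_fun F" using 7 by blast
    obtain G where G: "g = vfun G" "small_fun G" using 7 by blast
    obtain H where H: "h = vfun H" "small_fun H" using 7 by blast
    have FG: "Tgt F = Src G" and GH: "Tgt G = Src H"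
      using eq[OF 7(1,2,4)] eq[OF 7(2,3,5)] F G H by simp_all
    have "(H \<odot> G) \<odot> F = H \<odot> (G \<odot> F)"
      using small_funD(1)[OF F(2)] small_funD(1)[OF G(2)] small_funD(1)[OF H(2)] FG GH
      by (intro comp_assoc) auto
    then show ?case using F G H FG GH by (simp add: small_fun_comp)
  qed (auto dest: small_funD simp: small_fun_id)
qed

lemma moderately_small_Cat: "moderately_small_cat Cat"
proof -
  have "Obj Cat \<subseteq> Collect small_set" "Arr Cat \<subseteq> Collect small_set"
    using small_vcat small_vfun by (auto simp: Obj_Cat Arr_Cat)
  then show ?thesis
    unfolding moderately_small_cat_def
    using category_Cat card_of_subset_less[OF card_of_small_sets] by blast
qed

subsection \<open>Functors into the category of small categories\<close>

abbreviation val :: "'u::two_inaccessibles func \<Rightarrow> 'u \<Rightarrow> 'u ucat" where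
  "val x u \<equiv> cat_of (FO x u)"

abbreviation act :: "'u::two_inaccessibles func \<Rightarrow> 'u \<Rightarrow> 'u func" where
  "act x \<alpha> \<equiv> fun_of (FA x \<alpha>)"

context
  fixes x :: "'u::two_inaccessibles func" and U :: "'u ucat"
  assumes x: "x \<in> Fun U Cat"
begin

lemma val_small: "u \<in> Obj U \<Longrightarrow> small_cat (val x u)"
  using cat_of_Cat Fun_obj[OF x] by blast

lemma val_category: "u \<in> Obj U \<Longrightarrow> category (val x u)"
  using val_small small_catD by blast

lemma vcat_val: "u \<in> Obj U \<Longrightarrow> vcat (val x u) = FO x u"
  using cat_of_Cat Fun_obj[OF x] by blast

lemma act_Fun: "\<alpha> \<in> Arr U \<Longrightarrow> act x \<alpha> \<in> Fun (val x (Dom U \<alpha>)) (val x (Cod U \<alpha>))"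
  using fun_of_Cat(3)[of "FA x \<alpha>"] Fun_arr[OF x] by simp

lemma act_small: "\<alpha> \<in> Arr U \<Longrightarrow> small_fun (act x \<alpha>)"
  using fun_of_Cat(1)[of "FA x \<alpha>"] Fun_arr[OF x] by simp

lemma vfun_act: "\<alpha> \<in> Arr U \<Longrightarrow> vfun (act x \<alpha>) = FA x \<alpha>"
  using fun_of_Cat(2)[of "FA x \<alpha>"] Fun_arr[OF x] by simp

lemma act_Ident: "u \<in> Obj U \<Longrightarrow> act x (Ident U u) = id_fun (val x u)"
  by (simp add: fun_of_Ident Fun_rules[OF x])

lemma act_Cmp:
  "\<alpha> \<in> Arr U \<Longrightarrow> \<beta> \<in> Arr U \<Longrightarrow> Cod U \<alpha> = Dom U \<beta> \<Longrightarrow> act x (Cmp U \<beta> \<alpha>) = act x \<beta> \<odot> act x \<alpha>"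
  by (simp add: fun_of_Cmp Fun_rules[OF x] Fun_Cmp[OF x])

lemma act_Ident_obj: "u \<in> Obj U \<Longrightarrow> i \<in> Obj (val x u) \<Longrightarrow> FO (act x (Ident U u)) i = i"
  and act_Ident_arr: "u \<in> Obj U \<Longrightarrow> b \<in> Arr (val x u) \<Longrightarrow> FA (act x (Ident U u)) b = b"
  by (simp_all add: act_Ident)

lemma act_Cmp_obj:
  "\<alpha> \<in> Arr U \<Longrightarrow> \<beta> \<in> Arr U \<Longrightarrow> Cod U \<alpha> = Dom U \<beta> \<Longrightarrow> i \<in> Obj (val x (Dom U \<alpha>)) \<Longrightarrow>
    FO (act x (Cmp U \<beta> \<alpha>)) i = FO (act x \<beta>) (FO (act x \<alpha>) i)"
  and act_Cmp_arr:
  "\<alpha> \<in> Arr U \<Longrightarrow> \<beta> \<in> Arr U \<Longrightarrow> Cod U \<alpha> = Dom U \<beta> \<Longrightarrow> b \<in> Arr (val x (Dom U \<alpha>)) \<Longrightarrow>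
    FA (act x (Cmp U \<beta> \<alpha>)) b = FA (act x \<beta>) (FA (act x \<alpha>) b)"
  by (simp_all add: act_Cmp comp_FO[OF act_Fun] comp_FA[OF act_Fun])

text \<open>
  The source and target of \<open>\<alpha>\<close> are separate variables in the following rules, so that they also
  rewrite terms in which \<open>Dom U \<alpha>\<close> or \<open>Cod U \<alpha>\<close> has been replaced by a name for it.
\<close>

lemma act_obj:
  "\<alpha> \<in> Arr U \<Longrightarrow> Cod U \<alpha> = v \<Longrightarrow> i \<in> Obj (val x (Dom U \<alpha>)) \<Longrightarrow> FO (act x \<alpha>) i \<in> Obj (val x v)"
  using Fun_obj[OF act_Fun] by blast

lemma act_arr:
  assumes "\<alpha> \<in> Arr U" and "Cod U \<alpha> = v" and "Dom U \<alpha> = u" and "b \<in> Arr (val x u)"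
  shows "FA (act x \<alpha>) b \<in> Arr (val x v)"
    and "Dom (val x v) (FA (act x \<alpha>) b) = FO (act x \<alpha>) (Dom (val x u) b)"
    and "Cod (val x v) (FA (act x \<alpha>) b) = FO (act x \<alpha>) (Cod (val x u) b)"
  using assms Fun_arr[OF act_Fun] by blast+

lemma act_id:
  assumes "\<alpha> \<in> Arr U" and "Dom U \<alpha> = u" and "i \<in> Obj (val x u)"
  shows "FA (act x \<alpha>) (Ident (val x u) i) = Ident (val x (Cod U \<alpha>)) (FO (act x \<alpha>) i)"
  using assms Fun_Ident[OF act_Fun] by blast

lemma act_cmp:
  assumes "\<alpha> \<in> Arr U" and "Dom U \<alpha> = u" and "b \<in> Arr (val x u)" and "c \<in> Arr (val x u)"
    and "Cod (val x u) b = Dom (val x u) c"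
  shows "FA (act x \<alpha>) (Cmp (val x u) c b) =
    Cmp (val x (Cod U \<alpha>)) (FA (act x \<alpha>) c) (FA (act x \<alpha>) b)"
  using assms Fun_Cmp[OF act_Fun] by blast

lemmas act_rules = val_category act_Ident_obj act_Ident_arr act_Cmp_obj act_Cmp_arr
  act_obj act_arr act_id act_cmp

end

lemma make_fun_Cat:
  assumes U: "category U" and C: "\<And>u. u \<in> Obj U \<Longrightarrow> small_cat (C u)"
    and E: "\<And>\<alpha>. \<alpha> \<in> Arr U \<Longrightarrow> E \<alpha> \<in> Fun (C (Dom U \<alpha>)) (C (Cod U \<alpha>))"
    and "\<And>u. u \<in> Obj U \<Longrightarrow> E (Ident U u) = id_fun (C u)"
    and "\<And>\<alpha> \<beta>. \<alpha> \<in> Arr U \<Longrightarrow> \<beta> \<in> Arr U \<Longrightarrow> Cod U \<alpha> = Dom U \<beta> \<Longrightarrow> E (Cmp U \<beta> \<alpha>) = E \<beta> \<odot> E \<alpha>"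
  shows "make_fun U Cat (\<lambda>u. vcat (C u)) (\<lambda>\<alpha>. vfun (E \<alpha>)) \<in> Fun U Cat"
proof -
  have small: "small_fun (E \<alpha>)" "Src (E \<alpha>) = C (Dom U \<alpha>)" "Tgt (E \<alpha>) = C (Cod U \<alpha>)"
    if "\<alpha> \<in> Arr U" for \<alpha>
    using E[OF that] C U that by (auto intro!: small_fun_Fun simp: Fun_Src Fun_Tgt)
  show ?thesis
    by (rule make_fun_in_Fun) (use assms small category_Cat in auto)
qed

text \<open>
  An isomorphism in \<open>Cat\<close> is the code of an invertible functor.
\<close>

lemma nat_iso_Cat:
  assumes t: "is_nat_iso x y t" and x: "x \<in> Fun U Cat" and u: "u \<in> Obj U"
  shows "fun_of (t u) \<in> Fun (val x u) (val y u)"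
    and "\<exists>S \<in> Fun (val y u) (val x u). S \<odot> fun_of (t u) = id_fun (val x u) \<and>
       fun_of (t u) \<odot> S = id_fun (val y u)"
proof -
  note tD = nat_isoD[OF t x]
  show "fun_of (t u) \<in> Fun (val x u) (val y u)" using fun_of_Cat(3)[OF tD(2)[OF u]] tD u by simp
  obtain g where g: "t u \<in> Arr Cat" "g \<in> Arr Cat" "Dom Cat g = Cod Cat (t u)"
    "Cod Cat g = Dom Cat (t u)" "Cmp Cat g (t u) = Ident Cat (Dom Cat (t u))"
    "Cmp Cat (t u) g = Ident Cat (Cod Cat (t u))"
    using tD(5)[OF u] by (rule is_isoE)
  have "fun_of g \<in> Fun (val y u) (val x u)" using fun_of_Cat(3)[OF g(2)] g tD u by simp
  moreover have "fun_of g \<odot> fun_of (t u) = id_fun (val x u)"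
    using fun_of_Cmp[OF g(1) g(2)] g tD(3)[OF u] fun_of_Ident[OF Fun_obj[OF x u]] by simp
  moreover have "fun_of (t u) \<odot> fun_of g = id_fun (val y u)"
    using fun_of_Cmp[OF g(2) g(1)] g tD(4)[OF u] fun_of_Ident[OF Fun_obj[OF tD(1) u]] by simp
  ultimately show "\<exists>S \<in> Fun (val y u) (val x u). S \<odot> fun_of (t u) = id_fun (val x u) \<and>
       fun_of (t u) \<odot> S = id_fun (val y u)" by blast
qed

lemma nat_iso_Cat_natural:
  assumes t: "is_nat_iso x y t" and x: "x \<in> Fun U Cat" and \<alpha>: "\<alpha> \<in> Arr U"
  shows "fun_of (t (Cod U \<alpha>)) \<odot> act x \<alpha> = act y \<alpha> \<odot> fun_of (t (Dom U \<alpha>))"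
proof -
  note tD = nat_isoD[OF t x] and U = Fun_catS[OF x]
  have "Dom U \<alpha> \<in> Obj U" "Cod U \<alpha> \<in> Obj U" using \<alpha> U by auto
  then show ?thesis
    using tD(2-4) \<alpha> arg_cong[OF tD(6)[OF \<alpha>], of fun_of]
    by (simp add: fun_of_Cmp Fun_rules[OF x] Fun_rules[OF tD(1)])
qed

section \<open>Oplax colimits\<close>

text \<open>The code of the arrow \<open>(\<alpha>, \<beta>)\<close> with source \<open>(u, i)\<close> in an oplax colimit.\<close>

abbreviation garr :: "'u::two_inaccessibles \<Rightarrow> 'u \<Rightarrow> 'u \<Rightarrow> 'u \<Rightarrow> 'u" where
  "garr u i \<alpha> \<beta> \<equiv> vpair (vpair u i) (vpair \<alpha> \<beta>)"

context
  fixes x :: "'u::two_inaccessibles func" and U :: "'u ucat"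
  assumes x: "x \<in> Fun U Cat"
begin

lemma gr_obj: "vpair u i \<in> Obj (gr x) \<longleftrightarrow> u \<in> Obj U \<and> i \<in> Obj (val x u)"
  unfolding gr_def oplax_def Fun_Src[OF x] by simp

lemma gr_objE:
  assumes "s \<in> Obj (gr x)"
  obtains u i where "s = vpair u i" "u \<in> Obj U" "i \<in> Obj (val x u)"
  using assms unfolding gr_def oplax_def Fun_Src[OF x] by auto

lemma gr_arr: "garr u i \<alpha> \<beta> \<in> Arr (gr x) \<longleftrightarrow> \<alpha> \<in> Arr U \<and> Dom U \<alpha> = u \<and> i \<in> Obj (val x u) \<and>
    \<beta> \<in> Arr (val x (Cod U \<alpha>)) \<and> Dom (val x (Cod U \<alpha>)) \<beta> = FO (act x \<alpha>) i"
  unfolding gr_def oplax_def Fun_Src[OF x] by auto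

lemma gr_arrE:
  assumes "a \<in> Arr (gr x)"
  obtains u v i \<alpha> \<beta> where "a = garr u i \<alpha> \<beta>" "\<alpha> \<in> Arr U" "Dom U \<alpha> = u" "Cod U \<alpha> = v"
    "u \<in> Obj U" "v \<in> Obj U" "i \<in> Obj (val x u)"
    "\<beta> \<in> Arr (val x v)" "Dom (val x v) \<beta> = FO (act x \<alpha>) i"
  using assms Fun_catS[OF x] unfolding gr_def oplax_def Fun_Src[OF x] by auto

lemma gr_Dom: "garr u i \<alpha> \<beta> \<in> Arr (gr x) \<Longrightarrow> Dom (gr x) (garr u i \<alpha> \<beta>) = vpair u i"
  and gr_Cod: "garr u i \<alpha> \<beta> \<in> Arr (gr x) \<Longrightarrow>
    Cod (gr x) (garr u i \<alpha> \<beta>) = vpair (Cod U \<alpha>) (Cod (val x (Cod U \<alpha>)) \<beta>)"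
  unfolding gr_def oplax_def Fun_Src[OF x] by simp_all

lemma gr_Ident: "u \<in> Obj U \<Longrightarrow> i \<in> Obj (val x u) \<Longrightarrow>
    Ident (gr x) (vpair u i) = garr u i (Ident U u) (Ident (val x u) i)"
  unfolding gr_def oplax_def Fun_Src[OF x] by simp

lemma gr_Cmp:
  "garr u i \<alpha> \<beta> \<in> Arr (gr x) \<Longrightarrow> garr v k \<alpha>' \<beta>' \<in> Arr (gr x) \<Longrightarrow>
    v = Cod U \<alpha> \<Longrightarrow> k = Cod (val x v) \<beta> \<Longrightarrow>
    Cmp (gr x) (garr v k \<alpha>' \<beta>') (garr u i \<alpha> \<beta>) =
      garr u i (Cmp U \<alpha>' \<alpha>) (Cmp (val x (Cod U \<alpha>')) \<beta>' (FA (act x \<alpha>') \<beta>))"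
  unfolding gr_def oplax_def Fun_Src[OF x] make_cat_simps(2)
  by (subst make_cat_simps(6)) (use Fun_catS[OF x] in \<open>auto simp: Let_def act_rules[OF x]\<close>)

lemma category_gr: "category (gr x)"
proof -
  note U = Fun_catS[OF x]
  show ?thesis
    unfolding gr_def oplax_def Fun_Src[OF x] Let_def
  proof (rule category_make_cat, goal_cases)
    case (4 f g)
    then show ?case using U by (clarsimp simp: act_rules[OF x])
  next
    case (5 f)
    then show ?case using U by (clarsimp simp: act_rules[OF x])
  next
    case (6 f)
    then show ?case using U by (clarsimp simp: act_rules[OF x])
  next
    case (7 f g h)
    then show ?case using U by (clarsimp simp: act_rules[OF x] cat_assoc)
  qed (use U in \<open>auto simp: act_rules[OF x]\<close>)
qed

lemmas gr_rules = gr_obj gr_arr gr_Dom gr_Cod gr_Ident gr_Cmp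

lemma gr_proj_Fun: "gr_proj x \<in> Fun (gr x) U"
  unfolding gr_proj_def Fun_Src[OF x]
proof (rule make_fun_in_Fun[OF category_gr Fun_catS[OF x]], goal_cases)
  case (4 f g)
  then show ?case by (auto simp: gr_rules elim!: gr_arrE)
qed (auto simp: gr_rules elim!: gr_arrE gr_objE)

lemma gr_proj_FO: "vpair u i \<in> Obj (gr x) \<Longrightarrow> FO (gr_proj x) (vpair u i) = u"
  and gr_proj_FA: "garr u i \<alpha> \<beta> \<in> Arr (gr x) \<Longrightarrow> FA (gr_proj x) (garr u i \<alpha> \<beta>) = \<alpha>"
  unfolding gr_proj_def by simp_all

lemma fibre_Fun:
  assumes u: "u \<in> Obj U" shows "fibre x u \<in> Fun (val x u) (gr x)"
  unfolding fibre_def Fun_Src[OF x]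
  by (rule make_fun_in_Fun)
    (use u Fun_catS[OF x] category_gr in \<open>auto simp: gr_rules act_rules[OF x]\<close>)

lemma fibre_FO: "i \<in> Obj (val x u) \<Longrightarrow> FO (fibre x u) i = vpair u i"
  and fibre_FA: "b \<in> Arr (val x u) \<Longrightarrow> FA (fibre x u) b = garr u (Dom (val x u) b) (Ident U u) b"
  unfolding fibre_def Fun_Src[OF x] by simp_all

lemma fibre_arr:
  assumes "u \<in> Obj U" and "b \<in> Arr (val x u)"
  shows "FA (fibre x u) b \<in> Arr (gr x)"
    and "Dom (gr x) (FA (fibre x u) b) = vpair u (Dom (val x u) b)"
    and "Cod (gr x) (FA (fibre x u) b) = vpair u (Cod (val x u) b)"
  using assms Fun_arr[OF fibre_Fun] by (auto simp: fibre_FO act_rules[OF x])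

lemma gr_functor_eqI:
  assumes "G \<in> Fun (gr x) D" and "H \<in> Fun (gr x) D"
    and "\<And>u i. vpair u i \<in> Obj (gr x) \<Longrightarrow> FO G (vpair u i) = FO H (vpair u i)"
    and "\<And>u i \<alpha> \<beta>. garr u i \<alpha> \<beta> \<in> Arr (gr x) \<Longrightarrow> FA G (garr u i \<alpha> \<beta>) = FA H (garr u i \<alpha> \<beta>)"
  shows "G = H"
  by (rule functor_eqI[OF assms(1,2)]) (metis assms(3) gr_objE, metis assms(4) gr_arrE)

lemma gr_lift: "\<alpha> \<in> Arr U \<Longrightarrow> gr_lift x \<alpha> i =
    garr (Dom U \<alpha>) i \<alpha> (Ident (val x (Cod U \<alpha>)) (FO (act x \<alpha>) i))"
  unfolding gr_lift_def Fun_Src[OF x] ..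

lemma gr_lift_arr:
  assumes "\<alpha> \<in> Arr U" and "Dom U \<alpha> = u" and "i \<in> Obj (val x u)"
  shows "gr_lift x \<alpha> i \<in> Arr (gr x)" and "Dom (gr x) (gr_lift x \<alpha> i) = vpair u i"
    and "Cod (gr x) (gr_lift x \<alpha> i) = vpair (Cod U \<alpha>) (FO (act x \<alpha>) i)"
  using assms Fun_catS[OF x] by (auto simp: gr_lift gr_rules act_rules[OF x])

text \<open>
  Together with \<open>fibre_gr_lift\<close>, \<open>gr_lift_Cmp\<close> and \<open>gr_lift_Ident\<close> this presents \<open>\<lbrakk>x\<rbrakk>\<close> by generators and
  relations: the generators are the arrows of the fibres and the arrows \<open>(\<alpha>, id)\<close>.
\<close>

lemma gr_arr_factor:
  assumes "garr u i \<alpha> \<beta> \<in> Arr (gr x)"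
  shows "garr u i \<alpha> \<beta> = Cmp (gr x) (FA (fibre x (Cod U \<alpha>)) \<beta>) (gr_lift x \<alpha> i)"
  using assms Fun_catS[OF x] by (auto simp: gr_lift gr_rules act_rules[OF x] fibre_FA)

lemma fibre_gr_lift:
  assumes "\<alpha> \<in> Arr U" and "b \<in> Arr (val x (Dom U \<alpha>))"
  shows "Cmp (gr x) (FA (fibre x (Cod U \<alpha>)) (FA (act x \<alpha>) b)) (gr_lift x \<alpha> (Dom (val x (Dom U \<alpha>)) b))
    = Cmp (gr x) (gr_lift x \<alpha> (Cod (val x (Dom U \<alpha>)) b)) (FA (fibre x (Dom U \<alpha>)) b)"
  using assms Fun_catS[OF x] by (simp add: gr_lift gr_rules act_rules[OF x] fibre_FA)

lemma gr_lift_Cmp: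
  assumes "\<alpha> \<in> Arr U" and "\<beta> \<in> Arr U" and "Cod U \<alpha> = Dom U \<beta>" and "i \<in> Obj (val x (Dom U \<alpha>))"
  shows "gr_lift x (Cmp U \<beta> \<alpha>) i = Cmp (gr x) (gr_lift x \<beta> (FO (act x \<alpha>) i)) (gr_lift x \<alpha> i)"
  using assms Fun_catS[OF x] by (simp add: gr_lift gr_rules act_rules[OF x])

lemma gr_lift_Ident:
  assumes "u \<in> Obj U" and "i \<in> Obj (val x u)"
  shows "gr_lift x (Ident U u) i = Ident (gr x) (vpair u i)"
  using assms Fun_catS[OF x] by (simp add: gr_lift gr_rules act_rules[OF x])

lemma card_of_gr:
  fixes r :: "'u rel"
  assumes r: "stable r" and U: "|Obj U| <o r" "|Arr U| <o r"
    and val: "\<And>u. u \<in> Obj U \<Longrightarrow> |Obj (val x u)| <o r \<and> |Arr (val x u)| <o r"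
  shows "|Obj (gr x)| <o r" and "|Arr (gr x)| <o r"
proof -
  have "|SIGMA u:Obj U. Obj (val x u)| <o r"
    by (rule stable_elim[OF r]) (use U val in auto)
  from card_of_image_less[OF this, of "\<lambda>(u, i). vpair u i"]
  show obj: "|Obj (gr x)| <o r"
    by (rule card_of_subset_less) (force simp: gr_obj elim!: gr_objE)
  have "|SIGMA s:Obj (gr x). SIGMA \<alpha>:Arr U. Arr (val x (Cod U \<alpha>))| <o r"
    by (intro stable_elim[OF r]) (use obj U Fun_catS[OF x] val in auto)
  from card_of_image_less[OF this, of "\<lambda>(s, \<alpha>, \<beta>). vpair s (vpair \<alpha> \<beta>)"]
  show "|Arr (gr x)| <o r"
    by (rule card_of_subset_less) (force simp: gr_obj elim!: gr_arrE)
qed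

lemma small_gr:
  assumes "small_cat U" shows "small_cat (gr x)"
proof -
  note U = small_catD[OF assms]
  note val = small_catD[OF val_small[OF x]]
  have "small_set s" if "s \<in> Obj (gr x)" for s
    using that by (auto elim!: gr_objE intro!: small_vpair intro: U(2) val(2))
  moreover have "small_set a" if "a \<in> Arr (gr x)" for a
    using that U(1) by (auto elim!: gr_arrE intro!: small_vpair intro: U(2) U(3) val(2) val(3))
  ultimately show ?thesis
    using category_gr card_of_gr[OF kappa0_stable U(4,5)] val(4,5) unfolding small_cat_def by blast
qed

lemma moderately_small_gr:
  assumes "moderately_small_cat U" shows "moderately_small_cat (gr x)"
  using assms category_gr card_of_gr[OF kappa1_stable] small_catD(6,7)[OF val_small[OF x]]
  unfolding moderately_small_cat_def by blast

end

subsection \<open>Reindexing and change of the family\<close>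

lemma gr_reindex_Fun:
  assumes h: "h \<in> Fun U V" and y: "y \<in> Fun V Cat"
  shows "gr_reindex y h \<in> Fun (gr (y \<odot> h)) (gr y)"
proof -
  have yh: "y \<odot> h \<in> Fun U Cat" using h y by (rule comp_Fun)
  note U = Fun_catS[OF h] and V = Fun_catS[OF y]
  note rules = gr_rules[OF yh] gr_rules[OF y] comp_FO[OF h] comp_FA[OF h] Fun_rules[OF h]
    act_rules[OF y] Fun_Cmp[OF h]
  show ?thesis unfolding gr_reindex_def Let_def
    by (rule make_fun_in_Fun[OF category_gr[OF yh] category_gr[OF y]])
      (use U V in \<open>auto elim!: gr_objE[OF yh] gr_arrE[OF yh] simp: rules\<close>)
qed

lemma gr_reindex_simps [simp]:
  "vpair u i \<in> Obj (gr (y \<odot> h)) \<Longrightarrow> FO (gr_reindex y h) (vpair u i) = vpair (FO h u) i"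
  "garr u i \<alpha> \<beta> \<in> Arr (gr (y \<odot> h)) \<Longrightarrow>
     FA (gr_reindex y h) (garr u i \<alpha> \<beta>) = garr (FO h u) i (FA h \<alpha>) \<beta>"
  by (simp_all add: gr_reindex_def Let_def)

context
  fixes x y :: "'u::two_inaccessibles func" and t and U :: "'u ucat"
  assumes t: "is_nat_iso x y t" and x: "x \<in> Fun U Cat"
begin

text \<open>
  Naturality of \<open>t\<close>, as an equation between functors, is evaluated at objects (for the sources of
  arrows) and at arrows (for composites).
\<close>

lemma gr_map_Fun: "gr_map x y t \<in> Fun (gr x) (gr y)"
proof -
  note U = Fun_catS[OF x] and y = nat_isoD(1)[OF t x]
  note tF = nat_iso_Cat(1)[OF t x]
  have nat_obj: "FO (fun_of (t v)) (FO (act x \<alpha>) i) = FO (act y \<alpha>) (FO (fun_of (t (Dom U \<alpha>))) i)"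
    if "\<alpha> \<in> Arr U" "i \<in> Obj (val x (Dom U \<alpha>))" "Cod U \<alpha> = v" for \<alpha> i v
    using that arg_cong[OF nat_iso_Cat_natural[OF t x that(1)], of "\<lambda>F. FO F i"] U
    by (simp add: comp_FO[OF act_Fun[OF x]] comp_FO[OF tF])
  have nat_arr: "FA (fun_of (t v)) (FA (act x \<alpha>) b) = FA (act y \<alpha>) (FA (fun_of (t (Dom U \<alpha>))) b)"
    if "\<alpha> \<in> Arr U" "b \<in> Arr (val x (Dom U \<alpha>))" "Cod U \<alpha> = v" for \<alpha> b v
    using that arg_cong[OF nat_iso_Cat_natural[OF t x that(1)], of "\<lambda>F. FA F b"] U
    by (simp add: comp_FA[OF act_Fun[OF x]] comp_FA[OF tF])
  note rules = gr_rules[OF x] gr_rules[OF y] Fun_rules[OF tF] Fun_Cmp[OF tF] act_rules[OF x]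
    act_rules[OF y] nat_obj nat_arr Fun_Src[OF x]
  show ?thesis unfolding gr_map_def Let_def
    by (rule make_fun_in_Fun[OF category_gr[OF x] category_gr[OF y]])
      (use U in \<open>auto elim!: gr_objE[OF x] gr_arrE[OF x] simp: rules\<close>)
qed

lemma gr_map_FO: "vpair u i \<in> Obj (gr x) \<Longrightarrow>
    FO (gr_map x y t) (vpair u i) = vpair u (FO (fun_of (t u)) i)"
  and gr_map_FA: "garr u i \<alpha> \<beta> \<in> Arr (gr x) \<Longrightarrow>
    FA (gr_map x y t) (garr u i \<alpha> \<beta>) =
      garr u (FO (fun_of (t u)) i) \<alpha> (FA (fun_of (t (Cod U \<alpha>))) \<beta>)"
  by (simp_all add: gr_map_def Let_def Fun_Src[OF x])

end

subsection \<open>Iterated oplax colimits\<close>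

context
  fixes x f :: "'u::two_inaccessibles func" and U :: "'u ucat"
  assumes x: "x \<in> Fun U Cat" and f: "f \<in> Fun (gr x) Cat"
begin

lemma comp_fibre_Fun: "u \<in> Obj U \<Longrightarrow> f \<odot> fibre x u \<in> Fun (val x u) Cat"
  using fibre_Fun[OF x] f comp_Fun by blast

lemma val_comp_fibre: "i \<in> Obj (val x u) \<Longrightarrow> u \<in> Obj U \<Longrightarrow> FO (f \<odot> fibre x u) i = FO f (vpair u i)"
  and act_comp_fibre: "b \<in> Arr (val x u) \<Longrightarrow> u \<in> Obj U \<Longrightarrow>
    FA (f \<odot> fibre x u) b = FA f (FA (fibre x u) b)"
  by (simp_all add: comp_FO[OF fibre_Fun[OF x]] comp_FA[OF fibre_Fun[OF x]] fibre_FO[OF x])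

text \<open>
  From here to \<open>sum_Cmp\<close>, the rules of an oplax colimit are specialised to the summand
  \<open>colim\<^sup>o\<^sup>p\<^sup>l\<^sup>a\<^sup>x\<^bsub>i \<in> x(u)\<^esub> f(u, i)\<close>, with the values of \<open>f \<odot> fibre x u\<close> expressed by those of \<open>f\<close>.
\<close>

lemma sum_obj: "u \<in> Obj U \<Longrightarrow> vpair i j \<in> Obj (gr (f \<odot> fibre x u)) \<longleftrightarrow>
    i \<in> Obj (val x u) \<and> j \<in> Obj (val f (vpair u i))"
  using gr_obj[OF comp_fibre_Fun] val_comp_fibre by auto

lemma sum_objE:
  assumes "s \<in> Obj (gr (f \<odot> fibre x u))" and "u \<in> Obj U"
  obtains i j where "s = vpair i j" "i \<in> Obj (val x u)" "j \<in> Obj (val f (vpair u i))"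
  using assms gr_objE[OF comp_fibre_Fun] val_comp_fibre by metis

lemma sum_arr:
  assumes u: "u \<in> Obj U"
  shows "garr i j b c \<in> Arr (gr (f \<odot> fibre x u)) \<longleftrightarrow>
    b \<in> Arr (val x u) \<and> Dom (val x u) b = i \<and> i \<in> Obj (val x u) \<and> j \<in> Obj (val f (vpair u i)) \<and>
    c \<in> Arr (val f (vpair u (Cod (val x u) b))) \<and>
    Dom (val f (vpair u (Cod (val x u) b))) c = FO (act f (FA (fibre x u) b)) j"
  using val_category[OF x u] u
  by (auto simp: gr_arr[OF comp_fibre_Fun[OF u]] val_comp_fibre act_comp_fibre)

lemma sum_arrE:
  assumes a: "a \<in> Arr (gr (f \<odot> fibre x u))" and u: "u \<in> Obj U"
  obtains i j b c k where "a = garr i j b c" "b \<in> Arr (val x u)" "Dom (val x u) b = i"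
    "i \<in> Obj (val x u)" "j \<in> Obj (val f (vpair u i))" "Cod (val x u) b = k" "k \<in> Obj (val x u)"
    "c \<in> Arr (val f (vpair u k))"
    "Dom (val f (vpair u k)) c = FO (act f (FA (fibre x u) b)) j"
proof -
  obtain i j b c where "a = garr i j b c" using a by (rule gr_arrE[OF comp_fibre_Fun[OF u]])
  then show ?thesis using that a sum_arr[OF u] val_category[OF x u] by auto
qed

lemma sum_Dom: "u \<in> Obj U \<Longrightarrow> garr i j b c \<in> Arr (gr (f \<odot> fibre x u)) \<Longrightarrow>
    Dom (gr (f \<odot> fibre x u)) (garr i j b c) = vpair i j"
  by (rule gr_Dom[OF comp_fibre_Fun])

lemma sum_Cod: "u \<in> Obj U \<Longrightarrow> garr i j b c \<in> Arr (gr (f \<odot> fibre x u)) \<Longrightarrow>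
    Cod (gr (f \<odot> fibre x u)) (garr i j b c) =
      vpair (Cod (val x u) b) (Cod (val f (vpair u (Cod (val x u) b))) c)"
  using gr_Cod[OF comp_fibre_Fun] sum_arr val_category[OF x] val_comp_fibre by auto

lemma sum_Ident: "u \<in> Obj U \<Longrightarrow> i \<in> Obj (val x u) \<Longrightarrow> j \<in> Obj (val f (vpair u i)) \<Longrightarrow>
    Ident (gr (f \<odot> fibre x u)) (vpair i j) = garr i j (Ident (val x u) i) (Ident (val f (vpair u i)) j)"
  using gr_Ident[OF comp_fibre_Fun] val_comp_fibre by auto

lemma sum_Cmp:
  assumes "u \<in> Obj U" and "garr i j b c \<in> Arr (gr (f \<odot> fibre x u))"
    and "garr i' j' b' c' \<in> Arr (gr (f \<odot> fibre x u))"
    and "i' = Cod (val x u) b" and "j' = Cod (val f (vpair u i')) c"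
  shows "Cmp (gr (f \<odot> fibre x u)) (garr i' j' b' c') (garr i j b c) =
    garr i j (Cmp (val x u) b' b)
      (Cmp (val f (vpair u (Cod (val x u) b'))) c' (FA (act f (FA (fibre x u) b')) c))"
  using assms gr_Cmp[OF comp_fibre_Fun[OF assms(1)] assms(2,3)] val_category[OF x assms(1)]
  by (auto simp: val_comp_fibre act_comp_fibre sum_arr)

lemmas sum_rules = sum_obj sum_arr sum_Dom sum_Cod sum_Ident sum_Cmp

end

text \<open>
  The functor coded by \<open>FA (oplax_sum x f) \<alpha>\<close>. Decoding returns it only once it is known to be a
  functor between small categories, so this has to be proved about the functor itself.
\<close>

definition sum_act :: "'u::two_inaccessibles func \<Rightarrow> 'u func \<Rightarrow> 'u \<Rightarrow> 'u func" where
  "sum_act x f \<alpha> = make_fun (gr (f \<odot> fibre x (Dom (Src x) \<alpha>))) (gr (f \<odot> fibre x (Cod (Src x) \<alpha>)))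
     (\<lambda>s. vpair (FO (act x \<alpha>) (vfst s)) (FO (act f (gr_lift x \<alpha> (vfst s))) (vsnd s)))
     (\<lambda>a. vpair (vpair (FO (act x \<alpha>) (vfst (vfst a)))
                       (FO (act f (gr_lift x \<alpha> (vfst (vfst a)))) (vsnd (vfst a))))
        (vpair (FA (act x \<alpha>) (vfst (vsnd a)))
               (FA (act f (gr_lift x \<alpha> (Cod (val x (Dom (Src x) \<alpha>)) (vfst (vsnd a)))))
                   (vsnd (vsnd a)))))"

lemma oplax_sum_eq: "oplax_sum x f =
    make_fun (Src x) Cat (\<lambda>u. vcat (gr (f \<odot> fibre x u))) (\<lambda>\<alpha>. vfun (sum_act x f \<alpha>))"
  unfolding oplax_sum_def sum_act_def Let_def ..

context
  fixes x f :: "'u::two_inaccessibles func" and U :: "'u ucat"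
  assumes x: "x \<in> Fun U Cat" and f: "f \<in> Fun (gr x) Cat"
begin

lemma sum_act_FO:
  assumes "\<alpha> \<in> Arr U" and "Dom U \<alpha> = u" and "i \<in> Obj (val x u)" and "j \<in> Obj (val f (vpair u i))"
  shows "FO (sum_act x f \<alpha>) (vpair i j) = vpair (FO (act x \<alpha>) i) (FO (act f (gr_lift x \<alpha> i)) j)"
  using assms Fun_catS[OF x] unfolding sum_act_def Fun_Src[OF x]
  by (subst make_fun_simps(3)) (auto simp: sum_obj[OF x f])

lemma sum_act_FA:
  assumes "\<alpha> \<in> Arr U" and "Dom U \<alpha> = u" and "garr i j b c \<in> Arr (gr (f \<odot> fibre x u))"
  shows "FA (sum_act x f \<alpha>) (garr i j b c) =
    garr (FO (act x \<alpha>) i) (FO (act f (gr_lift x \<alpha> i)) j) (FA (act x \<alpha>) b)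
      (FA (act f (gr_lift x \<alpha> (Cod (val x u) b))) c)"
  using assms unfolding sum_act_def Fun_Src[OF x] by (subst make_fun_simps(4)) auto

text \<open>
  The square of \<open>fibre_gr_lift\<close> under \<open>f\<close>. It makes the arrow part of \<open>sum_act x f \<alpha>\<close> well-typed
  and compatible with composition.
\<close>

lemma act_fibre_lift:
  assumes \<alpha>: "\<alpha> \<in> Arr U" "Dom U \<alpha> = u" "Cod U \<alpha> = v" and b: "b \<in> Arr (val x u)" "Dom (val x u) b = i"
  shows "j \<in> Obj (val f (vpair u i)) \<Longrightarrow>
      FO (act f (FA (fibre x v) (FA (act x \<alpha>) b))) (FO (act f (gr_lift x \<alpha> i)) j) =
      FO (act f (gr_lift x \<alpha> (Cod (val x u) b))) (FO (act f (FA (fibre x u) b)) j)"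
    and "c \<in> Arr (val f (vpair u i)) \<Longrightarrow>
      FA (act f (FA (fibre x v) (FA (act x \<alpha>) b))) (FA (act f (gr_lift x \<alpha> i)) c) =
      FA (act f (gr_lift x \<alpha> (Cod (val x u) b))) (FA (act f (FA (fibre x u) b)) c)"
proof -
  have uv: "u \<in> Obj U" "v \<in> Obj U" using \<alpha> Fun_catS[OF x] by auto
  have ik: "i \<in> Obj (val x u)" "Cod (val x u) b \<in> Obj (val x u)"
    using b val_category[OF x uv(1)] by auto
  have "FA (act x \<alpha>) b \<in> Arr (val x v)" using \<alpha> b by (simp add: act_rules[OF x])
  note arrs = fibre_arr[OF x uv(2) this] fibre_arr[OF x uv(1) b(1)]
    gr_lift_arr[OF x \<alpha>(1,2) ik(1)] gr_lift_arr[OF x \<alpha>(1,2) ik(2)]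
  note eq = fibre_gr_lift[OF x \<alpha>(1), unfolded \<alpha>(2,3), OF b(1)]
  show "FO (act f (FA (fibre x v) (FA (act x \<alpha>) b))) (FO (act f (gr_lift x \<alpha> i)) j) =
      FO (act f (gr_lift x \<alpha> (Cod (val x u) b))) (FO (act f (FA (fibre x u) b)) j)"
    if "j \<in> Obj (val f (vpair u i))"
    using that arg_cong[OF eq, of "\<lambda>a. FO (act f a) j"] arrs \<alpha> b uv
    by (simp add: act_rules[OF f] act_rules[OF x])
  show "FA (act f (FA (fibre x v) (FA (act x \<alpha>) b))) (FA (act f (gr_lift x \<alpha> i)) c) =
      FA (act f (gr_lift x \<alpha> (Cod (val x u) b))) (FA (act f (FA (fibre x u) b)) c)"
    if "c \<in> Arr (val f (vpair u i))"
    using that arg_cong[OF eq, of "\<lambda>a. FA (act f a) c"] arrs \<alpha> b uv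
    by (simp add: act_rules[OF f] act_rules[OF x])
qed

lemma sum_act_Fun:
  assumes \<alpha>: "\<alpha> \<in> Arr U" "Dom U \<alpha> = u" "Cod U \<alpha> = v"
  shows "sum_act x f \<alpha> \<in> Fun (gr (f \<odot> fibre x u)) (gr (f \<odot> fibre x v))"
proof -
  have u: "u \<in> Obj U" and v: "v \<in> Obj U" using \<alpha> Fun_catS[OF x] by auto
  note cu = comp_fibre_Fun[OF x f u] and cv = comp_fibre_Fun[OF x f v]
  note rules = \<alpha> u v sum_rules[OF x f] gr_lift_arr[OF x] fibre_arr[OF x] act_fibre_lift
    act_rules[OF x] act_rules[OF f] gr_obj[OF x]
  show ?thesis
    unfolding sum_act_def Fun_Src[OF x] \<alpha>(2,3)
  proof (rule make_fun_in_Fun[OF category_gr[OF cu] category_gr[OF cv]], goal_cases)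
    case (1 s)
    then show ?case by (auto elim!: sum_objE[OF x f _ u] simp: rules)
  next
    case (2 a)
    then show ?case by (auto elim!: sum_arrE[OF x f _ u] simp: rules)
  next
    case (3 s)
    then show ?case by (auto elim!: sum_objE[OF x f _ u] simp: rules)
  next
    case (4 a b)
    then show ?case by (auto elim!: sum_arrE[OF x f _ u] simp: rules)
  qed
qed

lemma oplax_sum_Fun: "oplax_sum x f \<in> Fun U Cat"
  unfolding oplax_sum_eq Fun_Src[OF x]
proof (rule make_fun_Cat)
  show U: "category U" using Fun_catS[OF x] .
  show "small_cat (gr (f \<odot> fibre x u))" if "u \<in> Obj U" for u
    using small_gr[OF comp_fibre_Fun[OF x f that]] val_small[OF x that] .
  show "sum_act x f \<alpha> \<in> Fun (gr (f \<odot> fibre x (Dom U \<alpha>))) (gr (f \<odot> fibre x (Cod U \<alpha>)))"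
    if "\<alpha> \<in> Arr U" for \<alpha>
    using sum_act_Fun that by blast
  note rules = sum_act_FO sum_act_FA sum_rules[OF x f] gr_lift_arr[OF x] fibre_arr[OF x]
    act_rules[OF x] act_rules[OF f] gr_obj[OF x] gr_lift_Ident[OF x] gr_lift_Cmp[OF x]
    act_fibre_lift
  show "sum_act x f (Ident U u) = id_fun (gr (f \<odot> fibre x u))" if u: "u \<in> Obj U" for u
  proof (rule functor_eqI)
    show "sum_act x f (Ident U u) \<in> Fun (gr (f \<odot> fibre x u)) (gr (f \<odot> fibre x u))"
      using sum_act_Fun u U by simp
    show "id_fun (gr (f \<odot> fibre x u)) \<in> Fun (gr (f \<odot> fibre x u)) (gr (f \<odot> fibre x u))"
      using category_gr[OF comp_fibre_Fun[OF x f u]] by simp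
  qed (use u U in \<open>auto elim!: sum_objE[OF x f _ u] sum_arrE[OF x f _ u] simp: rules\<close>)
  show "sum_act x f (Cmp U \<beta> \<alpha>) = sum_act x f \<beta> \<odot> sum_act x f \<alpha>"
    if ab: "\<alpha> \<in> Arr U" "\<beta> \<in> Arr U" "Cod U \<alpha> = Dom U \<beta>" for \<alpha> \<beta>
  proof -
    have u: "Dom U \<alpha> \<in> Obj U" using ab U by simp
    note F = sum_act_Fun[OF ab(1) refl ab(3)] and G = sum_act_Fun[OF ab(2) refl refl]
    show ?thesis
    proof (rule functor_eqI[OF _ comp_Fun[OF F G]])
      show "sum_act x f (Cmp U \<beta> \<alpha>) \<in> Fun (gr (f \<odot> fibre x (Dom U \<alpha>))) (gr (f \<odot> fibre x (Cod U \<beta>)))"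
        using sum_act_Fun ab U by simp
    qed (use u U ab in \<open>auto elim!: sum_objE[OF x f _ u] sum_arrE[OF x f _ u]
        simp: rules comp_FO[OF F] comp_FA[OF F]\<close>)
  qed
qed

lemma oplax_sum_simps:
  shows "u \<in> Obj U \<Longrightarrow> val (oplax_sum x f) u = gr (f \<odot> fibre x u)"
    and "\<alpha> \<in> Arr U \<Longrightarrow> act (oplax_sum x f) \<alpha> = sum_act x f \<alpha>"
proof -
  have small: "small_cat (gr (f \<odot> fibre x u))" if "u \<in> Obj U" for u
    using small_gr[OF comp_fibre_Fun[OF x f that]] val_small[OF x that] .
  then show "u \<in> Obj U \<Longrightarrow> val (oplax_sum x f) u = gr (f \<odot> fibre x u)"
    unfolding oplax_sum_eq Fun_Src[OF x] by simp
  show "act (oplax_sum x f) \<alpha> = sum_act x f \<alpha>" if "\<alpha> \<in> Arr U"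
    unfolding oplax_sum_eq Fun_Src[OF x]
    using that small small_fun_Fun[OF sum_act_Fun[OF that refl refl]] Fun_catS[OF x] by simp
qed

lemma flatten_FO: "vpair (vpair u i) j \<in> Obj (gr f) \<Longrightarrow>
    FO (flatten_fun x f) (vpair (vpair u i) j) = vpair u (vpair i j)"
  unfolding flatten_fun_def Let_def by simp

lemma flatten_FA:
  assumes "garr (vpair u i) j (garr u i \<alpha> \<beta>) \<gamma> \<in> Arr (gr f)"
  shows "FA (flatten_fun x f) (garr (vpair u i) j (garr u i \<alpha> \<beta>) \<gamma>) =
    garr u (vpair i j) \<alpha> (garr (FO (act x \<alpha>) i) (FO (act f (gr_lift x \<alpha> i)) j) \<beta> \<gamma>)"
  using assms unfolding flatten_fun_def Let_def
  by (auto simp: gr_arr[OF f] gr_arr[OF x] gr_obj[OF x] oplax_sum_simps sum_act_FO)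

lemma gr2_arrE:
  assumes "a \<in> Arr (gr f)"
  obtains u v i j k \<alpha> \<beta> \<gamma> where "a = garr (vpair u i) j (garr u i \<alpha> \<beta>) \<gamma>"
    "\<alpha> \<in> Arr U" "Dom U \<alpha> = u" "Cod U \<alpha> = v" "u \<in> Obj U" "v \<in> Obj U" "i \<in> Obj (val x u)"
    "\<beta> \<in> Arr (val x v)" "Dom (val x v) \<beta> = FO (act x \<alpha>) i" "Cod (val x v) \<beta> = k" "k \<in> Obj (val x v)"
    "garr u i \<alpha> \<beta> \<in> Arr (gr x)" "j \<in> Obj (val f (vpair u i))"
    "\<gamma> \<in> Arr (val f (vpair v k))"
    "Dom (val f (vpair v k)) \<gamma> = FO (act f (garr u i \<alpha> \<beta>)) j"
  using assms
proof (rule gr_arrE[OF f])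
  fix s t j a' \<gamma> assume 1: "a = garr s j a' \<gamma>" "a' \<in> Arr (gr x)" "Dom (gr x) a' = s" "Cod (gr x) a' = t"
    "s \<in> Obj (gr x)" "t \<in> Obj (gr x)" "j \<in> Obj (val f s)"
    "\<gamma> \<in> Arr (val f t)" "Dom (val f t) \<gamma> = FO (act f a') j"
  from 1(2) obtain u v i \<alpha> \<beta> where 2: "a' = garr u i \<alpha> \<beta>" "\<alpha> \<in> Arr U" "Dom U \<alpha> = u" "Cod U \<alpha> = v"
    "u \<in> Obj U" "v \<in> Obj U" "i \<in> Obj (val x u)"
    "\<beta> \<in> Arr (val x v)" "Dom (val x v) \<beta> = FO (act x \<alpha>) i"
    by (rule gr_arrE[OF x])
  show thesis
    by (rule that[of u i j \<alpha> \<beta> \<gamma> v "Cod (val x v) \<beta>"])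
      (use 1 2 val_category[OF x 2(6)] in \<open>auto simp: gr_Dom[OF x] gr_Cod[OF x]\<close>)
qed

text \<open>
  The factorisation of \<open>gr_arr_factor\<close> under \<open>f\<close>: an arrow of \<open>\<lbrakk>f\<rbrakk>\<close> and its image under flattening
  differ just in whether \<open>f(\<alpha>, \<beta>)\<close> is applied at once or in two steps.
\<close>

lemma act_factor:
  assumes "garr u i \<alpha> \<beta> \<in> Arr (gr x)" and "Cod U \<alpha> = v"
  shows "j \<in> Obj (val f (vpair u i)) \<Longrightarrow> FO (act f (garr u i \<alpha> \<beta>)) j =
      FO (act f (FA (fibre x v) \<beta>)) (FO (act f (gr_lift x \<alpha> i)) j)"
    and "c \<in> Arr (val f (vpair u i)) \<Longrightarrow> FA (act f (garr u i \<alpha> \<beta>)) c =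
      FA (act f (FA (fibre x v) \<beta>)) (FA (act f (gr_lift x \<alpha> i)) c)"
proof -
  have a: "\<alpha> \<in> Arr U" "Dom U \<alpha> = u" "Cod U \<alpha> = v" "v \<in> Obj U" "i \<in> Obj (val x u)"
    "\<beta> \<in> Arr (val x v)" "Dom (val x v) \<beta> = FO (act x \<alpha>) i"
    using assms Fun_catS[OF x] by (auto simp: gr_arr[OF x])
  note arrs = fibre_arr[OF x a(4) a(6)] gr_lift_arr[OF x a(1) a(2) a(5)]
  note eq = gr_arr_factor[OF x assms(1), unfolded a(3)]
  show "FO (act f (garr u i \<alpha> \<beta>)) j = FO (act f (FA (fibre x v) \<beta>)) (FO (act f (gr_lift x \<alpha> i)) j)"
    if "j \<in> Obj (val f (vpair u i))"
    unfolding eq using that arrs a by (simp add: act_rules[OF f])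
  show "FA (act f (garr u i \<alpha> \<beta>)) c = FA (act f (FA (fibre x v) \<beta>)) (FA (act f (gr_lift x \<alpha> i)) c)"
    if "c \<in> Arr (val f (vpair u i))"
    unfolding eq using that arrs a by (simp add: act_rules[OF f])
qed

lemma flatten_Fun: "flatten_fun x f \<in> Fun (gr f) (gr (oplax_sum x f))"
proof -
  note U = Fun_catS[OF x]
  note s = oplax_sum_Fun
  let ?F = "flatten_fun x f"
  have mk: "?F = make_fun (gr f) (gr (oplax_sum x f)) (FO ?F) (FA ?F)"
    unfolding flatten_fun_def Let_def make_fun_def by simp
  note rules = gr_rules[OF s] gr_rules[OF f] flatten_FO flatten_FA oplax_sum_simps sum_act_FO
    sum_act_FA sum_rules[OF x f] gr_rules[OF x] act_rules[OF x] act_rules[OF f] act_factor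
    gr_lift_arr[OF x] fibre_arr[OF x] U
  have typing: "FA ?F a \<in> Arr (gr (oplax_sum x f)) \<and>
      Dom (gr (oplax_sum x f)) (FA ?F a) = FO ?F (Dom (gr f) a) \<and>
      Cod (gr (oplax_sum x f)) (FA ?F a) = FO ?F (Cod (gr f) a)" if "a \<in> Arr (gr f)" for a
    using that by (auto elim!: gr2_arrE simp: rules)
  show ?thesis
  proof (subst mk, rule make_fun_in_Fun[OF category_gr[OF f] category_gr[OF s]], goal_cases)
    case (1 s)
    then show ?case by (auto elim!: gr_objE[OF f] gr_objE[OF x] simp: rules)
  next
    case (2 a)
    then show ?case using typing by blast
  next
    case (3 s)
    from 3 obtain u i j where s': "s = vpair (vpair u i) j" "u \<in> Obj U" "i \<in> Obj (val x u)"
      "j \<in> Obj (val f (vpair u i))" "vpair u i \<in> Obj (gr x)"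
      by (auto elim!: gr_objE[OF f] gr_objE[OF x] simp: gr_obj[OF x])
    have id: "Ident (gr f) s = garr (vpair u i) j (garr u i (Ident U u) (Ident (val x u) i))
        (Ident (val f (vpair u i)) j)"
      using s' by (simp add: gr_Ident[OF f] gr_Ident[OF x])
    have "Ident (gr f) s \<in> Arr (gr f)" using 3 category_gr[OF f] by simp
    from flatten_FA[OF this[unfolded id]] show ?case
      unfolding id using s'
      by (simp add: gr_lift_Ident[OF x] act_Ident_obj[OF x] act_Ident_obj[OF f] flatten_FO
          gr_Ident[OF s] gr_obj[OF s] gr_obj[OF f] oplax_sum_simps sum_obj[OF x f] sum_Ident[OF x f])
  next
    case (4 a b)
    from 4(1) obtain u v i j k \<alpha> \<beta> \<gamma> where a: "a = garr (vpair u i) j (garr u i \<alpha> \<beta>) \<gamma>"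
      "\<alpha> \<in> Arr U" "Dom U \<alpha> = u" "Cod U \<alpha> = v" "u \<in> Obj U" "v \<in> Obj U" "i \<in> Obj (val x u)"
      "\<beta> \<in> Arr (val x v)" "Dom (val x v) \<beta> = FO (act x \<alpha>) i" "Cod (val x v) \<beta> = k"
      "k \<in> Obj (val x v)" "garr u i \<alpha> \<beta> \<in> Arr (gr x)" "j \<in> Obj (val f (vpair u i))"
      "\<gamma> \<in> Arr (val f (vpair v k))"
      "Dom (val f (vpair v k)) \<gamma> = FO (act f (garr u i \<alpha> \<beta>)) j"
      by (rule gr2_arrE)
    from 4(2) obtain v' w i' j' k' \<alpha>' \<beta>' \<gamma>' where b: "b = garr (vpair v' i') j' (garr v' i' \<alpha>' \<beta>') \<gamma>'"
      "\<alpha>' \<in> Arr U" "Dom U \<alpha>' = v'" "Cod U \<alpha>' = w" "v' \<in> Obj U" "w \<in> Obj U" "i' \<in> Obj (val x v')"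
      "\<beta>' \<in> Arr (val x w)" "Dom (val x w) \<beta>' = FO (act x \<alpha>') i'" "Cod (val x w) \<beta>' = k'"
      "k' \<in> Obj (val x w)" "garr v' i' \<alpha>' \<beta>' \<in> Arr (gr x)" "j' \<in> Obj (val f (vpair v' i'))"
      "\<gamma>' \<in> Arr (val f (vpair w k'))"
      "Dom (val f (vpair w k')) \<gamma>' = FO (act f (garr v' i' \<alpha>' \<beta>')) j'"
      by (rule gr2_arrE)
    have fits: "v' = v" "i' = k" "j' = Cod (val f (vpair v k)) \<gamma>"
      using 4 a b by (auto simp: gr_Dom[OF f] gr_Cod[OF f] gr_Cod[OF x])
    note ab = a(2-) b(2-)[unfolded fits]
    have xdc: "Dom (gr x) (garr u i \<alpha> \<beta>) = vpair u i" "Cod (gr x) (garr u i \<alpha> \<beta>) = vpair v k"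
      "Dom (gr x) (garr v k \<alpha>' \<beta>') = vpair v k" "Cod (gr x) (garr v k \<alpha>' \<beta>') = vpair w k'"
      using ab by (simp_all add: gr_Dom[OF x] gr_Cod[OF x])
    have in_f: "garr (vpair u i) j (garr u i \<alpha> \<beta>) \<gamma> \<in> Arr (gr f)"
      "garr (vpair v k) j' (garr v k \<alpha>' \<beta>') \<gamma>' \<in> Arr (gr f)"
      using 4 a(1) b(1) fits by auto
    have comp_x: "Cmp (gr x) (garr v k \<alpha>' \<beta>') (garr u i \<alpha> \<beta>) =
        garr u i (Cmp U \<alpha>' \<alpha>) (Cmp (val x w) \<beta>' (FA (act x \<alpha>') \<beta>))"
      using ab by (simp add: gr_Cmp[OF x])
    have comp_f: "Cmp (gr f) b a = garr (vpair u i) j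
        (garr u i (Cmp U \<alpha>' \<alpha>) (Cmp (val x w) \<beta>' (FA (act x \<alpha>') \<beta>)))
        (Cmp (val f (vpair w k')) \<gamma>' (FA (act f (garr v k \<alpha>' \<beta>')) \<gamma>))"
      unfolding a(1) b(1) fits using gr_Cmp[OF f in_f] fits(3) by (simp add: xdc comp_x)
    have "Cmp (gr f) b a \<in> Arr (gr f)" using 4 category_gr[OF f] by simp
    from flatten_FA[OF this[unfolded comp_f]]
    have lhs: "FA ?F (Cmp (gr f) b a) = garr u (vpair i j) (Cmp U \<alpha>' \<alpha>)
        (garr (FO (act x (Cmp U \<alpha>' \<alpha>)) i) (FO (act f (gr_lift x (Cmp U \<alpha>' \<alpha>) i)) j)
          (Cmp (val x w) \<beta>' (FA (act x \<alpha>') \<beta>))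
          (Cmp (val f (vpair w k')) \<gamma>' (FA (act f (garr v k \<alpha>' \<beta>')) \<gamma>)))"
      unfolding comp_f .
    let ?p = "garr (FO (act x \<alpha>) i) (FO (act f (gr_lift x \<alpha> i)) j) \<beta> \<gamma>"
    let ?q = "garr (FO (act x \<alpha>') k) (FO (act f (gr_lift x \<alpha>' k)) j') \<beta>' \<gamma>'"
    have Fa: "FA ?F a = garr u (vpair i j) \<alpha> ?p" and Fb: "FA ?F b = garr v (vpair k j') \<alpha>' ?q"
      using flatten_FA in_f unfolding a(1) b(1) fits by auto
    have in_s: "garr u (vpair i j) \<alpha> ?p \<in> Arr (gr (oplax_sum x f))"
      "garr v (vpair k j') \<alpha>' ?q \<in> Arr (gr (oplax_sum x f))"
      using typing[OF 4(1)] typing[OF 4(2)] Fa Fb by auto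
    have p: "?p \<in> Arr (gr (f \<odot> fibre x v))" and q: "?q \<in> Arr (gr (f \<odot> fibre x w))"
      using in_s ab by (simp_all add: gr_arr[OF s] oplax_sum_simps)
    have "Cod (gr (f \<odot> fibre x v)) ?p = vpair k j'"
      using sum_Cod[OF x f ab(5) p] ab fits(3) by simp
    then have "Cmp (gr (oplax_sum x f)) (FA ?F b) (FA ?F a) = garr u (vpair i j) (Cmp U \<alpha>' \<alpha>)
        (Cmp (gr (f \<odot> fibre x w)) ?q (FA (sum_act x f \<alpha>') ?p))"
      unfolding Fa Fb using gr_Cmp[OF s in_s] ab by (simp add: oplax_sum_simps)
    also have "FA (sum_act x f \<alpha>') ?p = garr (FO (act x \<alpha>') (FO (act x \<alpha>) i))
        (FO (act f (gr_lift x \<alpha>' (FO (act x \<alpha>) i))) (FO (act f (gr_lift x \<alpha> i)) j))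
        (FA (act x \<alpha>') \<beta>) (FA (act f (gr_lift x \<alpha>' k)) \<gamma>)" (is "_ = ?r")
      using sum_act_FA[OF _ _ p] ab by simp
    also have "Cmp (gr (f \<odot> fibre x w)) ?q ?r = garr (FO (act x \<alpha>') (FO (act x \<alpha>) i))
        (FO (act f (gr_lift x \<alpha>' (FO (act x \<alpha>) i))) (FO (act f (gr_lift x \<alpha> i)) j))
        (Cmp (val x w) \<beta>' (FA (act x \<alpha>') \<beta>))
        (Cmp (val f (vpair w k')) \<gamma>' (FA (act f (FA (fibre x w) \<beta>')) (FA (act f (gr_lift x \<alpha>' k)) \<gamma>)))"
    proof -
      have "?r \<in> Arr (gr (f \<odot> fibre x w))"
        using Fun_arr(1)[OF sum_act_Fun p] sum_act_FA[OF _ _ p] ab by simp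
      from sum_Cmp[OF x f _ this q] show ?thesis
        using ab fits(3) by (simp add: act_rules[OF x] act_rules[OF f] gr_lift_arr[OF x])
    qed
    finally show ?case
      unfolding lhs using ab act_factor(2)[OF ab(25)]
      by (simp add: act_Cmp_obj[OF x] act_Cmp_obj[OF f] gr_lift_Cmp[OF x] gr_lift_arr[OF x] act_obj[OF x])
  qed
qed

end

section \<open>Fibrewise colimits\<close>

text \<open>
  \<open>G\<close> is a pointwise left Kan extension of \<open>f\<close> along the projection \<open>\<lbrakk>x\<rbrakk> \<rightarrow> U\<close>, with unit \<open>c\<close>. As the
  projection is an opfibration, the comma categories in the pointwise formula may be replaced by
  the fibres \<open>x(u)\<close>. The second condition is naturality of \<open>c\<close> on all arrows of \<open>\<lbrakk>x\<rbrakk>\<close>, so that units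
  can be composed without first decomposing arrows.
\<close>

definition is_left_kan ::
  "'u::two_inaccessibles func \<Rightarrow> 'u func \<Rightarrow> 'u func \<Rightarrow> ('u \<Rightarrow> 'u) \<Rightarrow> bool" where
  "is_left_kan x f G c \<longleftrightarrow> G \<in> Fun (Src x) (Tgt f) \<and>
     (\<forall>u\<in>Obj (Src x). is_colimit (f \<odot> fibre x u) (FO G u) (\<lambda>i. c (vpair u i))) \<and>
     (\<forall>a\<in>Arr (gr x). Cmp (Tgt f) (FA G (FA (gr_proj x) a)) (c (Dom (gr x) a)) =
                     Cmp (Tgt f) (c (Cod (gr x) a)) (FA f a))"

context
  fixes x f :: "'u::two_inaccessibles func" and U M :: "'u ucat"
  assumes x: "x \<in> Fun U Cat" and f: "f \<in> Fun (gr x) M"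
begin

lemma fibre_diagram: "u \<in> Obj U \<Longrightarrow> f \<odot> fibre x u \<in> Fun (val x u) M"
  using fibre_Fun[OF x] f comp_Fun by blast

lemma fibre_diagram_simps:
  "u \<in> Obj U \<Longrightarrow> i \<in> Obj (val x u) \<Longrightarrow> FO (f \<odot> fibre x u) i = FO f (vpair u i)"
  "u \<in> Obj U \<Longrightarrow> b \<in> Arr (val x u) \<Longrightarrow> FA (f \<odot> fibre x u) b = FA f (FA (fibre x u) b)"
  by (simp_all add: comp_FO[OF fibre_Fun[OF x]] comp_FA[OF fibre_Fun[OF x]] fibre_FO[OF x])

lemma fibre_cocone_iff:
  assumes u: "u \<in> Obj U"
  shows "is_cocone (f \<odot> fibre x u) l d \<longleftrightarrow> l \<in> Obj M \<and>
    (\<forall>i\<in>Obj (val x u). d i \<in> Arr M \<and> Dom M (d i) = FO f (vpair u i) \<and> Cod M (d i) = l) \<and>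
    (\<forall>b\<in>Arr (val x u). Cmp M (d (Cod (val x u) b)) (FA f (FA (fibre x u) b)) = d (Dom (val x u) b))"
  unfolding cocone_iff[OF fibre_diagram[OF u]] using u by (simp add: fibre_diagram_simps)

lemma left_kanD:
  assumes K: "is_left_kan x f G c"
  shows "G \<in> Fun U M"
    and "u \<in> Obj U \<Longrightarrow> is_colimit (f \<odot> fibre x u) (FO G u) (\<lambda>i. c (vpair u i))"
    and "garr u i \<alpha> \<beta> \<in> Arr (gr x) \<Longrightarrow> Cod U \<alpha> = v \<Longrightarrow> Cmp M (FA G \<alpha>) (c (vpair u i)) =
      Cmp M (c (vpair v (Cod (val x v) \<beta>))) (FA f (garr u i \<alpha> \<beta>))"
    and "u \<in> Obj U \<Longrightarrow> i \<in> Obj (val x u) \<Longrightarrow> c (vpair u i) \<in> Arr M"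
    and "u \<in> Obj U \<Longrightarrow> i \<in> Obj (val x u) \<Longrightarrow> Dom M (c (vpair u i)) = FO f (vpair u i)"
    and "u \<in> Obj U \<Longrightarrow> i \<in> Obj (val x u) \<Longrightarrow> Cod M (c (vpair u i)) = FO G u"
proof -
  have *: "is_colimit (f \<odot> fibre x u) (FO G u) (\<lambda>i. c (vpair u i))" if "u \<in> Obj U" for u
    using K that unfolding is_left_kan_def Fun_Src[OF x] by blast
  then show "u \<in> Obj U \<Longrightarrow> is_colimit (f \<odot> fibre x u) (FO G u) (\<lambda>i. c (vpair u i))" .
  show "G \<in> Fun U M" using K unfolding is_left_kan_def Fun_Src[OF x] Fun_Tgt[OF f] by blast
  show "Cmp M (FA G \<alpha>) (c (vpair u i)) =
      Cmp M (c (vpair v (Cod (val x v) \<beta>))) (FA f (garr u i \<alpha> \<beta>))"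
    if a: "garr u i \<alpha> \<beta> \<in> Arr (gr x)" and "Cod U \<alpha> = v"
    using K that unfolding is_left_kan_def Fun_Tgt[OF f]
    by (auto simp: gr_proj_FA[OF x a] gr_Dom[OF x a] gr_Cod[OF x a])
  show "u \<in> Obj U \<Longrightarrow> i \<in> Obj (val x u) \<Longrightarrow> c (vpair u i) \<in> Arr M"
    "u \<in> Obj U \<Longrightarrow> i \<in> Obj (val x u) \<Longrightarrow> Dom M (c (vpair u i)) = FO f (vpair u i)"
    "u \<in> Obj U \<Longrightarrow> i \<in> Obj (val x u) \<Longrightarrow> Cod M (c (vpair u i)) = FO G u"
    using colimit_cocone[OF *] by (auto simp: fibre_cocone_iff)
qed

lemma left_kan_lift:
  assumes K: "is_left_kan x f G c" and "\<alpha> \<in> Arr U" and "Dom U \<alpha> = u" and "Cod U \<alpha> = v"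
    and "i \<in> Obj (val x u)"
  shows "Cmp M (FA G \<alpha>) (c (vpair u i)) =
    Cmp M (c (vpair v (FO (act x \<alpha>) i))) (FA f (gr_lift x \<alpha> i))"
proof -
  have "gr_lift x \<alpha> i \<in> Arr (gr x)" using assms by (simp add: gr_lift_arr[OF x])
  moreover have "v \<in> Obj U" using assms Fun_catS[OF x] by auto
  ultimately show ?thesis
    using left_kanD(3)[OF K, of u i \<alpha> "Ident (val x v) (FO (act x \<alpha>) i)" v] assms
    by (simp add: gr_lift[OF x] act_rules[OF x])
qed

text \<open>
  On the arrows of the fibres, naturality of \<open>c\<close> is the cocone condition; the arrows \<open>(\<alpha>, id)\<close> are
  the only other generators.
\<close>

lemma left_kanI:
  assumes G: "G \<in> Fun U M"
    and colim: "\<And>u. u \<in> Obj U \<Longrightarrow> is_colimit (f \<odot> fibre x u) (FO G u) (\<lambda>i. c (vpair u i))"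
    and lift: "\<And>u v \<alpha> i. \<alpha> \<in> Arr U \<Longrightarrow> Dom U \<alpha> = u \<Longrightarrow> Cod U \<alpha> = v \<Longrightarrow> i \<in> Obj (val x u) \<Longrightarrow>
      Cmp M (FA G \<alpha>) (c (vpair u i)) = Cmp M (c (vpair v (FO (act x \<alpha>) i))) (FA f (gr_lift x \<alpha> i))"
  shows "is_left_kan x f G c"
  unfolding is_left_kan_def Fun_Src[OF x] Fun_Tgt[OF f]
proof (intro conjI ballI)
  fix a assume a: "a \<in> Arr (gr x)"
  then obtain u v i \<alpha> \<beta> where e: "a = garr u i \<alpha> \<beta>" "\<alpha> \<in> Arr U" "Dom U \<alpha> = u" "Cod U \<alpha> = v"
    "u \<in> Obj U" "v \<in> Obj U" "i \<in> Obj (val x u)"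
    "\<beta> \<in> Arr (val x v)" "Dom (val x v) \<beta> = FO (act x \<alpha>) i"
    by (rule gr_arrE[OF x])
  note M = Fun_catT[OF f]
  note cocone = colimit_cocone[OF colim[OF e(6)], unfolded fibre_cocone_iff[OF e(6)]]
  have k: "Cod (val x v) \<beta> \<in> Obj (val x v)" and j: "FO (act x \<alpha>) i \<in> Obj (val x v)"
    using e val_category[OF x] by (auto simp: act_rules[OF x])
  note l = gr_lift_arr[OF x e(2,3,7)]
  have "Cmp M (FA G \<alpha>) (c (vpair u i)) = Cmp M (c (vpair v (FO (act x \<alpha>) i))) (FA f (gr_lift x \<alpha> i))"
    using lift e by blast
  also have "c (vpair v (FO (act x \<alpha>) i)) =
      Cmp M (c (vpair v (Cod (val x v) \<beta>))) (FA f (FA (fibre x v) \<beta>))"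
    using cocone e by metis
  also have "Cmp M (Cmp M (c (vpair v (Cod (val x v) \<beta>))) (FA f (FA (fibre x v) \<beta>))) (FA f (gr_lift x \<alpha> i))
      = Cmp M (c (vpair v (Cod (val x v) \<beta>))) (Cmp M (FA f (FA (fibre x v) \<beta>)) (FA f (gr_lift x \<alpha> i)))"
    using M l e cocone k by (intro cat_assoc[symmetric]) (auto simp: Fun_rules[OF f] fibre_arr[OF x])
  also have "Cmp M (FA f (FA (fibre x v) \<beta>)) (FA f (gr_lift x \<alpha> i)) = FA f a"
    using l e Fun_Cmp[OF f] gr_arr_factor[OF x a[unfolded e(1)]] by (simp add: fibre_arr[OF x])
  finally show "Cmp M (FA G (FA (gr_proj x) a)) (c (Dom (gr x) a)) = Cmp M (c (Cod (gr x) a)) (FA f a)"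
    using a e by (simp add: gr_proj_FA[OF x] gr_Dom[OF x] gr_Cod[OF x])
qed (use G colim in auto)

text \<open>
  The cocone that induces the canonical map \<open>colim\<^bsub>i \<in> x(u)\<^esub> f(u, i) \<rightarrow> colim\<^bsub>i \<in> x(v)\<^esub> f(v, i)\<close>.
\<close>

lemma fibre_transport:
  assumes \<alpha>: "\<alpha> \<in> Arr U" "Dom U \<alpha> = u" "Cod U \<alpha> = v"
    and d: "is_cocone (f \<odot> fibre x v) l d"
  shows "is_cocone (f \<odot> fibre x u) l (\<lambda>i. Cmp M (d (FO (act x \<alpha>) i)) (FA f (gr_lift x \<alpha> i)))"
proof -
  have u: "u \<in> Obj U" and v: "v \<in> Obj U" using \<alpha> Fun_catS[OF x] by auto
  note M = Fun_catT[OF f] and d' = d[unfolded fibre_cocone_iff[OF v]]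
  note rules = M \<alpha> u v gr_lift_arr[OF x] fibre_arr[OF x] Fun_rules[OF f] act_rules[OF x] gr_obj[OF x]
  have "Cmp M (Cmp M (d (FO (act x \<alpha>) (Cod (val x u) b))) (FA f (gr_lift x \<alpha> (Cod (val x u) b))))
          (FA f (FA (fibre x u) b)) =
        Cmp M (d (FO (act x \<alpha>) (Dom (val x u) b))) (FA f (gr_lift x \<alpha> (Dom (val x u) b)))"
    if b: "b \<in> Arr (val x u)" for b
  proof -
    let ?i = "Dom (val x u) b" and ?k = "Cod (val x u) b"
    have ik: "?i \<in> Obj (val x u)" "?k \<in> Obj (val x u)" using b u by (simp_all add: act_rules[OF x])
    have xb: "FA (act x \<alpha>) b \<in> Arr (val x v)" using b \<alpha> by (simp add: act_rules[OF x])
    have "Cmp M (Cmp M (d (FO (act x \<alpha>) ?k)) (FA f (gr_lift x \<alpha> ?k))) (FA f (FA (fibre x u) b))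
        = Cmp M (d (FO (act x \<alpha>) ?k)) (FA f (Cmp (gr x) (gr_lift x \<alpha> ?k) (FA (fibre x u) b)))"
      using b ik d' by (simp add: rules Fun_Cmp[OF f] cat_assoc)
    also have "Cmp (gr x) (gr_lift x \<alpha> ?k) (FA (fibre x u) b) =
        Cmp (gr x) (FA (fibre x v) (FA (act x \<alpha>) b)) (gr_lift x \<alpha> ?i)"
      using fibre_gr_lift[OF x \<alpha>(1)] b \<alpha> by simp
    also have "Cmp M (d (FO (act x \<alpha>) ?k)) (FA f \<dots>) =
        Cmp M (Cmp M (d (FO (act x \<alpha>) ?k)) (FA f (FA (fibre x v) (FA (act x \<alpha>) b)))) (FA f (gr_lift x \<alpha> ?i))"
      using b ik xb d' by (simp add: rules Fun_Cmp[OF f] cat_assoc)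
    also have "Cmp M (d (FO (act x \<alpha>) ?k)) (FA f (FA (fibre x v) (FA (act x \<alpha>) b))) = d (FO (act x \<alpha>) ?i)"
      using d' xb b by (metis act_arr(2,3)[OF x \<alpha>(1,3,2) b])
    finally show ?thesis .
  qed
  then show ?thesis
    unfolding fibre_cocone_iff[OF u] using d' by (auto simp: rules)
qed

text \<open>
  The comparison maps between the two colimits at \<open>u\<close> are mutually inverse, and natural because both
  composites agree on each colimit cocone.
\<close>

lemma left_kan_unique:
  assumes K: "is_left_kan x f G c" and L: "is_left_kan x f H d"
  shows "G \<cong>\<^sub>F H"
proof -
  note U = Fun_catS[OF x] and M = Fun_catT[OF f]
  note KD = left_kanD[OF K] and LD = left_kanD[OF L]
  note G = KD(1) and H = LD(1)
  have ex: "\<exists>m. m \<in> Arr M \<and> Dom M m = FO G u \<and> Cod M m = FO H u \<and>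
      (\<forall>i\<in>Obj (val x u). Cmp M m (c (vpair u i)) = d (vpair u i))"
    if KD: "\<And>u. u \<in> Obj U \<Longrightarrow> is_colimit (f \<odot> fibre x u) (FO G u) (\<lambda>i. c (vpair u i))"
      and LD: "\<And>u. u \<in> Obj U \<Longrightarrow> is_colimit (f \<odot> fibre x u) (FO H u) (\<lambda>i. d (vpair u i))"
      and u: "u \<in> Obj U" for G H c d u
    using colimit_ex[OF KD[OF u] fibre_diagram[OF u] colimit_cocone[OF LD[OF u]]] by metis
  define m where "m u = (SOME m. m \<in> Arr M \<and> Dom M m = FO G u \<and> Cod M m = FO H u \<and>
      (\<forall>i\<in>Obj (val x u). Cmp M m (c (vpair u i)) = d (vpair u i)))" for u
  have m: "m u \<in> Arr M" "Dom M (m u) = FO G u" "Cod M (m u) = FO H u"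
      "\<And>i. i \<in> Obj (val x u) \<Longrightarrow> Cmp M (m u) (c (vpair u i)) = d (vpair u i)" if "u \<in> Obj U" for u
    using someI_ex[OF ex[OF KD(2) LD(2) that]] unfolding m_def by auto
  have "is_nat_iso G H m"
  proof (rule nat_isoI[OF G H])
    fix u assume u: "u \<in> Obj U"
    obtain n where n: "n \<in> Arr M" "Dom M n = FO H u" "Cod M n = FO G u"
      "\<And>i. i \<in> Obj (val x u) \<Longrightarrow> Cmp M n (d (vpair u i)) = c (vpair u i)"
      using ex[OF LD(2) KD(2) u] by blast
    have "Cmp M n (m u) = Ident M (FO G u)"
      by (rule colimit_unique[OF KD(2)[OF u] fibre_diagram[OF u]])
        (use u M m[OF u] n KD(4-6) in \<open>auto simp: Fun_rules[OF G] simp flip: cat_assoc\<close>)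
    moreover have "Cmp M (m u) n = Ident M (FO H u)"
      by (rule colimit_unique[OF LD(2)[OF u] fibre_diagram[OF u]])
        (use u M m[OF u] n LD(4-6) in \<open>auto simp: Fun_rules[OF H] simp flip: cat_assoc\<close>)
    ultimately show "Dom M (m u) = FO G u \<and> Cod M (m u) = FO H u \<and> is_iso M (m u)"
      using m[OF u] n by (auto intro: is_isoI)
  next
    fix \<alpha> assume \<alpha>: "\<alpha> \<in> Arr U"
    define u v where uv: "u = Dom U \<alpha>" "v = Cod U \<alpha>"
    have u: "u \<in> Obj U" and v: "v \<in> Obj U" using \<alpha> uv U by auto
    show "Cmp M (m (Cod U \<alpha>)) (FA G \<alpha>) = Cmp M (FA H \<alpha>) (m (Dom U \<alpha>))"
      unfolding uv[symmetric]
    proof (rule colimit_unique[OF KD(2)[OF u] fibre_diagram[OF u]])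
      fix i assume i: "i \<in> Obj (val x u)"
      note types = M m(1-3)[OF u] m(1-3)[OF v] u v i \<alpha> uv[symmetric] KD(4-6) LD(4-6)
        Fun_rules[OF G] Fun_rules[OF H] Fun_rules[OF f] gr_lift_arr[OF x] act_obj[OF x]
      have "Cmp M (Cmp M (m v) (FA G \<alpha>)) (c (vpair u i)) = Cmp M (m v) (Cmp M (FA G \<alpha>) (c (vpair u i)))"
        by (simp add: types cat_assoc)
      also have "\<dots> = Cmp M (m v) (Cmp M (c (vpair v (FO (act x \<alpha>) i))) (FA f (gr_lift x \<alpha> i)))"
        using left_kan_lift[OF K \<alpha>] uv i by simp
      also have "\<dots> = Cmp M (Cmp M (m v) (c (vpair v (FO (act x \<alpha>) i)))) (FA f (gr_lift x \<alpha> i))"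
        by (simp add: types cat_assoc)
      also have "\<dots> = Cmp M (d (vpair v (FO (act x \<alpha>) i))) (FA f (gr_lift x \<alpha> i))"
        using m(4)[OF v] \<alpha> i uv by (simp add: act_obj[OF x])
      also have "\<dots> = Cmp M (FA H \<alpha>) (d (vpair u i))"
        using left_kan_lift[OF L \<alpha>] uv i by simp
      also have "\<dots> = Cmp M (Cmp M (FA H \<alpha>) (m u)) (c (vpair u i))"
        unfolding m(4)[OF u i, symmetric] by (simp add: types cat_assoc del: m(4))
      finally show "Cmp M (Cmp M (m v) (FA G \<alpha>)) (c (vpair u i)) =
        Cmp M (Cmp M (FA H \<alpha>) (m u)) (c (vpair u i))" .
    qed (use M m(1-3)[OF u] m(1-3)[OF v] \<alpha> uv in \<open>auto simp: Fun_rules[OF G] Fun_rules[OF H]\<close>)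
  qed
  then show ?thesis unfolding fun_iso_def by blast
qed

lemma left_kan_iso:
  assumes K: "is_left_kan x f G c" and s: "is_nat_iso f' f s" and f': "f' \<in> Fun (gr x) M"
  shows "is_left_kan x f' G (\<lambda>p. Cmp M (c p) (s p))"
proof -
  note M = Fun_catT[OF f] and KD = left_kanD[OF K] and sD = nat_isoD[OF s f']
  note G = KD(1)
  have fib': "f' \<odot> fibre x u \<in> Fun (val x u) M" if "u \<in> Obj U" for u
    using fibre_Fun[OF x that] f' comp_Fun by blast
  show ?thesis
    unfolding is_left_kan_def Fun_Src[OF x] Fun_Tgt[OF f']
  proof (intro conjI ballI)
    fix u assume u: "u \<in> Obj U"
    have "is_nat_iso (f' \<odot> fibre x u) (f \<odot> fibre x u) (\<lambda>i. s (FO (fibre x u) i))"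
      by (rule nat_iso_whisker_right[OF s f' fibre_Fun[OF x u]])
    from colimit_iso_diagram[OF KD(2)[OF u] fibre_diagram[OF u] fib'[OF u] this]
    have "is_colimit (f' \<odot> fibre x u) (FO G u)
       (\<lambda>i. Cmp M (c (vpair u i)) (s (FO (fibre x u) i)))" .
    then show "is_colimit (f' \<odot> fibre x u) (FO G u) (\<lambda>i. Cmp M (c (vpair u i)) (s (vpair u i)))"
      by (rule colimit_cong[OF _ fib'[OF u]]) (simp add: fibre_FO[OF x])
  next
    fix a assume a: "a \<in> Arr (gr x)"
    then obtain u v i \<alpha> \<beta> where e: "a = garr u i \<alpha> \<beta>" "\<alpha> \<in> Arr U" "Dom U \<alpha> = u" "Cod U \<alpha> = v"
      "u \<in> Obj U" "v \<in> Obj U" "i \<in> Obj (val x u)"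
      "\<beta> \<in> Arr (val x v)" "Dom (val x v) \<beta> = FO (act x \<alpha>) i"
      by (rule gr_arrE[OF x])
    let ?t = "vpair v (Cod (val x v) \<beta>)"
    have st: "Dom (gr x) a = vpair u i" "Cod (gr x) a = ?t" "vpair u i \<in> Obj (gr x)" "?t \<in> Obj (gr x)"
      using a e val_category[OF x] by (auto simp: gr_rules[OF x])
    have k: "Cod (val x v) \<beta> \<in> Obj (val x v)" using st by (simp add: gr_obj[OF x])
    note types = M a st k e(2-7) sD(2-4) KD(4-6) Fun_rules[OF f] Fun_rules[OF f'] Fun_rules[OF G]
    have "Cmp M (FA G \<alpha>) (Cmp M (c (vpair u i)) (s (vpair u i))) =
        Cmp M (Cmp M (FA G \<alpha>) (c (vpair u i))) (s (vpair u i))"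
      by (simp add: types cat_assoc)
    also have "\<dots> = Cmp M (Cmp M (c ?t) (FA f a)) (s (vpair u i))"
      using KD(3)[OF a[unfolded e(1)] e(4)] e(1) by simp
    also have "\<dots> = Cmp M (c ?t) (Cmp M (FA f a) (s (vpair u i)))"
      by (simp add: types cat_assoc)
    also have "Cmp M (FA f a) (s (vpair u i)) = Cmp M (s ?t) (FA f' a)"
      using sD(6)[OF a] st by simp
    also have "Cmp M (c ?t) (Cmp M (s ?t) (FA f' a)) = Cmp M (Cmp M (c ?t) (s ?t)) (FA f' a)"
      by (simp add: types cat_assoc)
    finally show "Cmp M (FA G (FA (gr_proj x) a)) (Cmp M (c (Dom (gr x) a)) (s (Dom (gr x) a))) =
      Cmp M (Cmp M (c (Cod (gr x) a)) (s (Cod (gr x) a))) (FA f' a)"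
      using a st(1,2) by (simp add: e(1) gr_proj_FA[OF x])
  qed (rule G)
qed

text \<open>
  The arrow part of \<open>colim_sum x f\<close> is a definite description; \<open>fibre_transport\<close> and the universal
  property of the colimit at \<open>u\<close> show that it denotes.
\<close>

lemma left_kan_colim_sum:
  assumes co: "cocomplete M"
  shows "is_left_kan x f (colim_sum x f) (\<lambda>p. colim_in (f \<odot> fibre x (vfst p)) (vsnd p))"
    (is "is_left_kan x f ?S ?c")
proof -
  note U = Fun_catS[OF x] and M = Fun_catT[OF f]
  let ?D = "\<lambda>u. f \<odot> fibre x u"
  have colim: "is_colimit (?D u) (colim (?D u)) (colim_in (?D u))" if u: "u \<in> Obj U" for u
    using co fibre_diagram[OF u] val_small[OF x u] unfolding cocomplete_def
    by (intro colim_is_colimit) (auto simp: Fun_def)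
  note colimD = colimitD[OF colim fibre_diagram]
  let ?P = "\<lambda>\<alpha> m. m \<in> hom M (colim (?D (Dom U \<alpha>))) (colim (?D (Cod U \<alpha>))) \<and>
    (\<forall>i\<in>Obj (val x (Dom U \<alpha>)). Cmp M m (colim_in (?D (Dom U \<alpha>)) i) =
       Cmp M (colim_in (?D (Cod U \<alpha>)) (FO (act x \<alpha>) i)) (FA f (gr_lift x \<alpha> i)))"
  define E where "E \<alpha> = (THE m. ?P \<alpha> m)" for \<alpha>
  have "?P \<alpha> (E \<alpha>)" if \<alpha>: "\<alpha> \<in> Arr U" for \<alpha>
  proof -
    have uv: "Dom U \<alpha> \<in> Obj U" "Cod U \<alpha> \<in> Obj U" using \<alpha> U by auto
    have "\<exists>!m. ?P \<alpha> m"
      using colimit_ex1[OF colim[OF uv(1)] fibre_diagram[OF uv(1)]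
          fibre_transport[OF \<alpha> refl refl colimit_cocone[OF colim[OF uv(2)]]]] .
    then show ?thesis unfolding E_def by (rule theI')
  qed
  then have E: "E \<alpha> \<in> Arr M" "Dom M (E \<alpha>) = colim (?D u)" "Cod M (E \<alpha>) = colim (?D v)"
    "\<And>i. i \<in> Obj (val x u) \<Longrightarrow> Cmp M (E \<alpha>) (colim_in (?D u) i) =
       Cmp M (colim_in (?D v) (FO (act x \<alpha>) i)) (FA f (gr_lift x \<alpha> i))"
    if "\<alpha> \<in> Arr U" "Dom U \<alpha> = u" "Cod U \<alpha> = v" for \<alpha> u v
    using that unfolding hom_def by auto
  have S: "?S = make_fun U M (\<lambda>u. colim (?D u)) E"
    unfolding colim_sum_def Let_def E_def Fun_Src[OF x] Fun_Tgt[OF f] fibre_def by simp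
  have "?S \<in> Fun U M"
    unfolding S
  proof (rule make_fun_in_Fun[OF U M])
    fix u assume u: "u \<in> Obj U"
    have i: "Ident U u \<in> Arr U" "Dom U (Ident U u) = u" "Cod U (Ident U u) = u" using u U by auto
    show "E (Ident U u) = Ident M (colim (?D u))"
      by (rule colimit_unique[OF colim[OF u] fibre_diagram[OF u]])
        (use u M E[OF i] colimD[OF u u] in
          \<open>auto simp: act_Ident_obj[OF x] gr_lift_Ident[OF x] Fun_Ident[OF f] gr_obj[OF x] fibre_diagram_simps\<close>)
  next
    fix \<alpha> \<beta> assume ab: "\<alpha> \<in> Arr U" "\<beta> \<in> Arr U" "Cod U \<alpha> = Dom U \<beta>"
    define u v w where uvw: "u = Dom U \<alpha>" "v = Dom U \<beta>" "w = Cod U \<beta>"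
    have a: "Dom U \<alpha> = u" "Cod U \<alpha> = v" and b: "Dom U \<beta> = v" "Cod U \<beta> = w" using ab uvw by auto
    have c: "Cmp U \<beta> \<alpha> \<in> Arr U" "Dom U (Cmp U \<beta> \<alpha>) = u" "Cod U (Cmp U \<beta> \<alpha>) = w"
      using ab a b U by auto
    have o: "u \<in> Obj U" "v \<in> Obj U" "w \<in> Obj U" using ab a b U by auto
    note Ea = E[OF ab(1) a] and Eb = E[OF ab(2) b] and Ec = E[OF c]
    show "E (Cmp U \<beta> \<alpha>) = Cmp M (E \<beta>) (E \<alpha>)"
    proof (rule colimit_unique[OF colim[OF o(1)] fibre_diagram[OF o(1)]])
      fix i assume i: "i \<in> Obj (val x u)"
      let ?j = "FO (act x \<alpha>) i" and ?k = "FO (act x \<beta>) (FO (act x \<alpha>) i)"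
      have jk: "?j \<in> Obj (val x v)" "?k \<in> Obj (val x w)"
        using i ab a b by (simp_all add: act_obj[OF x])
      note types = M Ea(1-3) Eb(1-3) o i jk ab(1,2) a b colimD(1-4) fibre_diagram_simps
        Fun_rules[OF f] gr_lift_arr[OF x] gr_obj[OF x]
      have "Cmp M (E (Cmp U \<beta> \<alpha>)) (colim_in (?D u) i) =
        Cmp M (colim_in (?D w) ?k) (Cmp M (FA f (gr_lift x \<beta> ?j)) (FA f (gr_lift x \<alpha> i)))"
        using Ec(4)[OF i] ab a b i jk
        by (simp add: act_Cmp_obj[OF x] gr_lift_Cmp[OF x] Fun_Cmp[OF f] gr_lift_arr[OF x])
      also have "\<dots> = Cmp M (Cmp M (E \<beta>) (colim_in (?D v) ?j)) (FA f (gr_lift x \<alpha> i))"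
        unfolding Eb(4)[OF jk(1)] by (simp add: types cat_assoc)
      also have "\<dots> = Cmp M (E \<beta>) (Cmp M (E \<alpha>) (colim_in (?D u) i))"
        unfolding Ea(4)[OF i] by (simp add: types cat_assoc)
      also have "\<dots> = Cmp M (Cmp M (E \<beta>) (E \<alpha>)) (colim_in (?D u) i)"
        by (simp add: types cat_assoc)
      finally show "Cmp M (E (Cmp U \<beta> \<alpha>)) (colim_in (?D u) i) =
        Cmp M (Cmp M (E \<beta>) (E \<alpha>)) (colim_in (?D u) i)" .
    qed (use M Ea(1-3) Eb(1-3) Ec(1-3) in auto)
  qed (use U E(1-3) colimD(1) in auto)
  then show ?thesis
    by (rule left_kanI) (use U colim E(4) in \<open>auto simp: S\<close>)
qed

end

subsection \<open>Base change\<close>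

text \<open>
  Base change for a square over \<open>h\<close> that restricts to isomorphisms of the fibres. It is stated for
  such squares in order to cover at once the projections \<open>\<lbrakk>y \<circ> h\<rbrakk> \<rightarrow> \<lbrakk>y\<rbrakk>\<close>, where the fibres agree,
  and the maps \<open>\<lbrakk>x\<rbrakk> \<rightarrow> \<lbrakk>y\<rbrakk>\<close> induced by isomorphisms \<open>x \<cong> y\<close>, where \<open>h\<close> is the identity.
\<close>

lemma left_kan_pullback:
  assumes x: "x \<in> Fun U Cat" and y: "y \<in> Fun V Cat" and h: "h \<in> Fun U V"
    and R: "R \<in> Fun (gr x) (gr y)" and proj: "gr_proj y \<odot> R = h \<odot> gr_proj x"
    and fibres: "\<And>u. u \<in> Obj U \<Longrightarrow> \<exists>T S. T \<in> Fun (val x u) (val y (FO h u)) \<and>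
      S \<in> Fun (val y (FO h u)) (val x u) \<and> S \<odot> T = id_fun (val x u) \<and>
      T \<odot> S = id_fun (val y (FO h u)) \<and> R \<odot> fibre x u = fibre y (FO h u) \<odot> T"
    and g: "g \<in> Fun (gr y) M" and K: "is_left_kan y g G c"
  shows "is_left_kan x (g \<odot> R) (G \<odot> h) (\<lambda>p. c (FO R p))"
proof -
  have gR: "g \<odot> R \<in> Fun (gr x) M" using R g by (rule comp_Fun)
  have G: "G \<in> Fun V M" using left_kanD(1)[OF y g K] .
  show ?thesis
    unfolding is_left_kan_def Fun_Src[OF x] Fun_Tgt[OF gR]
  proof (intro conjI ballI)
    show "G \<odot> h \<in> Fun U M" using h G by (rule comp_Fun)
    fix u assume u: "u \<in> Obj U"
    have hu: "FO h u \<in> Obj V" using u by (rule Fun_obj[OF h])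
    obtain T S where T: "T \<in> Fun (val x u) (val y (FO h u))" and S: "S \<in> Fun (val y (FO h u)) (val x u)"
      and ST: "S \<odot> T = id_fun (val x u)" "T \<odot> S = id_fun (val y (FO h u))"
      and RT: "R \<odot> fibre x u = fibre y (FO h u) \<odot> T"
      using fibres[OF u] by blast
    note fx = fibre_Fun[OF x u] and fy = fibre_Fun[OF y hu]
    have "(g \<odot> fibre y (FO h u)) \<odot> T = g \<odot> (R \<odot> fibre x u)"
      unfolding RT by (rule comp_assoc[OF T fy g])
    also have "\<dots> = (g \<odot> R) \<odot> fibre x u" by (rule comp_assoc[OF fx R g, symmetric])
    finally have D: "(g \<odot> fibre y (FO h u)) \<odot> T = (g \<odot> R) \<odot> fibre x u" .
    have RTi: "FO R (vpair u i) = vpair (FO h u) (FO T i)" if "i \<in> Obj (val x u)" for i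
      using that arg_cong[OF RT, of "\<lambda>F. FO F i"] Fun_obj[OF T that]
      by (simp add: comp_FO[OF fx] comp_FO[OF T] fibre_FO[OF x] fibre_FO[OF y])
    have "is_colimit ((g \<odot> R) \<odot> fibre x u) (FO G (FO h u)) (\<lambda>i. c (vpair (FO h u) (FO T i)))"
      using colimit_iso_shape[OF left_kanD(2)[OF y g K hu] fibre_diagram[OF y g hu] T S ST]
      unfolding D .
    from colimit_cong[OF this fibre_diagram[OF x gR u]]
    show "is_colimit ((g \<odot> R) \<odot> fibre x u) (FO (G \<odot> h) u) (\<lambda>i. c (FO R (vpair u i)))"
      using u RTi by (simp add: comp_FO[OF h])
  next
    fix a assume a: "a \<in> Arr (gr x)"
    have "Cmp M (FA G (FA (gr_proj y) (FA R a))) (c (Dom (gr y) (FA R a))) =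
        Cmp M (c (Cod (gr y) (FA R a))) (FA g (FA R a))"
      using K Fun_arr[OF R a] unfolding is_left_kan_def Fun_Tgt[OF g] by blast
    moreover have "FA (gr_proj y) (FA R a) = FA h (FA (gr_proj x) a)"
      using arg_cong[OF proj, of "\<lambda>F. FA F a"] a
      by (simp add: comp_FA[OF R] comp_FA[OF gr_proj_Fun[OF x]])
    ultimately show "Cmp M (FA (G \<odot> h) (FA (gr_proj x) a)) (c (FO R (Dom (gr x) a))) =
        Cmp M (c (FO R (Cod (gr x) a))) (FA (g \<odot> R) a)"
      using a by (simp add: comp_FA[OF h] comp_FA[OF R] Fun_rules[OF R] Fun_rules[OF gr_proj_Fun[OF x]])
  qed
qed

lemma gr_proj_reindex:
  assumes h: "h \<in> Fun U V" and y: "y \<in> Fun V Cat"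
  shows "gr_proj y \<odot> gr_reindex y h = h \<odot> gr_proj (y \<odot> h)"
proof -
  have yh: "y \<odot> h \<in> Fun U Cat" using h y by (rule comp_Fun)
  note R = gr_reindex_Fun[OF h y] and p = gr_proj_Fun[OF yh]
  show ?thesis
  proof (rule gr_functor_eqI[OF yh comp_Fun[OF R gr_proj_Fun[OF y]] comp_Fun[OF p h]])
    show "FO (gr_proj y \<odot> gr_reindex y h) (vpair u i) = FO (h \<odot> gr_proj (y \<odot> h)) (vpair u i)"
      if "vpair u i \<in> Obj (gr (y \<odot> h))" for u i
      using that Fun_obj[OF R that]
      by (simp add: comp_FO[OF R] comp_FO[OF p] gr_proj_FO[OF yh] gr_proj_FO[OF y])
    show "FA (gr_proj y \<odot> gr_reindex y h) (garr u i \<alpha> \<beta>) = FA (h \<odot> gr_proj (y \<odot> h)) (garr u i \<alpha> \<beta>)"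
      if "garr u i \<alpha> \<beta> \<in> Arr (gr (y \<odot> h))" for u i \<alpha> \<beta>
      using that Fun_arr(1)[OF R that]
      by (simp add: comp_FA[OF R] comp_FA[OF p] gr_proj_FA[OF yh] gr_proj_FA[OF y])
  qed
qed

lemma gr_proj_map:
  assumes t: "is_nat_iso x y t" and x: "x \<in> Fun U Cat"
  shows "gr_proj y \<odot> gr_map x y t = gr_proj x"
proof -
  note R = gr_map_Fun[OF t x] and p = gr_proj_Fun[OF x] and y = nat_isoD(1)[OF t x]
  show ?thesis
  proof (rule gr_functor_eqI[OF x comp_Fun[OF R gr_proj_Fun[OF y]] p])
    show "FO (gr_proj y \<odot> gr_map x y t) (vpair u i) = FO (gr_proj x) (vpair u i)"
      if "vpair u i \<in> Obj (gr x)" for u i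
      using that Fun_obj[OF R that]
      by (simp add: comp_FO[OF R] gr_map_FO[OF t x] gr_proj_FO[OF x] gr_proj_FO[OF y])
    show "FA (gr_proj y \<odot> gr_map x y t) (garr u i \<alpha> \<beta>) = FA (gr_proj x) (garr u i \<alpha> \<beta>)"
      if "garr u i \<alpha> \<beta> \<in> Arr (gr x)" for u i \<alpha> \<beta>
      using that Fun_arr(1)[OF R that]
      by (simp add: comp_FA[OF R] gr_map_FA[OF t x] gr_proj_FA[OF x] gr_proj_FA[OF y])
  qed
qed

lemma left_kan_reindex:
  assumes h: "h \<in> Fun U V" and y: "y \<in> Fun V Cat" and g: "g \<in> Fun (gr y) M"
    and K: "is_left_kan y g G c"
  shows "is_left_kan (y \<odot> h) (g \<odot> gr_reindex y h) (G \<odot> h) (\<lambda>p. c (FO (gr_reindex y h) p))"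
proof (rule left_kan_pullback[OF _ y h _ _ _ g K])
  show yh: "y \<odot> h \<in> Fun U Cat" using h y by (rule comp_Fun)
  show R: "gr_reindex y h \<in> Fun (gr (y \<odot> h)) (gr y)" by (rule gr_reindex_Fun[OF h y])
  show "gr_proj y \<odot> gr_reindex y h = h \<odot> gr_proj (y \<odot> h)" by (rule gr_proj_reindex[OF h y])
  fix u assume u: "u \<in> Obj U"
  have val: "val (y \<odot> h) u = val y (FO h u)" using u by (simp add: comp_FO[OF h])
  have hu: "FO h u \<in> Obj V" using u by (rule Fun_obj[OF h])
  note C = val_category[OF y hu]
  note fx = fibre_Fun[OF yh u] and fy = fibre_Fun[OF y hu]
  have "gr_reindex y h \<odot> fibre (y \<odot> h) u = fibre y (FO h u)"
  proof (rule functor_eqI[OF comp_Fun[OF fx R]])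
    show "fibre y (FO h u) \<in> Fun (val (y \<odot> h) u) (gr y)" using fy unfolding val .
    show "FO (gr_reindex y h \<odot> fibre (y \<odot> h) u) i = FO (fibre y (FO h u)) i"
      if "i \<in> Obj (val (y \<odot> h) u)" for i
      using that u val by (simp add: comp_FO[OF fx] fibre_FO[OF yh] fibre_FO[OF y] gr_obj[OF yh])
    show "FA (gr_reindex y h \<odot> fibre (y \<odot> h) u) b = FA (fibre y (FO h u)) b"
      if b: "b \<in> Arr (val (y \<odot> h) u)" for b
      using b u val Fun_arr(1)[OF fx b]
      by (simp add: comp_FA[OF fx] fibre_FA[OF yh] fibre_FA[OF y] Fun_Ident[OF h])
  qed
  then show "\<exists>T S. T \<in> Fun (val (y \<odot> h) u) (val y (FO h u)) \<and>
      S \<in> Fun (val y (FO h u)) (val (y \<odot> h) u) \<and> S \<odot> T = id_fun (val (y \<odot> h) u) \<and>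
      T \<odot> S = id_fun (val y (FO h u)) \<and>
      gr_reindex y h \<odot> fibre (y \<odot> h) u = fibre y (FO h u) \<odot> T"
    unfolding val using C fy
    by (intro exI[of _ "id_fun (val y (FO h u))"]) (simp add: comp_id_left[OF id_fun_Fun])
qed

lemma left_kan_gr_map:
  assumes t: "is_nat_iso x y t" and x: "x \<in> Fun U Cat" and g: "g \<in> Fun (gr y) M"
    and K: "is_left_kan y g G c"
  shows "is_left_kan x (g \<odot> gr_map x y t) G (\<lambda>p. c (FO (gr_map x y t) p))"
proof -
  note y = nat_isoD(1)[OF t x] and R = gr_map_Fun[OF t x]
  have "is_left_kan x (g \<odot> gr_map x y t) (G \<odot> id_fun U) (\<lambda>p. c (FO (gr_map x y t) p))"
  proof (rule left_kan_pullback[OF x y _ R _ _ g K])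
    show "id_fun U \<in> Fun U U" using Fun_catS[OF x] by simp
    show "gr_proj y \<odot> gr_map x y t = id_fun U \<odot> gr_proj x"
      using gr_proj_map[OF t x] comp_id_left[OF gr_proj_Fun[OF x]] by simp
    fix u assume u: "u \<in> Obj U"
    note T = nat_iso_Cat(1)[OF t x u]
    note fx = fibre_Fun[OF x u] and fy = fibre_Fun[OF y u]
    have "gr_map x y t \<odot> fibre x u = fibre y u \<odot> fun_of (t u)"
    proof (rule functor_eqI[OF comp_Fun[OF fx R] comp_Fun[OF T fy]])
      show "FO (gr_map x y t \<odot> fibre x u) i = FO (fibre y u \<odot> fun_of (t u)) i"
        if "i \<in> Obj (val x u)" for i
        using that u Fun_obj[OF T that]
        by (simp add: comp_FO[OF fx] comp_FO[OF T] fibre_FO[OF x] fibre_FO[OF y] gr_map_FO[OF t x]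
            gr_obj[OF x])
      show "FA (gr_map x y t \<odot> fibre x u) b = FA (fibre y u \<odot> fun_of (t u)) b"
        if b: "b \<in> Arr (val x u)" for b
        using b u Fun_arr[OF T b] Fun_arr(1)[OF fx b] Fun_catS[OF x]
        by (simp add: comp_FA[OF fx] comp_FA[OF T] fibre_FA[OF x] fibre_FA[OF y] gr_map_FA[OF t x])
    qed
    then show "\<exists>T S. T \<in> Fun (val x u) (val y (FO (id_fun U) u)) \<and>
        S \<in> Fun (val y (FO (id_fun U) u)) (val x u) \<and> S \<odot> T = id_fun (val x u) \<and>
        T \<odot> S = id_fun (val y (FO (id_fun U) u)) \<and>
        gr_map x y t \<odot> fibre x u = fibre y (FO (id_fun U) u) \<odot> T"
      using T nat_iso_Cat(2)[OF t x u] u by auto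
  qed
  then show ?thesis using comp_id_right[OF left_kanD(1)[OF y g K]] by simp
qed

subsection \<open>Families of one-arrow categories\<close>

text \<open>
  The fibre diagrams consist of a single object \<open>f(v)\<close> with its identity.
\<close>

lemma left_kan_unit:
  assumes y: "y \<in> Fun V Cat" and f: "f \<in> Fun V M"
    and one: "\<And>v. v \<in> Obj V \<Longrightarrow> \<exists>k. Obj (val y v) = {k} \<and> Arr (val y v) = {Ident (val y v) k}"
  shows "is_left_kan y (f \<odot> gr_proj y) f (\<lambda>p. Ident M (FO f (vfst p)))"
proof -
  note V = Fun_catS[OF y] and M = Fun_catT[OF f] and p = gr_proj_Fun[OF y]
  have fp: "f \<odot> gr_proj y \<in> Fun (gr y) M" using p f by (rule comp_Fun)
  show ?thesis
  proof (rule left_kanI[OF y fp f])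
    fix v assume v: "v \<in> Obj V"
    obtain k where k: "Obj (val y v) = {k}" "Arr (val y v) = {Ident (val y v) k}"
      using one[OF v] by blast
    have kk: "k \<in> Obj (val y v)" using k by simp
    have fo: "FO (f \<odot> gr_proj y) (vpair v k) = FO f v"
      using v kk by (simp add: comp_FO[OF p] gr_proj_FO[OF y] gr_obj[OF y])
    note C = val_category[OF y v]
    have fa: "FA (f \<odot> gr_proj y) (FA (fibre y v) (Ident (val y v) k)) = Ident M (FO f v)"
      using v kk by (simp add: Fun_Ident[OF fibre_Fun[OF y v]] fibre_FO[OF y] Fun_Ident[OF fp] gr_obj[OF y] fo)
    note D = fibre_diagram[OF y fp v]
    have cocone: "is_cocone ((f \<odot> gr_proj y) \<odot> fibre y v) l d \<longleftrightarrow>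
        d k \<in> Arr M \<and> Dom M (d k) = FO f v \<and> Cod M (d k) = l" for l d
      unfolding fibre_cocone_iff[OF y fp v] k using fo fa C kk M by auto
    show "is_colimit ((f \<odot> gr_proj y) \<odot> fibre y v) (FO f v) (\<lambda>i. Ident M (FO f (vfst (vpair v i))))"
      by (rule is_colimitI[OF D])
        (use v M in \<open>auto simp: cocone k Fun_rules[OF f]\<close>)
  next
    fix u v \<alpha> i assume "\<alpha> \<in> Arr V" "Dom V \<alpha> = u" "Cod V \<alpha> = v" "i \<in> Obj (val y u)"
    moreover from this have "FA (gr_proj y) (gr_lift y \<alpha> i) = \<alpha>"
      using gr_lift_arr(1)[OF y, of \<alpha> u i] by (simp add: gr_lift[OF y] gr_proj_FA[OF y])
    ultimately show "Cmp M (FA f \<alpha>) (Ident M (FO f (vfst (vpair u i)))) =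
        Cmp M (Ident M (FO f (vfst (vpair v (FO (act y \<alpha>) i))))) (FA (f \<odot> gr_proj y) (gr_lift y \<alpha> i))"
      using M by (simp add: comp_FA[OF p] gr_lift_arr[OF y] Fun_rules[OF f])
  qed
qed

subsection \<open>The Fubini theorem\<close>

context
  fixes x f :: "'u::two_inaccessibles func" and U :: "'u ucat"
  assumes x: "x \<in> Fun U Cat" and f: "f \<in> Fun (gr x) Cat"
begin

text \<open>
  Flattening identifies an arrow inside the fibre over \<open>u\<close> of the outer sum with the corresponding
  arrow of \<open>\<lbrakk>f\<rbrakk>\<close> lying over \<open>id\<^sub>u\<close>. Thereby a cocone over the fibre of the outer sum restricts to
  cocones over the fibres of \<open>f\<close>.
\<close>

lemma fibre_flatten:
  assumes u: "u \<in> Obj U" and b: "garr i j b c \<in> Arr (gr (f \<odot> fibre x u))"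
  shows "garr (vpair u i) j (FA (fibre x u) b) c \<in> Arr (gr f)"
    and "FA (fibre (oplax_sum x f) u) (garr i j b c) =
      FA (flatten_fun x f) (garr (vpair u i) j (FA (fibre x u) b) c)"
proof -
  have b': "b \<in> Arr (val x u)" "Dom (val x u) b = i" "i \<in> Obj (val x u)"
    "j \<in> Obj (val f (vpair u i))" "c \<in> Arr (val f (vpair u (Cod (val x u) b)))"
    "Dom (val f (vpair u (Cod (val x u) b))) c = FO (act f (FA (fibre x u) b)) j"
    using b sum_arr[OF x f u] by auto
  show in_f: "garr (vpair u i) j (FA (fibre x u) b) c \<in> Arr (gr f)"
    using b' u by (simp add: gr_arr[OF f] fibre_arr[OF x])
  have "FA (fibre x u) b = garr u i (Ident U u) b" using b' by (simp add: fibre_FA[OF x])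
  then have "FA (flatten_fun x f) (garr (vpair u i) j (FA (fibre x u) b) c) =
      garr u (vpair i j) (Ident U u) (garr i j b c)"
    using flatten_FA[OF x f, of u i j "Ident U u" b c] in_f u b'
    by (simp add: act_Ident_obj[OF x] gr_lift_Ident[OF x] act_Ident_obj[OF f] gr_obj[OF x])
  then show "FA (fibre (oplax_sum x f) u) (garr i j b c) =
      FA (flatten_fun x f) (garr (vpair u i) j (FA (fibre x u) b) c)"
    using u b by (simp add: fibre_FA[OF oplax_sum_Fun[OF x f]] oplax_sum_simps[OF x f] sum_Dom[OF x f])
qed

text \<open>
  The source of the inner arrow is determined by \<open>\<alpha>\<close> and the source of the outer one; what is left
  is the data of an arrow of \<open>\<lbrakk>f\<rbrakk>\<close>.
\<close>

lemma flatten_surj: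
  assumes "b \<in> Arr (gr (oplax_sum x f))"
  obtains a where "a \<in> Arr (gr f)" "b = FA (flatten_fun x f) a"
proof -
  note s = oplax_sum_Fun[OF x f]
  from assms obtain u v p \<alpha> q where e: "b = garr u p \<alpha> q" "\<alpha> \<in> Arr U" "Dom U \<alpha> = u" "Cod U \<alpha> = v"
    "u \<in> Obj U" "v \<in> Obj U" "p \<in> Obj (gr (f \<odot> fibre x u))"
    "q \<in> Arr (gr (f \<odot> fibre x v))" "Dom (gr (f \<odot> fibre x v)) q = FO (sum_act x f \<alpha>) p"
    by (rule gr_arrE[OF s]) (auto simp: oplax_sum_simps[OF x f])
  obtain i j where p: "p = vpair i j" "i \<in> Obj (val x u)" "j \<in> Obj (val f (vpair u i))"
    using e(7) by (rule sum_objE[OF x f _ e(5)])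
  obtain i' j' \<beta> \<gamma> k where q: "q = garr i' j' \<beta> \<gamma>" "\<beta> \<in> Arr (val x v)" "Dom (val x v) \<beta> = i'"
    "i' \<in> Obj (val x v)" "j' \<in> Obj (val f (vpair v i'))" "Cod (val x v) \<beta> = k" "k \<in> Obj (val x v)"
    "\<gamma> \<in> Arr (val f (vpair v k))" "Dom (val f (vpair v k)) \<gamma> = FO (act f (FA (fibre x v) \<beta>)) j'"
    using e(8) by (rule sum_arrE[OF x f _ e(6)])
  have ij': "i' = FO (act x \<alpha>) i" "j' = FO (act f (gr_lift x \<alpha> i)) j"
    using e(9) e(8) sum_act_FO[OF x f e(2,3) p(2,3)] sum_Dom[OF x f e(6)] unfolding p(1) q(1) by auto
  have a0: "garr u i \<alpha> \<beta> \<in> Arr (gr x)" using e p q ij' by (simp add: gr_arr[OF x])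
  have "garr (vpair u i) j (garr u i \<alpha> \<beta>) \<gamma> \<in> Arr (gr f)"
    using e p q ij' a0 act_factor(1)[OF x f a0 e(4)]
    by (simp add: gr_arr[OF f] gr_Dom[OF x] gr_Cod[OF x] gr_obj[OF x])
  then show thesis
    using that flatten_FA[OF x f] e(1) p(1) q(1) ij' by auto
qed

text \<open>
  A cocone over the big diagram at \<open>u\<close> is first factored through the inner colimits, one for each
  \<open>i \<in> x(u)\<close>; the factorisations form a cocone over the outer diagram, which is factored again.
  That they form a cocone is checked after composing with the inner colimit cocones. Naturality is
  the pasting of the two units, since every arrow is the flattening of an arrow of \<open>\<lbrakk>f\<rbrakk>\<close>.
\<close>

lemma left_kan_flatten:
  assumes g: "g \<in> Fun (gr (oplax_sum x f)) M"
    and K: "is_left_kan f (g \<odot> flatten_fun x f) H c" and L: "is_left_kan x H N d"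
  shows "is_left_kan (oplax_sum x f) g N
    (\<lambda>p. Cmp M (d (vpair (vfst p) (vfst (vsnd p))))
           (c (vpair (vpair (vfst p) (vfst (vsnd p))) (vsnd (vsnd p)))))"
    (is "is_left_kan ?s g N ?e")
proof -
  note U = Fun_catS[OF x] and M = Fun_catT[OF g] and s = oplax_sum_Fun[OF x f]
  note flat = flatten_Fun[OF x f]
  have gf: "g \<odot> flatten_fun x f \<in> Fun (gr f) M" using flat g by (rule comp_Fun)
  note KD = left_kanD[OF f gf K]
  note H = KD(1)
  note LD = left_kanD[OF x H L]
  note N = LD(1)
  have c: "c (vpair (vpair u i) j) \<in> Arr M"
    "Dom M (c (vpair (vpair u i) j)) = FO g (vpair u (vpair i j))"
    "Cod M (c (vpair (vpair u i) j)) = FO H (vpair u i)"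
    if "u \<in> Obj U" "i \<in> Obj (val x u)" "j \<in> Obj (val f (vpair u i))" for u i j
    using that KD(4-6)[of "vpair u i" j]
    by (auto simp: gr_obj[OF x] gr_obj[OF f] comp_FO[OF flat] flatten_FO[OF x f])
  have e_simp: "?e (vpair u (vpair i j)) = Cmp M (d (vpair u i)) (c (vpair (vpair u i) j))" for u i j
    by simp
  have nat: "Cmp M (FA N (FA (gr_proj ?s) b)) (?e (Dom (gr ?s) b)) = Cmp M (?e (Cod (gr ?s) b)) (FA g b)"
    if b: "b \<in> Arr (gr ?s)" for b
  proof -
    obtain a where a: "a \<in> Arr (gr f)" "b = FA (flatten_fun x f) a" using b by (rule flatten_surj)
    obtain u v i j k \<alpha> \<beta> \<gamma> where ae: "a = garr (vpair u i) j (garr u i \<alpha> \<beta>) \<gamma>"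
      "\<alpha> \<in> Arr U" "Dom U \<alpha> = u" "Cod U \<alpha> = v" "u \<in> Obj U" "v \<in> Obj U" "i \<in> Obj (val x u)"
      "\<beta> \<in> Arr (val x v)" "Dom (val x v) \<beta> = FO (act x \<alpha>) i" "Cod (val x v) \<beta> = k" "k \<in> Obj (val x v)"
      "garr u i \<alpha> \<beta> \<in> Arr (gr x)" "j \<in> Obj (val f (vpair u i))"
      "\<gamma> \<in> Arr (val f (vpair v k))"
      "Dom (val f (vpair v k)) \<gamma> = FO (act f (garr u i \<alpha> \<beta>)) j"
      using a(1) by (rule gr2_arrE[OF x f])
    let ?a0 = "garr u i \<alpha> \<beta>" and ?l = "Cod (val f (vpair v k)) \<gamma>"
    have l: "?l \<in> Obj (val f (vpair v k))"
      using ae val_category[OF f] by (simp add: gr_obj[OF x])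
    have a0: "Dom (gr x) ?a0 = vpair u i" "Cod (gr x) ?a0 = vpair v k"
      using ae by (simp_all add: gr_Dom[OF x] gr_Cod[OF x])
    have "FA (gr_proj ?s) b = \<alpha>"
      using b unfolding a(2) ae(1) by (simp add: flatten_FA[OF x f a(1)[unfolded ae(1)]] gr_proj_FA[OF s])
    moreover have "Dom (gr ?s) b = vpair u (vpair i j)"
      using Fun_arr(2)[OF flat a(1)] a ae
      by (simp add: gr_Dom[OF f] flatten_FO[OF x f] gr_obj[OF f] gr_obj[OF x])
    moreover have "Cod (gr ?s) b = vpair v (vpair k ?l)"
      using Fun_arr(3)[OF flat a(1)] a ae l
      by (simp add: gr_Cod[OF f] a0 flatten_FO[OF x f] gr_obj[OF f] gr_obj[OF x])
    moreover have "Cmp M (FA N \<alpha>) (Cmp M (d (vpair u i)) (c (vpair (vpair u i) j))) =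
        Cmp M (Cmp M (d (vpair v k)) (c (vpair (vpair v k) ?l))) (FA g b)"
    proof -
      have gb: "FA g b \<in> Arr M" "Dom M (FA g b) = FO g (vpair u (vpair i j))"
        "Cod M (FA g b) = FO g (vpair v (vpair k ?l))"
        using Fun_arr[OF g b] calculation by auto
      note types = M ae(2-14) l a0 gb c LD(4-6) Fun_rules[OF N] Fun_rules[OF H]
      have "Cmp M (FA N \<alpha>) (Cmp M (d (vpair u i)) (c (vpair (vpair u i) j))) =
          Cmp M (Cmp M (FA N \<alpha>) (d (vpair u i))) (c (vpair (vpair u i) j))"
        by (simp add: types cat_assoc)
      also have "\<dots> = Cmp M (Cmp M (d (vpair v k)) (FA H ?a0)) (c (vpair (vpair u i) j))"
        using LD(3)[OF ae(12,4)] ae(10) by simp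
      also have "\<dots> = Cmp M (d (vpair v k)) (Cmp M (FA H ?a0) (c (vpair (vpair u i) j)))"
        by (simp add: types cat_assoc)
      also have "Cmp M (FA H ?a0) (c (vpair (vpair u i) j)) = Cmp M (c (vpair (vpair v k) ?l)) (FA g b)"
        using KD(3)[OF a(1)[unfolded ae(1)] a0(2)] a by (simp add: comp_FA[OF flat] ae(1))
      also have "Cmp M (d (vpair v k)) (Cmp M (c (vpair (vpair v k) ?l)) (FA g b)) =
          Cmp M (Cmp M (d (vpair v k)) (c (vpair (vpair v k) ?l))) (FA g b)"
        by (simp add: types cat_assoc)
      finally show ?thesis .
    qed
    ultimately show ?thesis by simp
  qed
  show ?thesis
    unfolding is_left_kan_def Fun_Src[OF s] Fun_Tgt[OF g]
  proof (intro conjI ballI N nat)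
    fix u assume u: "u \<in> Obj U"
    let ?G = "gr (f \<odot> fibre x u)"
    have val: "val ?s u = ?G" using u by (simp add: oplax_sum_simps[OF x f])
    note D = fibre_diagram[OF s g u, unfolded val]
    note cocone = fibre_cocone_iff[OF s g u, unfolded val]
    note fs = fibre_Fun[OF s u, unfolded val]
    have G: "category ?G" using Fun_catS[OF D] .
    show "is_colimit (g \<odot> fibre ?s u) (FO N u) (\<lambda>i. ?e (vpair u i))"
    proof (rule is_colimitI[OF D])
      show "is_cocone (g \<odot> fibre ?s u) (FO N u) (\<lambda>i. ?e (vpair u i))"
        unfolding cocone
      proof (intro conjI ballI)
        show "FO N u \<in> Obj M" using u by (rule Fun_obj[OF N])
      next
        fix p assume "p \<in> Obj ?G"
        then obtain i j where "p = vpair i j" "i \<in> Obj (val x u)" "j \<in> Obj (val f (vpair u i))"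
          by (rule sum_objE[OF x f _ u])
        then show "?e (vpair u p) \<in> Arr M" "Dom M (?e (vpair u p)) = FO g (vpair u p)"
          "Cod M (?e (vpair u p)) = FO N u"
          using M u c LD(4-6) by simp_all
        then have "Cmp M (FA N (Ident U u)) (?e (vpair u p)) = ?e (vpair u p)"
          using M u by (simp add: Fun_Ident[OF N])
      next
        fix b assume b: "b \<in> Arr ?G"
        then have p: "Dom ?G b \<in> Obj ?G" using G by simp
        then obtain i j where ij: "Dom ?G b = vpair i j" "i \<in> Obj (val x u)" "j \<in> Obj (val f (vpair u i))"
          by (rule sum_objE[OF x f _ u])
        note fb = fibre_arr[OF s u b[folded val], unfolded val]
        have "FA (gr_proj ?s) (FA (fibre ?s u) b) = Ident U u"
          using fb(1) b by (simp add: fibre_FA[OF s] val gr_proj_FA[OF s])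
        then show "Cmp M (?e (vpair u (Cod ?G b))) (FA g (FA (fibre ?s u) b)) = ?e (vpair u (Dom ?G b))"
          using nat[OF fb(1)] fb M u c ij LD(4-6) by (simp add: Fun_rules[OF N])
      qed
    next
      fix l' d' assume d': "is_cocone (g \<odot> fibre ?s u) l' d'"
      note d'D = d'[unfolded cocone]
      have d'o: "d' (vpair i j) \<in> Arr M" "Dom M (d' (vpair i j)) = FO g (vpair u (vpair i j))"
        "Cod M (d' (vpair i j)) = l'"
        if "i \<in> Obj (val x u)" "j \<in> Obj (val f (vpair u i))" for i j
        using d'D that sum_obj[OF x f u] by auto
      \<comment> \<open>the cocone condition, read off on arrows of \<open>\<lbrakk>f\<rbrakk>\<close> over \<open>id\<^sub>u\<close>\<close>
      have d'a: "Cmp M (d' (vpair (Cod (val x u) b) (Cod (val f (vpair u (Cod (val x u) b))) \<gamma>)))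
          (FA (g \<odot> flatten_fun x f) (garr (vpair u i) j (FA (fibre x u) b) \<gamma>)) = d' (vpair i j)"
        if b: "garr i j b \<gamma> \<in> Arr ?G" for i j b \<gamma>
        using d'D b fibre_flatten[OF u b] sum_Dom[OF x f u b] sum_Cod[OF x f u b]
        by (metis comp_FA[OF flat])
      have ex: "\<exists>m. m \<in> Arr M \<and> Dom M m = FO H (vpair u i) \<and> Cod M m = l' \<and>
          (\<forall>j\<in>Obj (val f (vpair u i)). Cmp M m (c (vpair (vpair u i) j)) = d' (vpair i j))"
        if i: "i \<in> Obj (val x u)" for i
      proof -
        have ui: "vpair u i \<in> Obj (gr x)" using u i by (simp add: gr_obj[OF x])
        have "is_cocone ((g \<odot> flatten_fun x f) \<odot> fibre f (vpair u i)) l' (\<lambda>j. d' (vpair i j))"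
          unfolding fibre_cocone_iff[OF f gf ui]
        proof (intro conjI ballI)
          fix \<gamma> assume \<gamma>: "\<gamma> \<in> Arr (val f (vpair u i))"
          let ?j = "Dom (val f (vpair u i)) \<gamma>" and ?id = "Ident (val x u) i"
          have 1: "FA (fibre x u) ?id = Ident (gr x) (vpair u i)"
            using i by (simp add: Fun_Ident[OF fibre_Fun[OF x u]] fibre_FO[OF x])
          have j: "?j \<in> Obj (val f (vpair u i))" using \<gamma> val_category[OF f ui] by simp
          have "garr i ?j ?id \<gamma> \<in> Arr ?G"
            using u i \<gamma> j val_category[OF x u]
            by (simp add: sum_arr[OF x f] 1 act_Ident_obj[OF f ui])
          from d'a[OF this] show "Cmp M (d' (vpair i (Cod (val f (vpair u i)) \<gamma>)))
              (FA (g \<odot> flatten_fun x f) (FA (fibre f (vpair u i)) \<gamma>)) = d' (vpair i ?j)"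
            using i \<gamma> val_category[OF x u] by (simp add: 1 fibre_FA[OF f])
        next
          fix j assume j: "j \<in> Obj (val f (vpair u i))"
          then have "FO (g \<odot> flatten_fun x f) (vpair (vpair u i) j) = FO g (vpair u (vpair i j))"
            using ui by (simp add: comp_FO[OF flat] flatten_FO[OF x f] gr_obj[OF f])
          then show "d' (vpair i j) \<in> Arr M"
            "Dom M (d' (vpair i j)) = FO (g \<odot> flatten_fun x f) (vpair (vpair u i) j)"
            "Cod M (d' (vpair i j)) = l'" using d'o i j by auto
        qed (use d'D in blast)
        from colimit_ex[OF KD(2)[OF ui] fibre_diagram[OF f gf ui] this] show ?thesis by metis
      qed
      define m where "m i = (SOME m. m \<in> Arr M \<and> Dom M m = FO H (vpair u i) \<and> Cod M m = l' \<and>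
          (\<forall>j\<in>Obj (val f (vpair u i)). Cmp M m (c (vpair (vpair u i) j)) = d' (vpair i j)))" for i
      have m: "m i \<in> Arr M" "Dom M (m i) = FO H (vpair u i)" "Cod M (m i) = l'"
          "\<And>j. j \<in> Obj (val f (vpair u i)) \<Longrightarrow> Cmp M (m i) (c (vpair (vpair u i) j)) = d' (vpair i j)"
        if "i \<in> Obj (val x u)" for i
        using someI_ex[OF ex[OF that]] unfolding m_def by auto
      have "is_cocone (H \<odot> fibre x u) l' m"
        unfolding fibre_cocone_iff[OF x H u]
      proof (intro conjI ballI)
        fix b assume b: "b \<in> Arr (val x u)"
        let ?i = "Dom (val x u) b" and ?k = "Cod (val x u) b"
        have i: "?i \<in> Obj (val x u)" and k: "?k \<in> Obj (val x u)" using b val_category[OF x u] by auto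
        have ui: "vpair u ?i \<in> Obj (gr x)" "vpair u ?k \<in> Obj (gr x)" using u i k by (auto simp: gr_obj[OF x])
        note fb = fibre_arr[OF x u b]
        show "Cmp M (m ?k) (FA H (FA (fibre x u) b)) = m ?i"
        proof (rule colimit_unique[OF KD(2)[OF ui(1)] fibre_diagram[OF f gf ui(1)]])
          fix j assume j: "j \<in> Obj (val f (vpair u ?i))"
          let ?j' = "FO (act f (FA (fibre x u) b)) j"
          have j': "?j' \<in> Obj (val f (vpair u ?k))" using j fb by (simp add: act_obj[OF f])
          let ?a = "gr_lift f (FA (fibre x u) b) j"
          have "?a = garr (vpair u ?i) j (FA (fibre x u) b) (Ident (val f (vpair u ?k)) ?j')"
            using fb by (simp add: gr_lift[OF f])
          moreover have "garr ?i j b (Ident (val f (vpair u ?k)) ?j') \<in> Arr ?G"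
            using b i j j' k u val_category[OF f ui(2)] by (simp add: sum_arr[OF x f])
          ultimately have d'a': "Cmp M (d' (vpair ?k ?j')) (FA (g \<odot> flatten_fun x f) ?a) = d' (vpair ?i j)"
            using d'a[of ?i j b "Ident (val f (vpair u ?k)) ?j'"] j' val_category[OF f ui(2)] by simp
          have ga: "FA (g \<odot> flatten_fun x f) ?a \<in> Arr M"
            "Dom M (FA (g \<odot> flatten_fun x f) ?a) = FO g (vpair u (vpair ?i j))"
            "Cod M (FA (g \<odot> flatten_fun x f) ?a) = FO g (vpair u (vpair ?k ?j'))"
            using Fun_arr[OF gf] gr_lift_arr[OF f fb(1,2) j] j j' ui fb
            by (auto simp: comp_FO[OF flat] flatten_FO[OF x f] gr_obj[OF f])
          note types = M u i j k j' fb m(1-3) c ga Fun_rules[OF H]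
          have "Cmp M (Cmp M (m ?k) (FA H (FA (fibre x u) b))) (c (vpair (vpair u ?i) j)) =
              Cmp M (m ?k) (Cmp M (FA H (FA (fibre x u) b)) (c (vpair (vpair u ?i) j)))"
            by (simp add: types cat_assoc)
          also have "\<dots> = Cmp M (m ?k) (Cmp M (c (vpair (vpair u ?k) ?j')) (FA (g \<odot> flatten_fun x f) ?a))"
            using left_kan_lift[OF f gf K fb j] by simp
          also have "\<dots> = Cmp M (Cmp M (m ?k) (c (vpair (vpair u ?k) ?j'))) (FA (g \<odot> flatten_fun x f) ?a)"
            by (simp add: types cat_assoc)
          also have "\<dots> = Cmp M (m ?i) (c (vpair (vpair u ?i) j))"
            using d'a' m(4)[OF k j'] m(4)[OF i j] by simp
          finally show "Cmp M (Cmp M (m ?k) (FA H (FA (fibre x u) b))) (c (vpair (vpair u ?i) j)) =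
            Cmp M (m ?i) (c (vpair (vpair u ?i) j))" .
        qed (use M u i k fb m(1-3) in \<open>auto simp: Fun_rules[OF H]\<close>)
      qed (use d'D m in auto)
      from colimit_ex[OF LD(2)[OF u] fibre_diagram[OF x H u] this] obtain n where
        n: "n \<in> Arr M" "Dom M n = FO N u" "Cod M n = l'"
          "\<And>i. i \<in> Obj (val x u) \<Longrightarrow> Cmp M n (d (vpair u i)) = m i" by blast
      have "Cmp M n (?e (vpair u p)) = d' p" if p_obj: "p \<in> Obj ?G" for p
      proof -
        obtain i j where p: "p = vpair i j" "i \<in> Obj (val x u)" "j \<in> Obj (val f (vpair u i))"
          using p_obj by (rule sum_objE[OF x f _ u])
        have "Cmp M n (?e (vpair u p)) = Cmp M (Cmp M n (d (vpair u i))) (c (vpair (vpair u i) j))"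
          using M u p n(1,2) c LD(4-6) by (simp add: cat_assoc)
        then show ?thesis using n(4) m(4) p by simp
      qed
      then show "\<exists>n. n \<in> Arr M \<and> Dom M n = FO N u \<and> Cod M n = l' \<and>
          (\<forall>p\<in>Obj ?G. Cmp M n (?e (vpair u p)) = d' p)" using n by blast
    next
      fix m n assume mn: "m \<in> Arr M" "n \<in> Arr M" "Dom M m = FO N u" "Dom M n = FO N u"
        "Cod M n = Cod M m" "\<forall>p\<in>Obj ?G. Cmp M m (?e (vpair u p)) = Cmp M n (?e (vpair u p))"
      show "m = n"
      proof (rule colimit_unique[OF LD(2)[OF u] fibre_diagram[OF x H u]])
        fix i assume i: "i \<in> Obj (val x u)"
        have ui: "vpair u i \<in> Obj (gr x)" using u i by (simp add: gr_obj[OF x])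
        show "Cmp M m (d (vpair u i)) = Cmp M n (d (vpair u i))"
        proof (rule colimit_unique[OF KD(2)[OF ui] fibre_diagram[OF f gf ui]])
          fix j assume j: "j \<in> Obj (val f (vpair u i))"
          have "vpair i j \<in> Obj ?G" using i j u by (simp add: sum_obj[OF x f])
          then show "Cmp M (Cmp M m (d (vpair u i))) (c (vpair (vpair u i) j)) =
              Cmp M (Cmp M n (d (vpair u i))) (c (vpair (vpair u i) j))"
            using mn M u i j c LD(4-6) by (auto simp flip: cat_assoc)
        qed (use mn M u i LD(4-6) in auto)
      qed (use mn in auto)
    qed
  qed
qed

end

section \<open>The dependent adder of small categories\<close>

lemma id_Cat_Fun: "id_fun Cat \<in> Fun Cat Cat"
  by (simp add: category_Cat)

lemma gr_lift_iso:
  assumes x: "x \<in> Fun U Cat" and \<alpha>: "is_iso U \<alpha>" and i: "i \<in> Obj (val x (Dom U \<alpha>))"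
  shows "is_iso (gr x) (gr_lift x \<alpha> i)"
proof -
  note U = Fun_catS[OF x]
  obtain \<beta> where b: "\<alpha> \<in> Arr U" "\<beta> \<in> Arr U" "Dom U \<beta> = Cod U \<alpha>" "Cod U \<beta> = Dom U \<alpha>"
    "Cmp U \<beta> \<alpha> = Ident U (Dom U \<alpha>)" "Cmp U \<alpha> \<beta> = Ident U (Cod U \<alpha>)"
    using \<alpha> by (rule is_isoE)
  let ?j = "FO (act x \<alpha>) i"
  have j: "?j \<in> Obj (val x (Dom U \<beta>))" using b i by (simp add: act_obj[OF x])
  have inv_i: "FO (act x \<beta>) ?j = i"
    using act_Cmp_obj[OF x b(1,2) _ i] b i U by (simp add: act_Ident_obj[OF x])
  note l = gr_lift_arr[OF x b(1) refl i] gr_lift_arr[OF x b(2) refl j]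
  have "Cmp (gr x) (gr_lift x \<beta> ?j) (gr_lift x \<alpha> i) = Ident (gr x) (vpair (Dom U \<alpha>) i)"
    using gr_lift_Cmp[OF x b(1,2) _ i] b i U by (simp add: gr_lift_Ident[OF x])
  moreover have "Cmp (gr x) (gr_lift x \<alpha> i) (gr_lift x \<beta> ?j) = Ident (gr x) (vpair (Cod U \<alpha>) ?j)"
    using gr_lift_Cmp[OF x b(2,1) _ j] b j U by (simp add: gr_lift_Ident[OF x] inv_i)
  ultimately show ?thesis
    using l b inv_i by (intro is_isoI[where g = "gr_lift x \<beta> ?j"]) auto
qed

text \<open>
  The two functors send \<open>(u, i)\<close> to \<open>(x(u), i)\<close> and \<open>(y(u), t\<^sub>u(i))\<close>. They differ, but the arrows
  \<open>(t\<^sub>u, id)\<close> between their values are invertible as \<open>t\<^sub>u\<close> is; so the projections to \<open>F\<close> agree in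
  \<open>hCAT\<close>.
\<close>

lemma reindex_map_iso:
  assumes t: "is_nat_iso x y t" and x: "x \<in> Fun U Cat"
  shows "gr_reindex (id_fun Cat) x \<cong>\<^sub>F gr_reindex (id_fun Cat) y \<odot> gr_map x y t"
proof -
  note y = nat_isoD(1)[OF t x] and tD = nat_isoD[OF t x] and U = Fun_catS[OF x]
  let ?i = "id_fun Cat"
  note i = id_Cat_Fun
  have ix: "?i \<odot> x = x" and iy: "?i \<odot> y = y" using x y by auto
  note Rx = gr_reindex_Fun[OF x i, unfolded ix] and Ry = gr_reindex_Fun[OF y i, unfolded iy]
  note m = gr_map_Fun[OF t x]
  note Rxs = gr_reindex_simps(1)[of _ _ ?i x, unfolded ix] gr_reindex_simps(2)[of _ _ _ _ ?i x, unfolded ix]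
  note Rys = gr_reindex_simps(1)[of _ _ ?i y, unfolded iy] gr_reindex_simps(2)[of _ _ _ _ ?i y, unfolded iy]
  have "is_nat_iso (gr_reindex ?i x) (gr_reindex ?i y \<odot> gr_map x y t)
      (\<lambda>s. gr_lift ?i (t (vfst s)) (vsnd s))"
  proof (rule nat_isoI[OF Rx comp_Fun[OF m Ry]])
    fix s assume s: "s \<in> Obj (gr x)"
    then obtain u k where e: "s = vpair u k" "u \<in> Obj U" "k \<in> Obj (val x u)" by (rule gr_objE[OF x])
    have k: "k \<in> Obj (val ?i (Dom Cat (t u)))"
      using e tD(2,3)[OF e(2)] Fun_obj[OF x e(2)] by simp
    note l = gr_lift_arr[OF i tD(2)[OF e(2)] refl k]
    have "vpair u (FO (fun_of (t u)) k) \<in> Obj (gr y)"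
      using Fun_obj[OF m s] e s by (simp add: gr_map_FO[OF t x])
    then show "Dom (gr ?i) (gr_lift ?i (t (vfst s)) (vsnd s)) = FO (gr_reindex ?i x) s \<and>
        Cod (gr ?i) (gr_lift ?i (t (vfst s)) (vsnd s)) = FO (gr_reindex ?i y \<odot> gr_map x y t) s \<and>
        is_iso (gr ?i) (gr_lift ?i (t (vfst s)) (vsnd s))"
      using l gr_lift_iso[OF i tD(5)[OF e(2)] k] s tD(2-4)[OF e(2)]
      by (simp add: e(1) comp_FO[OF m] gr_map_FO[OF t x] Rxs Rys)
  next
    fix a assume a: "a \<in> Arr (gr x)"
    then obtain u v k \<alpha> \<beta> where e: "a = garr u k \<alpha> \<beta>" "\<alpha> \<in> Arr U" "Dom U \<alpha> = u" "Cod U \<alpha> = v"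
      "u \<in> Obj U" "v \<in> Obj U" "k \<in> Obj (val x u)"
      "\<beta> \<in> Arr (val x v)" "Dom (val x v) \<beta> = FO (act x \<alpha>) k"
      by (rule gr_arrE[OF x])
    note tu = tD(2-4)[OF e(5)] and tv = tD(2-4)[OF e(6)]
    note Tu = nat_iso_Cat(1)[OF t x e(5)] and Tv = nat_iso_Cat(1)[OF t x e(6)]
    let ?l = "Cod (val x v) \<beta>"
    have l: "?l \<in> Obj (val x v)" using e val_category[OF x] by simp
    have ma: "FA (gr_map x y t) a = garr u (FO (fun_of (t u)) k) \<alpha> (FA (fun_of (t v)) \<beta>)"
      using a e gr_map_FA[OF t x] by simp
    have ma_in: "garr u (FO (fun_of (t u)) k) \<alpha> (FA (fun_of (t v)) \<beta>) \<in> Arr (gr y)"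
      using Fun_arr(1)[OF m a] ma by simp
    have Rxa: "FA (gr_reindex ?i x) a = garr (FO x u) k (FA x \<alpha>) \<beta>"
      using a Rxs by (simp add: e(1))
    have Rya: "FA (gr_reindex ?i y \<odot> gr_map x y t) a =
        garr (FO y u) (FO (fun_of (t u)) k) (FA y \<alpha>) (FA (fun_of (t v)) \<beta>)"
      using a ma ma_in Rys by (simp add: comp_FA[OF m])
    have Rxa_in: "garr (FO x u) k (FA x \<alpha>) \<beta> \<in> Arr (gr ?i)"
      using Fun_arr(1)[OF Rx a] Rxa by simp
    have Rya_in: "garr (FO y u) (FO (fun_of (t u)) k) (FA y \<alpha>) (FA (fun_of (t v)) \<beta>) \<in> Arr (gr ?i)"
      using Fun_arr(1)[OF comp_Fun[OF m Ry] a] Rya by simp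
    have xu: "FO x u \<in> Obj Cat" "FO x v \<in> Obj Cat" "FO y u \<in> Obj Cat" "FO y v \<in> Obj Cat"
      using Fun_obj[OF x] Fun_obj[OF y] e by auto
    have k': "k \<in> Obj (val ?i (Dom Cat (t u)))" and l': "?l \<in> Obj (val ?i (Dom Cat (t v)))"
      using e l tu tv xu by auto
    have lu_in: "gr_lift ?i (t u) k \<in> Arr (gr ?i)" and lv_in: "gr_lift ?i (t v) ?l \<in> Arr (gr ?i)"
      using gr_lift_arr(1)[OF i tu(1) refl k'] gr_lift_arr(1)[OF i tv(1) refl l'] by auto
    have lu: "gr_lift ?i (t u) k = garr (FO x u) k (t u) (Ident (val y u) (FO (fun_of (t u)) k))"
      and lv: "gr_lift ?i (t v) ?l = garr (FO x v) ?l (t v) (Ident (val y v) (FO (fun_of (t v)) ?l))"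
      using tu tv xu by (auto simp: gr_lift[OF i])
    have yv: "category (val y v)" "category (val y u)" using val_category[OF y] e by auto
    have ya: "act y \<alpha> \<in> Fun (val y u) (val y v)" using act_Fun[OF y e(2)] e by simp
    have Tk: "FO (fun_of (t u)) k \<in> Obj (val y u)" using Fun_obj[OF Tu] e by simp
    have "Cmp (gr ?i) (gr_lift ?i (t v) ?l) (garr (FO x u) k (FA x \<alpha>) \<beta>) =
        garr (FO x u) k (Cmp Cat (t v) (FA x \<alpha>))
          (Cmp (val y v) (Ident (val y v) (FO (fun_of (t v)) ?l)) (FA (fun_of (t v)) \<beta>))"
      using gr_Cmp[OF i Rxa_in lv_in[unfolded lv]] e tv xu by (simp add: lv Fun_rules[OF x])
    also have "\<dots> = garr (FO x u) k (Cmp Cat (FA y \<alpha>) (t u)) (FA (fun_of (t v)) \<beta>)"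
      using tD(6)[OF e(2)] e yv by (simp add: Fun_rules[OF Tv])
    also have "\<dots> = garr (FO x u) k (Cmp Cat (FA y \<alpha>) (t u)) (Cmp (val y v) (FA (fun_of (t v)) \<beta>)
          (FA (act y \<alpha>) (Ident (val y u) (FO (fun_of (t u)) k))))"
      using ma_in Tk e yv by (simp add: Fun_rules[OF ya] Fun_rules[OF Tv] gr_arr[OF y])
    also have "\<dots> = Cmp (gr ?i) (garr (FO y u) (FO (fun_of (t u)) k) (FA y \<alpha>) (FA (fun_of (t v)) \<beta>))
        (gr_lift ?i (t u) k)"
      using gr_Cmp[OF i lu_in[unfolded lu] Rya_in] e tu xu yv Tk
      by (simp add: lu Fun_rules[OF y] vcat_val)
    finally show "Cmp (gr ?i) (gr_lift ?i (t (vfst (Cod (gr x) a))) (vsnd (Cod (gr x) a)))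
        (FA (gr_reindex ?i x) a) =
      Cmp (gr ?i) (FA (gr_reindex ?i y \<odot> gr_map x y t) a)
        (gr_lift ?i (t (vfst (Dom (gr x) a))) (vsnd (Dom (gr x) a)))"
      using a e Rxa Rya by (simp add: gr_Dom[OF x] gr_Cod[OF x])
  qed
  then show ?thesis unfolding fun_iso_def by blast
qed

lemma reindex_reindex:
  assumes h: "h \<in> Fun U V" and y: "y \<in> Fun V Cat"
  shows "gr_reindex (id_fun Cat) y \<odot> gr_reindex y h = gr_reindex (id_fun Cat) (y \<odot> h)"
proof -
  have yh: "y \<odot> h \<in> Fun U Cat" using h y by (rule comp_Fun)
  let ?i = "id_fun Cat"
  note i = id_Cat_Fun
  have iy: "?i \<odot> y = y" and iyh: "?i \<odot> (y \<odot> h) = y \<odot> h" using y yh by auto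
  note Ry = gr_reindex_Fun[OF y i, unfolded iy] and Ryh = gr_reindex_Fun[OF yh i, unfolded iyh]
  note R = gr_reindex_Fun[OF h y]
  note Rys = gr_reindex_simps(1)[of _ _ ?i y, unfolded iy] gr_reindex_simps(2)[of _ _ _ _ ?i y, unfolded iy]
  note Ryhs = gr_reindex_simps(1)[of _ _ ?i "y \<odot> h", unfolded iyh]
    gr_reindex_simps(2)[of _ _ _ _ ?i "y \<odot> h", unfolded iyh]
  show ?thesis
  proof (rule gr_functor_eqI[OF yh comp_Fun[OF R Ry] Ryh])
    show "FO (gr_reindex ?i y \<odot> gr_reindex y h) (vpair u k) = FO (gr_reindex ?i (y \<odot> h)) (vpair u k)"
      if "vpair u k \<in> Obj (gr (y \<odot> h))" for u k
    proof -
      have "u \<in> Obj U" using that gr_obj[OF yh] by blast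
      then show ?thesis
        using that Fun_obj[OF R that] by (simp add: comp_FO[OF R] Rys Ryhs comp_FO[OF h])
    qed
    show "FA (gr_reindex ?i y \<odot> gr_reindex y h) (garr u k \<alpha> \<beta>) = FA (gr_reindex ?i (y \<odot> h)) (garr u k \<alpha> \<beta>)"
      if "garr u k \<alpha> \<beta> \<in> Arr (gr (y \<odot> h))" for u k \<alpha> \<beta>
    proof -
      have "u \<in> Obj U" "\<alpha> \<in> Arr U" using that Fun_catS[OF h] by (auto simp: gr_arr[OF yh])
      then show ?thesis
        using that Fun_arr(1)[OF R that]
        by (simp add: comp_FA[OF R] Rys Ryhs comp_FO[OF h] comp_FA[OF h])
    qed
  qed
qed

lemma gr_proj_flatten:
  assumes x: "x \<in> Fun U Cat" and f: "f \<in> Fun (gr x) Cat"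
  shows "gr_proj (oplax_sum x f) \<odot> flatten_fun x f = gr_proj x \<odot> gr_proj f"
proof -
  note s = oplax_sum_Fun[OF x f] and R = flatten_Fun[OF x f]
  note ps = gr_proj_Fun[OF s] and px = gr_proj_Fun[OF x] and pf = gr_proj_Fun[OF f]
  show ?thesis
  proof (rule functor_eqI[OF comp_Fun[OF R ps] comp_Fun[OF pf px]])
    fix p assume p: "p \<in> Obj (gr f)"
    then obtain q j where q: "p = vpair q j" "q \<in> Obj (gr x)" by (rule gr_objE[OF f])
    then obtain u i where e: "q = vpair u i" using gr_objE[OF x] by blast
    show "FO (gr_proj (oplax_sum x f) \<odot> flatten_fun x f) p = FO (gr_proj x \<odot> gr_proj f) p"
      using p Fun_obj[OF R p] q unfolding q(1) e
      by (simp add: comp_FO[OF R] comp_FO[OF pf] flatten_FO[OF x f] gr_proj_FO[OF x]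
          gr_proj_FO[OF f] gr_proj_FO[OF s])
  next
    fix a assume a: "a \<in> Arr (gr f)"
    then obtain u v i j k \<alpha> \<beta> \<gamma> where e: "a = garr (vpair u i) j (garr u i \<alpha> \<beta>) \<gamma>"
      "garr u i \<alpha> \<beta> \<in> Arr (gr x)" by (rule gr2_arrE[OF x f])
    show "FA (gr_proj (oplax_sum x f) \<odot> flatten_fun x f) a = FA (gr_proj x \<odot> gr_proj f) a"
      using a Fun_arr(1)[OF R a] e(2) unfolding e(1)
      by (simp add: comp_FA[OF R] comp_FA[OF pf] flatten_FA[OF x f] gr_proj_FA[OF x]
          gr_proj_FA[OF f] gr_proj_FA[OF s])
  qed
qed

lemma gr_proj_sum_act:
  assumes x: "x \<in> Fun U Cat" and f: "f \<in> Fun (gr x) Cat"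
    and \<alpha>: "\<alpha> \<in> Arr U" "Dom U \<alpha> = u" "Cod U \<alpha> = v"
  shows "gr_proj (f \<odot> fibre x v) \<odot> sum_act x f \<alpha> = act x \<alpha> \<odot> gr_proj (f \<odot> fibre x u)"
proof -
  have u: "u \<in> Obj U" and v: "v \<in> Obj U" using \<alpha> Fun_catS[OF x] by auto
  note cu = comp_fibre_Fun[OF x f u] and cv = comp_fibre_Fun[OF x f v]
  note pu = gr_proj_Fun[OF cu] and pv = gr_proj_Fun[OF cv]
  note R = sum_act_Fun[OF x f \<alpha>]
  have xa: "act x \<alpha> \<in> Fun (val x u) (val x v)" using act_Fun[OF x \<alpha>(1)] \<alpha> by simp
  show ?thesis
  proof (rule gr_functor_eqI[OF cu comp_Fun[OF R pv] comp_Fun[OF pu xa]])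
    show "FO (gr_proj (f \<odot> fibre x v) \<odot> sum_act x f \<alpha>) (vpair i j) =
        FO (act x \<alpha> \<odot> gr_proj (f \<odot> fibre x u)) (vpair i j)"
      if "vpair i j \<in> Obj (gr (f \<odot> fibre x u))" for i j
      using that Fun_obj[OF R that] \<alpha> sum_obj[OF x f u]
      by (simp add: comp_FO[OF R] comp_FO[OF pu] sum_act_FO[OF x f] gr_proj_FO[OF cu] gr_proj_FO[OF cv])
    show "FA (gr_proj (f \<odot> fibre x v) \<odot> sum_act x f \<alpha>) (garr i j b c) =
        FA (act x \<alpha> \<odot> gr_proj (f \<odot> fibre x u)) (garr i j b c)"
      if "garr i j b c \<in> Arr (gr (f \<odot> fibre x u))" for i j b c
      using that Fun_arr(1)[OF R that] \<alpha>
      by (simp add: comp_FA[OF R] comp_FA[OF pu] sum_act_FA[OF x f] gr_proj_FA[OF cu] gr_proj_FA[OF cv])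
  qed
qed

lemma iso_cancel:
  assumes C: "category C" and f: "is_iso C f" and g: "g \<in> Arr C" "Dom C g = Cod C f"
    and h: "h \<in> Arr C" "Dom C h = Cod C f" and eq: "Cmp C g f = Cmp C h f"
  shows "g = h"
proof -
  obtain f' where f': "f \<in> Arr C" "f' \<in> Arr C" "Dom C f' = Cod C f" "Cod C f' = Dom C f"
    "Cmp C f f' = Ident C (Cod C f)"
    using f by (rule is_isoE)
  have "k = Cmp C (Cmp C k f) f'" if "k \<in> Arr C" "Dom C k = Cod C f" for k
    using C f' that by (simp flip: cat_assoc)
  then show ?thesis using eq g h by metis
qed

subsection \<open>The terminal category and the unit\<close>

lemma one_cat_simps [simp]:
  "Obj one_cat = {vset {}}" "Arr one_cat = {vset {}}"
  "Ident one_cat (vset {}) = vset {}" "Dom one_cat (vset {}) = vset {}" "Cod one_cat (vset {}) = vset {}"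
  "Cmp one_cat (vset {}) (vset {}) = vset {}"
  unfolding one_cat_def by simp_all

lemma category_one_cat: "category one_cat"
  unfolding one_cat_def by (rule category_make_cat) auto

lemma small_one_cat: "small_cat (one_cat :: 'u::two_inaccessibles ucat)"
  unfolding small_cat_def
  using category_one_cat small_vset_finite[of "{} :: 'u set"]
  by (simp add: inaccessible_finite[OF kappa0_inaccessible])

lemma small_moderately_small: "small_cat C \<Longrightarrow> moderately_small_cat C"
  using small_catD unfolding moderately_small_cat_def by blast

definition to_one :: "'u::two_inaccessibles ucat \<Rightarrow> 'u func" where
  "to_one C = make_fun C one_cat (\<lambda>_. vset {}) (\<lambda>_. vset {})"

lemma to_one_Fun: "category C \<Longrightarrow> to_one C \<in> Fun C one_cat"
  unfolding to_one_def using category_one_cat by (intro make_fun_in_Fun) auto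

lemma Fun_one_unique:
  assumes G: "G \<in> Fun C one_cat" and H: "H \<in> Fun C one_cat"
  shows "G = H"
  using Fun_obj[OF G] Fun_obj[OF H] Fun_arr(1)[OF G] Fun_arr(1)[OF H]
  by (intro functor_eqI[OF G H]) simp_all

lemma iso_one_cat:
  assumes T: "T \<in> Fun C one_cat" and S: "S \<in> Fun one_cat C" and ST: "S \<odot> T = id_fun C"
  shows "\<exists>k. Obj C = {k} \<and> Arr C = {Ident C k}"
proof -
  note C = Fun_catS[OF T]
  let ?k = "FO S (vset {})"
  have k: "?k \<in> Obj C" using Fun_obj[OF S] by simp
  have "a = ?k" if a: "a \<in> Obj C" for a
    using arg_cong[OF ST, of "\<lambda>F. FO F a"] a Fun_obj[OF T a] by (simp add: comp_FO[OF T])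
  moreover have "f = Ident C ?k" if f: "f \<in> Arr C" for f
    using arg_cong[OF ST, of "\<lambda>F. FA F f"] f Fun_arr(1)[OF T f] Fun_Ident[OF S, of "vset {}"]
    by (simp add: comp_FA[OF T])
  moreover have "Ident C ?k \<in> Arr C" using k C by simp
  ultimately have "Obj C = {?k}" "Arr C = {Ident C ?k}" using k by blast+
  then show ?thesis by blast
qed

lemma unit_fun_Fun: "(unit_fun :: 'u::two_inaccessibles func) \<in> Fun one_cat (gr (id_fun Cat))"
proof -
  let ?s = "vpair (vcat one_cat) (vset {}) :: 'u"
  have "?s \<in> Obj (gr (id_fun Cat))"
    by (simp add: gr_obj[OF id_Cat_Fun] small_one_cat)
  then show ?thesis unfolding unit_fun_def Let_def
    using category_one_cat category_gr[OF id_Cat_Fun]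
    by (intro make_fun_in_Fun) auto
qed

lemma univ_opfib_Fun: "univ_opfib \<in> Fun (gr (id_fun Cat)) Cat"
  unfolding univ_opfib_def by (rule gr_proj_Fun[OF id_Cat_Fun])

lemma univ_opfib_unit: "FO univ_opfib (FO unit_fun (vset {})) = vcat one_cat"
  unfolding univ_opfib_def unit_fun_def Let_def
  by (simp add: gr_proj_FO[OF id_Cat_Fun] gr_obj[OF id_Cat_Fun] small_one_cat)

lemma Cat_adder_simps:
  "ad_obj (Cat_adder Ho eta) = Cat"
  "ad_F (Cat_adder Ho eta) = gr (id_fun Cat)"
  "ad_p (Cat_adder Ho eta) = Ho univ_opfib"
  "ad_unit (Cat_adder Ho eta) = Ho unit_fun"
  "ad_ext (Cat_adder Ho eta) = gr"
  "ad_prU (Cat_adder Ho eta) = (\<lambda>x. Ho (gr_proj x))"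
  "ad_prF (Cat_adder Ho eta) = (\<lambda>x. Ho (gr_reindex (id_fun Cat) x))"
  "ad_pair (Cat_adder Ho eta) = (\<lambda>y h. {Ho (gr_reindex y h \<odot> gr_map (Ho (y \<odot> h)) (y \<odot> h) t) |t.
                          is_nat_iso (Ho (y \<odot> h)) (y \<odot> h) t})"
  "ad_sum (Cat_adder Ho eta) = (\<lambda>x f. Ho (oplax_sum x f))"
  "ad_flat (Cat_adder Ho eta) = (\<lambda>x f. Ho (gr_map (oplax_sum x f) (Ho (oplax_sum x f)) (eta x f)
                              \<odot> flatten_fun x f))"
  unfolding Cat_adder_def by simp_all

section \<open>The category hCAT\<close>

context
  fixes Ho :: "'u::two_inaccessibles func \<Rightarrow> 'u func"
  assumes Ho: "skeleton_choice Ho"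
begin

context
  fixes C D :: "'u ucat"
  assumes C: "moderately_small_cat C" and D: "moderately_small_cat D"
begin

lemma Ho_iso: "G \<in> Fun C D \<Longrightarrow> G \<cong>\<^sub>F Ho G"
  using Ho C D unfolding skeleton_choice_def Fun_def by blast

lemma Ho_cong: "G \<in> Fun C D \<Longrightarrow> G \<cong>\<^sub>F H \<Longrightarrow> Ho G = Ho H"
  using Ho C D unfolding skeleton_choice_def Fun_def by (metis (mono_tags, lifting) mem_Collect_eq)

lemma Ho_Fun: "G \<in> Fun C D \<Longrightarrow> Ho G \<in> Fun C D"
  using Ho_iso fun_iso_Fun by blast

lemma Ho_Ho: "G \<in> Fun C D \<Longrightarrow> Ho (Ho G) = Ho G"
  using Ho_iso Ho_cong by metis

end

text \<open>
  Composition respects isomorphism of functors, so representatives may be replaced inside of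
  composites; associativity in \<open>hCAT\<close> follows from associativity of functors.
\<close>

lemma Ho_comp:
  assumes "moderately_small_cat B" and "moderately_small_cat C" and "moderately_small_cat D"
    and "F \<in> Fun B C" and "G \<in> Fun C D"
  shows "Ho (G \<odot> Ho F) = Ho (G \<odot> F)" and "Ho (Ho G \<odot> F) = Ho (G \<odot> F)"
proof -
  have GF: "G \<odot> F \<in> Fun B D" using assms comp_Fun by blast
  show "Ho (G \<odot> Ho F) = Ho (G \<odot> F)"
    using Ho_cong[OF _ _ GF] comp_cong_right[OF Ho_iso] assms by metis
  show "Ho (Ho G \<odot> F) = Ho (G \<odot> F)"
    using Ho_cong[OF _ _ GF] comp_cong_left[OF Ho_iso] assms by metis
qed

lemma hom_hCAT: "G \<in> hom (hCAT Ho) C D \<longleftrightarrow>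
    G \<in> Fun C D \<and> moderately_small_cat C \<and> moderately_small_cat D \<and> Ho G = G"
  unfolding hom_def hCAT_def Fun_def by auto

lemma Obj_hCAT: "Obj (hCAT Ho) = Collect moderately_small_cat"
  unfolding hCAT_def by simp

lemma Ho_hom:
  "moderately_small_cat C \<Longrightarrow> moderately_small_cat D \<Longrightarrow> G \<in> Fun C D \<Longrightarrow> Ho G \<in> hom (hCAT Ho) C D"
  unfolding hom_hCAT using Ho_Fun Ho_Ho by blast

lemma Cmp_hCAT:
  assumes "F \<in> hom (hCAT Ho) B C" and "G \<in> hom (hCAT Ho) C D"
  shows "Cmp (hCAT Ho) G F = Ho (G \<odot> F)"
  using assms unfolding hom_hCAT unfolding hCAT_def Fun_def by simp

lemma Cmp_hCAT_Ho:
  assumes "moderately_small_cat B" and "moderately_small_cat C" and "moderately_small_cat D"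
    and "F \<in> Fun B C" and "G \<in> Fun C D"
  shows "Cmp (hCAT Ho) (Ho G) (Ho F) = Ho (G \<odot> F)"
  using Cmp_hCAT[OF Ho_hom Ho_hom] Ho_comp Ho_Fun assms by metis

lemma category_hCAT: "category (hCAT Ho)"
  unfolding hCAT_def
proof (rule category_make_cat, goal_cases)
  case (3 C)
  then have C: "moderately_small_cat C" and "category C" by (auto simp: moderately_small_cat_def)
  then have "Ho (id_fun C) \<in> Fun C C" "Ho (Ho (id_fun C)) = Ho (id_fun C)"
    using Ho_Fun[OF C C] Ho_Ho[OF C C] by auto
  then show ?case using C by (auto simp: Fun_def)
next
  case (4 F G)
  then have "F \<in> hom (hCAT Ho) (Src F) (Src G)" "G \<in> hom (hCAT Ho) (Src G) (Tgt G)"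
    unfolding hom_hCAT Fun_def by auto
  then have "Ho (G \<odot> F) \<in> hom (hCAT Ho) (Src F) (Tgt G)"
    using Ho_hom comp_Fun unfolding hom_hCAT by blast
  then show ?case unfolding hom_hCAT Fun_def by auto
next
  case (5 F)
  then have F: "F \<in> Fun (Src F) (Tgt F)" "moderately_small_cat (Src F)" "moderately_small_cat (Tgt F)"
    "Ho F = F" by (auto simp: Fun_def)
  have "Ho (F \<odot> Ho (id_fun (Src F))) = Ho (F \<odot> id_fun (Src F))"
    by (rule Ho_comp(1)[of "Src F" "Src F" "Tgt F"]) (use F Fun_catS[OF F(1)] in auto)
  then show ?case using F comp_id_right[OF F(1)] by simp
next
  case (6 F)
  then have F: "F \<in> Fun (Src F) (Tgt F)" "moderately_small_cat (Src F)" "moderately_small_cat (Tgt F)"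
    "Ho F = F" by (auto simp: Fun_def)
  have "Ho (Ho (id_fun (Tgt F)) \<odot> F) = Ho (id_fun (Tgt F) \<odot> F)"
    by (rule Ho_comp(2)[of "Src F" "Tgt F" "Tgt F"]) (use F Fun_catT[OF F(1)] in auto)
  then show ?case using F comp_id_left[OF F(1)] by simp
next
  case (7 F G H)
  then have F: "F \<in> Fun (Src F) (Src G)" and G: "G \<in> Fun (Src G) (Src H)" and H: "H \<in> Fun (Src H) (Tgt H)"
    and ms: "moderately_small_cat (Src F)" "moderately_small_cat (Src G)"
      "moderately_small_cat (Src H)" "moderately_small_cat (Tgt H)"
    by (auto simp: Fun_def)
  show ?case
    using Ho_comp(1)[OF ms(1,3,4) comp_Fun[OF F G] H] Ho_comp(2)[OF ms(1,2,4) F comp_Fun[OF G H]]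
      comp_assoc[OF F G H] by simp
qed auto

text \<open>
  There is a single functor to \<open>one_cat\<close>, so that the representative chosen by \<open>Ho\<close> is the only
  arrow.
\<close>

lemma terminal_one_cat: "is_terminal (hCAT Ho) one_cat"
  unfolding is_terminal_def Obj_hCAT
proof (intro conjI ballI)
  fix I assume "I \<in> Collect (moderately_small_cat :: 'u ucat \<Rightarrow> bool)"
  then have I: "moderately_small_cat I" "category I" by (auto simp: moderately_small_cat_def)
  have "Ho (to_one I) \<in> hom (hCAT Ho) I one_cat"
    using I Ho_hom to_one_Fun small_one_cat small_moderately_small by blast
  then show "\<exists>!f. f \<in> hom (hCAT Ho) I one_cat"
    using Fun_one_unique unfolding hom_hCAT by blast
qed (simp add: small_one_cat small_moderately_small)

lemma ms_gr: "x \<in> hom (hCAT Ho) U Cat \<Longrightarrow> moderately_small_cat (gr x)"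
  using moderately_small_gr unfolding hom_hCAT by blast

lemma ms_gr_id: "moderately_small_cat (gr (id_fun Cat :: 'u func))"
  using moderately_small_gr[OF id_Cat_Fun moderately_small_Cat] .

lemma ms_one: "moderately_small_cat (one_cat :: 'u ucat)"
  using small_one_cat small_moderately_small by blast

text \<open>
  \<open>c\<close> is only isomorphic to the functor with constant value the terminal category. Its values are
  nevertheless isomorphic to the terminal category, and hence have just one arrow.
\<close>

lemma ad_const:
  fixes eta :: "'u func \<Rightarrow> 'u func \<Rightarrow> 'u \<Rightarrow> 'u"
  assumes x: "x \<in> hom (hCAT Ho) U Cat"
  defines "c \<equiv> ad_const (hCAT Ho) (Cat_adder Ho eta) x"
  shows "c \<in> hom (hCAT Ho) (gr x) Cat"
    and "s \<in> Obj (gr x) \<Longrightarrow> \<exists>k. Obj (val c s) = {k} \<and> Arr (val c s) = {Ident (val c s) k}"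
proof -
  note ms = ms_gr[OF x] ms_one ms_gr_id moderately_small_Cat
  let ?e = "univ_opfib \<odot> unit_fun :: 'u func"
  have e: "?e \<in> Fun one_cat Cat" using comp_Fun unit_fun_Fun univ_opfib_Fun by blast
  have G: "category (gr x)" using ms(1) unfolding moderately_small_cat_def by blast
  note t = to_one_Fun[OF G]
  have eHo: "Cmp (hCAT Ho) (Ho univ_opfib) (Ho unit_fun) = Ho ?e"
    by (rule Cmp_hCAT_Ho[OF ms(2,3,4) unit_fun_Fun univ_opfib_Fun])
  have e_hom: "Ho ?e \<in> hom (hCAT Ho) one_cat Cat" using Ho_hom[OF ms(2,4) e] .
  then have "Dom (hCAT Ho) (Ho ?e) = one_cat" unfolding hom_def by blast
  moreover have "(THE t. t \<in> hom (hCAT Ho) (gr x) one_cat) = Ho (to_one (gr x))"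
    using Ho_hom[OF ms(1,2) t] Fun_one_unique unfolding hom_hCAT by blast
  ultimately have c: "c = Ho (?e \<odot> to_one (gr x))"
    unfolding c_def ad_const_def const_map_def
    by (simp add: Cat_adder_simps eHo Cmp_hCAT_Ho[OF ms(1,2,4) t e])
  let ?k = "?e \<odot> to_one (gr x)"
  have k: "?k \<in> Fun (gr x) Cat" using comp_Fun[OF t e] .
  show c_hom: "c \<in> hom (hCAT Ho) (gr x) Cat" unfolding c using Ho_hom[OF ms(1,4) k] .
  then have cF: "c \<in> Fun (gr x) Cat" unfolding hom_hCAT by blast
  assume s: "s \<in> Obj (gr x)"
  have "c \<cong>\<^sub>F ?k" using fun_iso_sym[OF Ho_iso[OF ms(1,4) k]] c by simp
  then obtain \<tau> where \<tau>: "is_nat_iso c ?k \<tau>" unfolding fun_iso_def by blast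
  have "FO ?k s = vcat one_cat"
    using s univ_opfib_unit
    by (simp add: comp_FO[OF t] comp_FO[OF unit_fun_Fun] to_one_def)
  then have one: "val ?k s = one_cat" by (simp add: small_one_cat)
  show "\<exists>k. Obj (val c s) = {k} \<and> Arr (val c s) = {Ident (val c s) k}"
    using nat_iso_Cat[OF \<tau> cF s] unfolding one by (blast intro: iso_one_cat)
qed

context
  fixes eta :: "'u func \<Rightarrow> 'u func \<Rightarrow> 'u \<Rightarrow> 'u"
  assumes eta: "flattening_choice Ho eta"
begin

context
  fixes x f U
  assumes x: "x \<in> hom (hCAT Ho) U Cat" and f: "f \<in> hom (hCAT Ho) (gr x) Cat"
begin

lemma eta_iso: "is_nat_iso (oplax_sum x f) (Ho (oplax_sum x f)) (eta x f)"
  using eta x f unfolding flattening_choice_def by blast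

lemma sum_hom: "Ho (oplax_sum x f) \<in> hom (hCAT Ho) U Cat"
  using x f oplax_sum_Fun Ho_hom unfolding hom_hCAT by blast

lemma flat_Fun: "gr_map (oplax_sum x f) (Ho (oplax_sum x f)) (eta x f) \<odot> flatten_fun x f
    \<in> Fun (gr f) (gr (Ho (oplax_sum x f)))"
  using comp_Fun[OF flatten_Fun gr_map_Fun[OF eta_iso oplax_sum_Fun]] x f unfolding hom_hCAT by blast

end

context
  fixes x U c
  assumes x: "x \<in> hom (hCAT Ho) U Cat" and c: "c = ad_const (hCAT Ho) (Cat_adder Ho eta) x"
begin

text \<open>
  The given components of \<open>eta x c\<close> are invertible arrows to \<open>Ho (oplax_sum x c)\<close>, and by
  \<open>gr_proj_sum_act\<close> they are also natural as arrows to \<open>x\<close>. Comparing targets identifies the two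
  functors on objects, and cancelling the component at \<open>u\<close> identifies them on arrows.
\<close>

lemma sum_const: "Ho (oplax_sum x c) = x"
proof -
  have cH: "c \<in> hom (hCAT Ho) (gr x) Cat" using ad_const[OF x] c by blast
  have xF: "x \<in> Fun U Cat" and cF: "c \<in> Fun (gr x) Cat" using x cH unfolding hom_hCAT by auto
  note s = oplax_sum_Fun[OF xF cF] and t = eta_iso[OF x cH]
  note tD = nat_isoD[OF t s]
  have eta_u: "eta x c u = vfun (gr_proj (c \<odot> fibre x u))" if "u \<in> Obj U" for u
    using eta x c that unfolding flattening_choice_def by blast
  have p: "gr_proj (c \<odot> fibre x u) \<in> Fun (gr (c \<odot> fibre x u)) (val x u)"
    "small_fun (gr_proj (c \<odot> fibre x u))" if u: "u \<in> Obj U" for u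
  proof -
    note cu = comp_fibre_Fun[OF xF cF u]
    show "gr_proj (c \<odot> fibre x u) \<in> Fun (gr (c \<odot> fibre x u)) (val x u)" by (rule gr_proj_Fun[OF cu])
    then show "small_fun (gr_proj (c \<odot> fibre x u))"
      using small_gr[OF cu val_small[OF xF u]] val_small[OF xF u] small_fun_Fun by blast
  qed
  show ?thesis
  proof (rule functor_eqI[OF tD(1) xF])
    show "FO (Ho (oplax_sum x c)) u = FO x u" if u: "u \<in> Obj U" for u
      using tD(4)[OF u] p[OF u] u by (simp add: eta_u Fun_Tgt vcat_val[OF xF])
    fix \<alpha> assume \<alpha>: "\<alpha> \<in> Arr U"
    define u v where uv: "u = Dom U \<alpha>" "v = Cod U \<alpha>"
    have u: "u \<in> Obj U" and v: "v \<in> Obj U" using \<alpha> uv Fun_catS[OF xF] by auto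
    have "Cmp Cat (FA (Ho (oplax_sum x c)) \<alpha>) (eta x c u) = Cmp Cat (eta x c v) (FA (oplax_sum x c) \<alpha>)"
      using tD(6)[OF \<alpha>] uv by simp
    also have "\<dots> = Cmp Cat (vfun (gr_proj (c \<odot> fibre x v))) (vfun (sum_act x c \<alpha>))"
      using eta_u[OF v] vfun_act[OF s \<alpha>] oplax_sum_simps(2)[OF xF cF \<alpha>] by simp
    also have "\<dots> = vfun (gr_proj (c \<odot> fibre x v) \<odot> sum_act x c \<alpha>)"
      using p[OF v] act_small[OF s \<alpha>] oplax_sum_simps(2)[OF xF cF \<alpha>]
        sum_act_Fun[OF xF cF \<alpha> uv(1)[symmetric] uv(2)[symmetric]]
      by (intro Cmp_Cat) (auto simp: Fun_Src Fun_Tgt)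
    also have "\<dots> = vfun (act x \<alpha> \<odot> gr_proj (c \<odot> fibre x u))"
      using gr_proj_sum_act[OF xF cF \<alpha>] uv by simp
    also have "\<dots> = Cmp Cat (vfun (act x \<alpha>)) (vfun (gr_proj (c \<odot> fibre x u)))"
      using p[OF u] act_small[OF xF \<alpha>] act_Fun[OF xF \<alpha>] uv
      by (intro Cmp_Cat[symmetric]) (auto simp: Fun_Src Fun_Tgt)
    also have "\<dots> = Cmp Cat (FA x \<alpha>) (eta x c u)"
      using eta_u[OF u] vfun_act[OF xF \<alpha>] by simp
    finally have eq: "Cmp Cat (FA (Ho (oplax_sum x c)) \<alpha>) (eta x c u) = Cmp Cat (FA x \<alpha>) (eta x c u)" .
    have "FO (Ho (oplax_sum x c)) u = FO x u"
      using tD(4)[OF u] p[OF u] u by (simp add: eta_u Fun_Tgt vcat_val[OF xF])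
    then show "FA (Ho (oplax_sum x c)) \<alpha> = FA x \<alpha>"
      using iso_cancel[OF category_Cat tD(5)[OF u] _ _ _ _ eq] \<alpha> uv tD(4)[OF u]
        Fun_arr[OF tD(1) \<alpha>] Fun_arr[OF xF \<alpha>] by simp
  qed
qed

text \<open>
  Flattening followed by the projections takes \<open>((u, i), j)\<close> to \<open>(u, (i, j))\<close> and then to \<open>(u, i)\<close>.
\<close>

lemma flat_const: "gr_map (oplax_sum x c) (Ho (oplax_sum x c)) (eta x c) \<odot> flatten_fun x c = gr_proj c"
proof -
  have cH: "c \<in> hom (hCAT Ho) (gr x) Cat" using ad_const[OF x] c by blast
  have xF: "x \<in> Fun U Cat" and cF: "c \<in> Fun (gr x) Cat" using x cH unfolding hom_hCAT by auto
  note s = oplax_sum_Fun[OF xF cF] and t = eta_iso[OF x cH]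
  note R = flatten_Fun[OF xF cF] and m = gr_map_Fun[OF t s] and p = gr_proj_Fun[OF cF]
  have eta_u: "fun_of (eta x c u) = gr_proj (c \<odot> fibre x u)" if u: "u \<in> Obj U" for u
  proof -
    note cu = comp_fibre_Fun[OF xF cF u]
    have "eta x c u = vfun (gr_proj (c \<odot> fibre x u))"
      using eta x c that unfolding flattening_choice_def by blast
    then show ?thesis
      using small_fun_Fun[OF gr_proj_Fun[OF cu] small_gr[OF cu val_small[OF xF u]] val_small[OF xF u]]
      by simp
  qed
  show ?thesis
  proof (rule functor_eqI[OF flat_Fun[OF x cH]])
    show "gr_proj c \<in> Fun (gr c) (gr (Ho (oplax_sum x c)))" using p unfolding sum_const .
  next
    fix q assume q: "q \<in> Obj (gr c)"
    then obtain r j where r: "q = vpair r j" "r \<in> Obj (gr x)" by (rule gr_objE[OF cF])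
    then obtain u i where e: "r = vpair u i" "u \<in> Obj U" "i \<in> Obj (val x u)" using gr_objE[OF xF] by blast
    have "vpair i j \<in> Obj (gr (c \<odot> fibre x u))"
      using q e r by (simp add: sum_obj[OF xF cF] gr_obj[OF cF])
    then show "FO (gr_map (oplax_sum x c) (Ho (oplax_sum x c)) (eta x c) \<odot> flatten_fun x c) q = FO (gr_proj c) q"
      using q Fun_obj[OF R q] e r
      by (simp add: comp_FO[OF R] flatten_FO[OF xF cF] gr_map_FO[OF t s] gr_proj_FO[OF cF] eta_u
          gr_proj_FO[OF comp_fibre_Fun[OF xF cF]])
  next
    fix a assume a: "a \<in> Arr (gr c)"
    then obtain u v i j k \<alpha> \<beta> \<gamma> where e: "a = garr (vpair u i) j (garr u i \<alpha> \<beta>) \<gamma>"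
      "\<alpha> \<in> Arr U" "Dom U \<alpha> = u" "Cod U \<alpha> = v" "u \<in> Obj U" "v \<in> Obj U" "i \<in> Obj (val x u)"
      "\<beta> \<in> Arr (val x v)" "Dom (val x v) \<beta> = FO (act x \<alpha>) i" "Cod (val x v) \<beta> = k" "k \<in> Obj (val x v)"
      "garr u i \<alpha> \<beta> \<in> Arr (gr x)" "j \<in> Obj (val c (vpair u i))"
      by (rule gr2_arrE[OF xF cF])
    let ?q = "garr (FO (act x \<alpha>) i) (FO (act c (gr_lift x \<alpha> i)) j) \<beta> \<gamma>"
    have Ra: "FA (flatten_fun x c) a = garr u (vpair i j) \<alpha> ?q"
      using flatten_FA[OF xF cF] a e by simp
    have Ra_in: "garr u (vpair i j) \<alpha> ?q \<in> Arr (gr (oplax_sum x c))"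
      using Fun_arr(1)[OF R a] Ra by simp
    then have q: "?q \<in> Arr (gr (c \<odot> fibre x v))"
      using e by (simp add: gr_arr[OF s] oplax_sum_simps[OF xF cF])
    have ij: "vpair i j \<in> Obj (gr (c \<odot> fibre x u))" using e by (simp add: sum_obj[OF xF cF])
    show "FA (gr_map (oplax_sum x c) (Ho (oplax_sum x c)) (eta x c) \<odot> flatten_fun x c) a = FA (gr_proj c) a"
      using a e(2-6) Ra_in
      by (simp add: comp_FA[OF R] Ra gr_map_FA[OF t s] eta_u gr_proj_FO[OF comp_fibre_Fun[OF xF cF] ij]
          gr_proj_FA[OF comp_fibre_Fun[OF xF cF] q]) (simp add: e(1) gr_proj_FA[OF cF])
  qed
qed

end

lemma adder_data_Cat: "adder_data (hCAT Ho) (Cat_adder Ho eta)"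
proof -
  let ?C = "hCAT Ho" and ?i = "id_fun Cat :: 'u func"
  note msCat = moderately_small_Cat and i = id_Cat_Fun
  have reindex: "gr_reindex ?i x \<in> Fun (gr x) (gr ?i)" if "x \<in> Fun U Cat" for x U
    using gr_reindex_Fun[OF that i] comp_id_left[OF that] by simp
  show ?thesis
    unfolding adder_data_def Cat_adder_simps
  proof (intro conjI allI impI ballI; (elim conjE)?)
    show "category ?C" by (rule category_hCAT)
    show "Ho univ_opfib \<in> hom ?C (gr ?i) Cat" by (rule Ho_hom[OF ms_gr_id msCat univ_opfib_Fun])
    show "\<exists>t. is_terminal ?C t \<and> Ho unit_fun \<in> hom ?C t (gr ?i)"
      using terminal_one_cat Ho_hom[OF ms_one ms_gr_id unit_fun_Fun] by blast
  next
    fix U x assume x: "x \<in> hom ?C U Cat"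
    then have xF: "x \<in> Fun U Cat" and U: "moderately_small_cat U" and Hx: "Ho x = x"
      unfolding hom_hCAT by auto
    note G = ms_gr[OF x]
    show prU: "Ho (gr_proj x) \<in> hom ?C (gr x) U" by (rule Ho_hom[OF G U gr_proj_Fun[OF xF]])
    show prF: "Ho (gr_reindex ?i x) \<in> hom ?C (gr x) (gr ?i)" by (rule Ho_hom[OF G ms_gr_id reindex[OF xF]])
    have "Cmp ?C x (Ho (gr_proj x)) = Ho (x \<odot> gr_proj x)"
      using Cmp_hCAT_Ho[OF G U msCat gr_proj_Fun[OF xF] xF] Hx by simp
    also have "x \<odot> gr_proj x = univ_opfib \<odot> gr_reindex ?i x"
      using gr_proj_reindex[OF xF i] comp_id_left[OF xF] unfolding univ_opfib_def by simp
    also have "Ho \<dots> = Cmp ?C (Ho univ_opfib) (Ho (gr_reindex ?i x))"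
      using Cmp_hCAT_Ho[OF G ms_gr_id msCat reindex[OF xF] univ_opfib_Fun] by simp
    finally show "Cmp ?C x (Ho (gr_proj x)) = Cmp ?C (Ho univ_opfib) (Ho (gr_reindex ?i x))" .
    show "Ho (oplax_sum x (ad_const ?C (Cat_adder Ho eta) x)) = x"
      by (rule sum_const[OF x refl])
  next
    fix U V h y assume h: "h \<in> hom ?C U V" and y: "y \<in> hom ?C V Cat"
    then have hF: "h \<in> Fun U V" and yF: "y \<in> Fun V Cat" and U: "moderately_small_cat U"
      and V: "moderately_small_cat V" and Hh: "Ho h = h"
      unfolding hom_hCAT by auto
    note yh = comp_Fun[OF hF yF]
    show "{Ho (gr_reindex y h \<odot> gr_map (Ho (y \<odot> h)) (y \<odot> h) t) |t.
        is_nat_iso (Ho (y \<odot> h)) (y \<odot> h) t} \<noteq> {}"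
      using fun_iso_sym[OF Ho_iso[OF U msCat yh]] unfolding fun_iso_def by blast
    fix w assume "w \<in> {Ho (gr_reindex y h \<odot> gr_map (Ho (y \<odot> h)) (y \<odot> h) t) |t.
        is_nat_iso (Ho (y \<odot> h)) (y \<odot> h) t}"
    then obtain t where t: "is_nat_iso (Ho (y \<odot> h)) (y \<odot> h) t"
      and w: "w = Ho (gr_reindex y h \<odot> gr_map (Ho (y \<odot> h)) (y \<odot> h) t)" by blast
    define x where "x = Ho (y \<odot> h)"
    have xC: "Cmp ?C y h = x" unfolding x_def by (rule Cmp_hCAT[OF h y])
    have x: "x \<in> hom ?C U Cat" unfolding x_def by (rule Ho_hom[OF U msCat yh])
    then have xF: "x \<in> Fun U Cat" unfolding hom_hCAT by blast
    note t = t[folded x_def] and w = w[folded x_def]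
    note R = gr_reindex_Fun[OF hF yF] and m = gr_map_Fun[OF t xF]
    note Rm = comp_Fun[OF m R]
    note Gx = ms_gr[OF x] and Gy = ms_gr[OF y]
    show "w \<in> hom ?C (gr (Cmp ?C y h)) (gr y)"
      unfolding xC w by (rule Ho_hom[OF Gx Gy Rm])
    have "Cmp ?C (Ho (gr_proj y)) w = Ho (gr_proj y \<odot> (gr_reindex y h \<odot> gr_map x (y \<odot> h) t))"
      unfolding w by (rule Cmp_hCAT_Ho[OF Gx Gy V Rm gr_proj_Fun[OF yF]])
    also have "gr_proj y \<odot> (gr_reindex y h \<odot> gr_map x (y \<odot> h) t) = h \<odot> gr_proj x"
      using comp_assoc[OF m R gr_proj_Fun[OF yF]] gr_proj_reindex[OF hF yF]
        comp_assoc[OF m gr_proj_Fun[OF yh] hF] gr_proj_map[OF t xF] by simp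
    also have "Ho \<dots> = Cmp ?C h (Ho (gr_proj x))"
      using Cmp_hCAT_Ho[OF Gx U V gr_proj_Fun[OF xF] hF] Hh by simp
    finally show "Cmp ?C (Ho (gr_proj y)) w = Cmp ?C h (Ho (gr_proj (Cmp ?C y h)))"
      unfolding xC .
    have "Cmp ?C (Ho (gr_reindex ?i y)) w =
        Ho (gr_reindex ?i y \<odot> (gr_reindex y h \<odot> gr_map x (y \<odot> h) t))"
      unfolding w by (rule Cmp_hCAT_Ho[OF Gx Gy ms_gr_id Rm reindex[OF yF]])
    also have "gr_reindex ?i y \<odot> (gr_reindex y h \<odot> gr_map x (y \<odot> h) t) =
        gr_reindex ?i (y \<odot> h) \<odot> gr_map x (y \<odot> h) t"
      using comp_assoc[OF m R reindex[OF yF]] reindex_reindex[OF hF yF] by simp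
    also have "Ho \<dots> = Ho (gr_reindex ?i x)"
      using Ho_cong[OF Gx ms_gr_id reindex[OF xF] reindex_map_iso[OF t xF]] by simp
    finally show "Cmp ?C (Ho (gr_reindex ?i y)) w = Ho (gr_reindex ?i (Cmp ?C y h))"
      unfolding xC .
  next
    fix U x f assume x: "x \<in> hom ?C U Cat" and f: "f \<in> hom ?C (gr x) Cat"
    then have xF: "x \<in> Fun U Cat" and fF: "f \<in> Fun (gr x) Cat" and U: "moderately_small_cat U"
      unfolding hom_hCAT by auto
    let ?s = "oplax_sum x f"
    note s = oplax_sum_Fun[OF xF fF] and t = eta_iso[OF x f] and Hs = sum_hom[OF x f]
    note Gs = ms_gr[OF Hs] and Gf = ms_gr[OF f] and Gx = ms_gr[OF x]
    have HsF: "Ho ?s \<in> Fun U Cat" using Hs unfolding hom_hCAT by blast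
    note flat = flat_Fun[OF x f] and R = flatten_Fun[OF xF fF] and m = gr_map_Fun[OF t s]
    show "Ho ?s \<in> hom ?C U Cat" by (rule Hs)
    show "Ho (gr_map ?s (Ho ?s) (eta x f) \<odot> flatten_fun x f) \<in> hom ?C (gr f) (gr (Ho ?s))"
      by (rule Ho_hom[OF Gf Gs flat])
    have "Cmp ?C (Ho (gr_proj (Ho ?s))) (Ho (gr_map ?s (Ho ?s) (eta x f) \<odot> flatten_fun x f)) =
        Ho (gr_proj (Ho ?s) \<odot> (gr_map ?s (Ho ?s) (eta x f) \<odot> flatten_fun x f))"
      by (rule Cmp_hCAT_Ho[OF Gf Gs U flat gr_proj_Fun[OF HsF]])
    also have "gr_proj (Ho ?s) \<odot> (gr_map ?s (Ho ?s) (eta x f) \<odot> flatten_fun x f) = gr_proj x \<odot> gr_proj f"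
      using comp_assoc[OF R m gr_proj_Fun[OF HsF]] gr_proj_map[OF t s] gr_proj_flatten[OF xF fF] by simp
    also have "Ho \<dots> = Cmp ?C (Ho (gr_proj x)) (Ho (gr_proj f))"
      using Cmp_hCAT_Ho[OF Gf Gx U gr_proj_Fun[OF fF] gr_proj_Fun[OF xF]] by simp
    finally show "Cmp ?C (Ho (gr_proj (Ho ?s))) (Ho (gr_map ?s (Ho ?s) (eta x f) \<odot> flatten_fun x f)) =
        Cmp ?C (Ho (gr_proj x)) (Ho (gr_proj f))" .
  qed
qed

text \<open>
  The form in which left Kan extensions are used in \<open>hCAT\<close>, where \<open>f'\<close> is the representative of a
  composite \<open>f\<close>.
\<close>

lemma Ho_colim_sum:
  assumes co: "cocomplete M" and M: "moderately_small_cat M" and U: "moderately_small_cat U"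
    and x: "x \<in> Fun U Cat" and f: "f \<in> Fun (gr x) M" and f': "f' \<cong>\<^sub>F f"
    and K: "is_left_kan x f G c"
  shows "Ho (colim_sum x f') = Ho G"
proof -
  have f'F: "f' \<in> Fun (gr x) M" using fun_iso_Fun[OF fun_iso_sym[OF f'] f] .
  obtain s where "is_nat_iso f' f s" using f' unfolding fun_iso_def by blast
  note K' = left_kan_iso[OF x f K this f'F] and L = left_kan_colim_sum[OF x f'F co]
  show ?thesis
    using Ho_cong[OF U M left_kanD(1)[OF x f'F L] left_kan_unique[OF x f'F L K']] .
qed

end

end

section \<open>The module of a cocomplete category\<close>

theorem mainTheorem7:
  fixes M :: "'u::two_inaccessibles ucat"
    and Ho :: "'u func \<Rightarrow> 'u func"
    and eta :: "'u func \<Rightarrow> 'u func \<Rightarrow> 'u \<Rightarrow> 'u"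
  assumes "skeleton_choice Ho"
    and "flattening_choice Ho eta"
    and "moderately_small_cat M"
    and "cocomplete M"
  shows "dependent_right_module (hCAT Ho) (Cat_adder Ho eta) M (\<lambda>x f. Ho (colim_sum x f))"
proof -
  note Ho = assms(1) and eta = assms(2) and M = assms(3) and co = assms(4)
  let ?C = "hCAT Ho"
  note hom = hom_hCAT[OF Ho] and msCat = moderately_small_Cat
  have kan: "is_left_kan x k (colim_sum x k) (\<lambda>p. colim_in (k \<odot> fibre x (vfst p)) (vsnd p))"
    if "x \<in> Fun U Cat" "k \<in> Fun (gr x) M" for U x k
    using left_kan_colim_sum[OF that co] .
  have sum_Fun: "colim_sum x k \<in> Fun U M" if "x \<in> Fun U Cat" "k \<in> Fun (gr x) M" for U x k
    using left_kanD(1)[OF that kan[OF that]] .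
  show ?thesis
    unfolding dependent_right_module_def Cat_adder_simps
  proof (intro conjI allI impI; (elim conjE)?)
    show "adder_data ?C (Cat_adder Ho eta)" by (rule adder_data_Cat[OF Ho eta])
    show "M \<in> Obj ?C" unfolding Obj_hCAT[OF Ho] using M by simp
  next
    fix U x k assume "x \<in> hom ?C U Cat" and "k \<in> hom ?C (gr x) M"
    then show "Ho (colim_sum x k) \<in> hom ?C U M"
      using Ho_hom[OF Ho _ M] sum_Fun unfolding hom by blast
  next
    fix U V h x y k w
    assume h: "h \<in> hom ?C U V" and y: "y \<in> hom ?C V Cat" and xC: "Cmp ?C y h = x"
      and k: "k \<in> hom ?C (gr y) M"
      and w: "w \<in> {Ho (gr_reindex y h \<odot> gr_map (Ho (y \<odot> h)) (y \<odot> h) t) |t.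
        is_nat_iso (Ho (y \<odot> h)) (y \<odot> h) t}"
    have hF: "h \<in> Fun U V" and yF: "y \<in> Fun V Cat" and U: "moderately_small_cat U"
      and V: "moderately_small_cat V" and Hh: "Ho h = h" and kF: "k \<in> Fun (gr y) M" and Hk: "Ho k = k"
      using h y k unfolding hom by auto
    note yh = comp_Fun[OF hF yF]
    have xHo: "Ho (y \<odot> h) = x" using Cmp_hCAT[OF Ho h y] xC by simp
    then have x: "x \<in> hom ?C U Cat" using Ho_hom[OF Ho U msCat yh] by simp
    then have xF: "x \<in> Fun U Cat" unfolding hom by blast
    obtain t where t: "is_nat_iso x (y \<odot> h) t"
      and w: "w = Ho (gr_reindex y h \<odot> gr_map x (y \<odot> h) t)" using w xHo by blast
    note R = gr_reindex_Fun[OF hF yF] and m = gr_map_Fun[OF t xF]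
    note Rm = comp_Fun[OF m R] and Gx = ms_gr[OF Ho x] and Gy = ms_gr[OF Ho y]
    let ?k = "(k \<odot> gr_reindex y h) \<odot> gr_map x (y \<odot> h) t"
    have kF': "?k \<in> Fun (gr x) M" using comp_Fun[OF m comp_Fun[OF R kF]] .
    have "Cmp ?C k w = Ho (k \<odot> (gr_reindex y h \<odot> gr_map x (y \<odot> h) t))"
      using Cmp_hCAT_Ho[OF Ho Gx Gy M Rm kF] Hk w by simp
    then have kw: "Cmp ?C k w = Ho ?k" using comp_assoc[OF m R kF] by simp
    have "Ho (colim_sum x (Ho ?k)) = Ho (colim_sum y k \<odot> h)"
      by (rule Ho_colim_sum[OF Ho eta co M U xF kF' fun_iso_sym[OF Ho_iso[OF Ho Gx M kF']]
          left_kan_gr_map[OF t xF comp_Fun[OF R kF] left_kan_reindex[OF hF yF kF kan[OF yF kF]]]])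
    also have "\<dots> = Cmp ?C (Ho (colim_sum y k)) h"
      using Cmp_hCAT_Ho[OF Ho U V M hF sum_Fun[OF yF kF]] Hh by simp
    finally show "Ho (colim_sum x (Cmp ?C k w)) = Cmp ?C (Ho (colim_sum y k)) h"
      unfolding kw .
  next
    fix U x f assume x: "x \<in> hom ?C U Cat" and f: "f \<in> hom ?C (gr x) M"
    have fF: "f \<in> Fun (gr x) M" and Hf: "Ho f = f" using f unfolding hom by auto
    define c where "c = ad_const ?C (Cat_adder Ho eta) x"
    have c: "c \<in> hom ?C (gr x) Cat" unfolding c_def by (rule ad_const(1)[OF Ho x])
    then have cF: "c \<in> Fun (gr x) Cat" unfolding hom by blast
    note Gx = ms_gr[OF Ho x] and Gc = ms_gr[OF Ho c] and p = gr_proj_Fun[OF cF]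
    have flat: "gr_map (oplax_sum x c) (Ho (oplax_sum x c)) (eta x c) \<odot> flatten_fun x c = gr_proj c"
      by (rule flat_const[OF Ho eta x c_def])
    have fp: "f \<odot> gr_proj c \<in> Fun (gr c) M" using comp_Fun[OF p fF] .
    have "Cmp ?C f (Ho (gr_proj c)) = Ho (f \<odot> gr_proj c)"
      using Cmp_hCAT_Ho[OF Ho Gc Gx M p fF] Hf by simp
    moreover have "Ho (colim_sum c (Ho (f \<odot> gr_proj c))) = Ho f"
      by (rule Ho_colim_sum[OF Ho eta co M Gx cF fp fun_iso_sym[OF Ho_iso[OF Ho Gc M fp]]
          left_kan_unit[OF cF fF ad_const(2)[OF Ho x, where eta = eta, folded c_def]]])
    ultimately show "Ho (colim_sum (ad_const ?C (Cat_adder Ho eta) x)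
        (Cmp ?C f (Ho (gr_map (oplax_sum x (ad_const ?C (Cat_adder Ho eta) x))
          (Ho (oplax_sum x (ad_const ?C (Cat_adder Ho eta) x)))
          (eta x (ad_const ?C (Cat_adder Ho eta) x)) \<odot>
          flatten_fun x (ad_const ?C (Cat_adder Ho eta) x))))) = f"
      unfolding c_def[symmetric] flat using Hf by simp
  next
    fix U x f g assume x: "x \<in> hom ?C U Cat" and f: "f \<in> hom ?C (gr x) Cat"
      and g: "g \<in> hom ?C (gr (Ho (oplax_sum x f))) M"
    have xF: "x \<in> Fun U Cat" and fF: "f \<in> Fun (gr x) Cat" and U: "moderately_small_cat U"
      and gF: "g \<in> Fun (gr (Ho (oplax_sum x f))) M" and Hg: "Ho g = g"
      using x f g unfolding hom by auto
    let ?s = "oplax_sum x f"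
    let ?m = "gr_map ?s (Ho ?s) (eta x f)"
    note s = oplax_sum_Fun[OF xF fF] and t = eta_iso[OF Ho eta x f] and Hs = sum_hom[OF Ho eta x f]
    have HsF: "Ho ?s \<in> Fun U Cat" using Hs unfolding hom by blast
    note Gs = ms_gr[OF Ho Hs] and Gf = ms_gr[OF Ho f] and Gx = ms_gr[OF Ho x]
    note R = flatten_Fun[OF xF fF] and m = gr_map_Fun[OF t s] and flat = flat_Fun[OF Ho eta x f]
    note gm = comp_Fun[OF m gF]
    note gmR = comp_Fun[OF R gm]
    let ?q = "Ho ((g \<odot> ?m) \<odot> flatten_fun x f)"
    have "Cmp ?C g (Ho (?m \<odot> flatten_fun x f)) = Ho (g \<odot> (?m \<odot> flatten_fun x f))"
      using Cmp_hCAT_Ho[OF Ho Gf Gs M flat gF] Hg by simp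
    then have q: "Cmp ?C g (Ho (?m \<odot> flatten_fun x f)) = ?q" using comp_assoc[OF R m gF] by simp
    have qF: "?q \<in> Fun (gr f) M" and q_iso: "(g \<odot> ?m) \<odot> flatten_fun x f \<cong>\<^sub>F ?q"
      using Ho_Fun[OF Ho Gf M gmR] Ho_iso[OF Ho Gf M gmR] by auto
    let ?K = "colim_sum f ?q"
    note KF = sum_Fun[OF fF qF]
    obtain r where "is_nat_iso ((g \<odot> ?m) \<odot> flatten_fun x f) ?q r"
      using q_iso unfolding fun_iso_def by blast
    \<comment> \<open>\<open>A\<close> and \<open>B\<close> exhibit both sides as extensions of \<open>g \<odot> ?m\<close> along the projection from
      the oplax colimit of \<open>?s\<close>; \<open>?m\<close> compares it with \<open>\<lbrakk>Ho ?s\<rbrakk>\<close>\<close>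
    note K = left_kan_iso[OF fF qF kan[OF fF qF] this gmR]
    note A = left_kan_flatten[OF xF fF gm K kan[OF xF KF]]
    note B = left_kan_gr_map[OF t s gF kan[OF HsF gF]]
    have "Ho (colim_sum (Ho ?s) g) = Ho (colim_sum x ?K)"
      using Ho_cong[OF Ho U M sum_Fun[OF HsF gF] left_kan_unique[OF s gm B A]] .
    also have "\<dots> = Ho (colim_sum x (Ho ?K))"
      using Ho_colim_sum[OF Ho eta co M U xF KF fun_iso_sym[OF Ho_iso[OF Ho Gx M KF]] kan[OF xF KF]]
      by simp
    finally show "Ho (colim_sum (Ho ?s) g) =
        Ho (colim_sum x (Ho (colim_sum f (Cmp ?C g (Ho (?m \<odot> flatten_fun x f))))))"
      unfolding q .
  qed
qed

end
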